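(* Let $m\ge 2$, let $d_1,\dots,d_m\ge1$ be integers, $d=d_1+\cdots+d_m$. There are constants $c_{m,d},C_{m,d}>0$, depending only on $m$ and $d$, such that the following holds. Let $\mathcal D=\mathcal D^1\times\cdots\times\mathcal D^m$ be a product of dyadic cube grids $\mathcal D^i$ in $\mathbb R^{d_i}$, let $\eta\in(0,1]$, and let $\mathcal G\subset\mathcal D$ be incomparable and $\eta$-sparse, with finite shadow, i.e. $|\mathrm{sh}(\mathcal G)|<\infty$. Then $$\|h_{\mathcal G}\|_q\le C_{m,d}\,\eta^{-1}q^{m-1}|\mathrm{sh}(\mathcal G)|^{1/q},\qquad 2\le q<\infty,$$ where $\|\cdot\|_q$ is the $L^q(\mathbb R^d)$ norm, and $$\int_{\mathrm{sh}(\mathcal G)}\left[\exp\left(c_{m,d}(\eta h_{\mathcal G})^{1/(m-1)}\right)-1\right]\le C_{m,d}|\mathrm{sh}(\mathcal G)|.$$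
   Context: A dyadic (cube) grid in $\mathbb R^n$ is a collection of half-open axis-parallel cubes with side lengths $2^k$, $k\in\mathbb Z$, such that for every $k\in\mathbb Z$ the cubes of side length $2^k$ in the collection partition $\mathbb R^n$, and any two intersecting cubes of the collection are nested. Elements of $\mathcal D=\mathcal D^1\times\cdots\times\mathcal D^m$ are the rectangles $I=I^1\times\cdots\times I^m\subset\mathbb R^d=\mathbb R^{d_1}\times\cdots\times\mathbb R^{d_m}$ with $I^i\in\mathcal D^i$. For $\mathcal G\subset\mathcal D$, $$h_{\mathcal G}=\sum_{I\in\mathcal G}\mathbf 1_I,\qquad \mathrm{sh}(\mathcal G)=\bigcup_{I\in\mathcal G}I.$$ $\mathcal G$ is incomparable if no two distinct members contain one another (i.e. $I,J\in\mathcal G$, $I\subset J$ implies $I=J$). $\mathcal G$ is $\eta$-sparse if there are pairwise disjoint measurable sets $E_I\subset I$, $I\in\mathcal G$, with $|E_I|\ge\eta|I|$. $|\cdot|$ is Lebesgue measure. *)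

theory Defs
  imports "HOL-Analysis.Analysis"
begin

(* The dimensions are natural numbers that vary inside the theorem (the constants depend on
   the total dimension only, not on the way it is split up), so R^n is modelled as the set of
   extensional functions on {..<n}, and R^(d 0) x ... x R^(d (m-1)) as the iterated extensional
   product; these are exactly the spaces of the library's product measures. *)

definition Rn :: "nat \<Rightarrow> (nat \<Rightarrow> real) set"
  where "Rn n = ({..<n} \<rightarrow>\<^sub>E UNIV)"

(* Lebesgue measure is the completion: the pieces in the definition of sparseness may be
   arbitrary Lebesgue measurable sets, not only Borel sets. *)
definition lebesgue_prod :: "nat \<Rightarrow> (nat \<Rightarrow> nat) \<Rightarrow> (nat \<Rightarrow> nat \<Rightarrow> real) measure"
  where "lebesgue_prod m d =
    completion (\<Pi>\<^sub>M i\<in>{..<m}. \<Pi>\<^sub>M j\<in>{..<d i}. (lborel :: real measure))"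

lemma space_lebesgue_prod: "space (lebesgue_prod m d) = (\<Pi>\<^sub>E i\<in>{..<m}. Rn (d i))"
  by (simp add: lebesgue_prod_def Rn_def space_PiM)

lemma emeasure_lebesgue_prod_box:
  assumes "\<And>i j. i < m \<Longrightarrow> j < d i \<Longrightarrow> a i j \<le> b i j"
  shows "emeasure (lebesgue_prod m d) (\<Pi>\<^sub>E i\<in>{..<m}. \<Pi>\<^sub>E j\<in>{..<d i}. {a i j..<b i j})
    = ennreal (\<Prod>i<m. \<Prod>j<d i. b i j - a i j)"
proof -
  interpret inner: product_sigma_finite "\<lambda>_::nat. lborel :: real measure" ..
  interpret outer: product_sigma_finite "\<lambda>i. \<Pi>\<^sub>M j\<in>{..<d i}. (lborel :: real measure)"
    by (simp add: product_sigma_finite_def inner.sigma_finite)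
  have inner_sets: "(\<Pi>\<^sub>E j\<in>{..<d i}. {a i j..<b i j})
      \<in> sets (\<Pi>\<^sub>M j\<in>{..<d i}. (lborel :: real measure))" for i
    by (rule sets_PiM_I_finite) auto
  have "emeasure (lebesgue_prod m d) (\<Pi>\<^sub>E i\<in>{..<m}. \<Pi>\<^sub>E j\<in>{..<d i}. {a i j..<b i j})
      = emeasure (\<Pi>\<^sub>M i\<in>{..<m}. \<Pi>\<^sub>M j\<in>{..<d i}. (lborel :: real measure))
          (\<Pi>\<^sub>E i\<in>{..<m}. \<Pi>\<^sub>E j\<in>{..<d i}. {a i j..<b i j})"
    unfolding lebesgue_prod_def
    using inner_sets by (simp add: main_part sets_PiM_I_finite)
  also have "\<dots> = (\<Prod>i<m. emeasure (\<Pi>\<^sub>M j\<in>{..<d i}. (lborel :: real measure))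
          (\<Pi>\<^sub>E j\<in>{..<d i}. {a i j..<b i j}))"
    using inner_sets by (intro outer.emeasure_PiM) auto
  also have "\<dots> = (\<Prod>i<m. \<Prod>j<d i. emeasure lborel {a i j..<b i j})"
    by (intro prod.cong refl inner.emeasure_PiM) auto
  also have "\<dots> = (\<Prod>i<m. \<Prod>j<d i. ennreal (b i j - a i j))"
    using assms by (intro prod.cong refl) simp
  also have "\<dots> = (\<Prod>i<m. ennreal (\<Prod>j<d i. b i j - a i j))"
    using assms by (intro prod.cong[OF refl] prod_ennreal) simp
  also have "\<dots> = ennreal (\<Prod>i<m. \<Prod>j<d i. b i j - a i j)"
    using assms by (intro prod_ennreal prod_nonneg) simp
  finally show ?thesis .
qed

definition half_open_cube :: "nat \<Rightarrow> (nat \<Rightarrow> real) \<Rightarrow> real \<Rightarrow> (nat \<Rightarrow> real) set"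
  where "half_open_cube n a l = (\<Pi>\<^sub>E j\<in>{..<n}. {a j..<a j + l})"

definition dyadic_grid :: "nat \<Rightarrow> (nat \<Rightarrow> real) set set \<Rightarrow> bool"
  where "dyadic_grid n \<D> \<longleftrightarrow>
    (\<forall>Q\<in>\<D>. \<exists>(k::int) a. Q = half_open_cube n a (2 powi k)) \<and>
    (\<forall>k::int. partition_on (Rn n) {Q\<in>\<D>. \<exists>a. Q = half_open_cube n a (2 powi k)}) \<and>
    (\<forall>Q\<in>\<D>. \<forall>R\<in>\<D>. Q \<inter> R \<noteq> {} \<longrightarrow> Q \<subseteq> R \<or> R \<subseteq> Q)"

definition dyadic_rectangles ::
    "nat \<Rightarrow> (nat \<Rightarrow> (nat \<Rightarrow> real) set set) \<Rightarrow> (nat \<Rightarrow> nat \<Rightarrow> real) set set"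
  where "dyadic_rectangles m \<D> =
    {\<Pi>\<^sub>E i\<in>{..<m}. Q i | Q. \<forall>i<m. Q i \<in> \<D> i}"

definition shadow :: "'a set set \<Rightarrow> 'a set"
  where "shadow \<G> = \<Union>\<G>"

(* Values in ennreal, since infinitely many rectangles may overlap at a point. *)
definition counting_function :: "'a set set \<Rightarrow> 'a \<Rightarrow> ennreal"
  where "counting_function \<G> x = (\<Sum>\<^sub>\<infinity>I\<in>\<G>. indicator I x)"

definition incomparable :: "'a set set \<Rightarrow> bool"
  where "incomparable \<G> \<longleftrightarrow> (\<forall>I\<in>\<G>. \<forall>J\<in>\<G>. I \<subseteq> J \<longrightarrow> I = J)"

definition sparse_family :: "'a measure \<Rightarrow> real \<Rightarrow> 'a set set \<Rightarrow> bool"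
  where "sparse_family M \<eta> \<G> \<longleftrightarrow>
    (\<exists>E. disjoint_family_on E \<G> \<and>
      (\<forall>I\<in>\<G>. E I \<in> sets M \<and> E I \<subseteq> I \<and> ennreal \<eta> * emeasure M I \<le> emeasure M (E I)))"

(* Used for positive exponents only. *)
definition ennreal_powr :: "ennreal \<Rightarrow> real \<Rightarrow> ennreal"
  where "ennreal_powr x p = (if x = \<infinity> then \<infinity> else ennreal (enn2real x powr p))"

definition ennreal_exp :: "ennreal \<Rightarrow> ennreal"
  where "ennreal_exp x = (if x = \<infinity> then \<infinity> else ennreal (exp (enn2real x)))"

definition Lq_norm :: "'a measure \<Rightarrow> real \<Rightarrow> ('a \<Rightarrow> ennreal) \<Rightarrow> ennreal"
  where "Lq_norm M q f = ennreal_powr (\<integral>\<^sup>+x. ennreal_powr (f x) q \<partial>M) (1 / q)"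

end

theory Submission
  imports Defs
begin

text \<open>
  The heart of the matter is a level set estimate: for every natural number K, the set on which
  \<open>h\<close> exceeds a constant times \<open>(K + 1)\<^sup>m\<^sup>-\<^sup>1 / \<eta>\<close> has measure at most \<open>4\<^sup>-\<^sup>K |sh|\<close>. Both assertions of the
  theorem follow from it by summing over K.

  For a finite family, only the finitely many atoms of each coordinate matter, so the estimate lives
  on a finite weighted product space. Testing sparseness against the rectangle averages, one
  coordinate at a time (dual Doob inequality), gives moment bounds for the counting function of each
  subfamily, and hence a Gram bound for the overlaps of two subfamilies. Given a set A, cut each
  \<open>A \<inter> R\<^sub>k\<close> into pieces according to its type \<open>\<beta> \<in> \<nat>\<^sup>m\<close>, which records base 4 logarithms of the
  relative lengths of the coordinate fibres. A nonempty piece of type \<open>\<beta>\<close> has relative measure comparable with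
  \<open>4\<close> to the power \<open>-|\<beta>|\<close>, and its fibres are correspondingly thin. If \<open>R\<^sub>k\<close> and \<open>R\<^sub>l\<close> meet and neither contains the other,
  some side of \<open>R\<^sub>l\<close> is strictly shorter than that of \<open>R\<^sub>k\<close>; there the fibres of a piece whose type is
  shifted by \<open>c\<close> along the diagonal are thinner by \<open>4\<^sup>c\<close>. So pieces on one diagonal
  \<open>d + \<nat>(1,\<dots>,1)\<close> are almost orthogonal and their total mass is at most a constant
  times \<open>|A| / \<eta>\<close>. Only about \<open>(K + 1)\<^sup>m\<^sup>-\<^sup>1\<close> diagonals have starting points with all entries at most K, and
  the others contribute at most about \<open>4\<^sup>-\<^sup>K |sh| / \<eta>\<close>. Taking A to be the level set gives the estimate.
\<close>

section \<open>The dual Doob inequality\<close>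

text \<open>Discrete form of integrating the derivative of \<open>t ^ Suc n\<close>. A smallest set
  of the chain is split off: every other set contains it, so its inner sum is the full sum, and
  passing from \<open>t\<close> to \<open>a k + t\<close> raises the power by at most
  \<open>Suc n\<close> times \<open>a k * (a k + t) ^ n\<close>.\<close>

lemma power_sum_chain_le:
  fixes a :: "'k \<Rightarrow> real" and L :: "'k \<Rightarrow> 'a set"
  assumes "finite S" "\<And>k. k \<in> S \<Longrightarrow> 0 \<le> a k" "\<And>k. k \<in> S \<Longrightarrow> finite (L k)"
    and "\<And>k l. k \<in> S \<Longrightarrow> l \<in> S \<Longrightarrow> L k \<subseteq> L l \<or> L l \<subseteq> L k"
  shows "(\<Sum>k\<in>S. a k) ^ Suc n \<le> real (Suc n) * (\<Sum>k\<in>S. a k * (\<Sum>l\<in>{l\<in>S. L k \<subseteq> L l}. a l) ^ n)"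
  using assms
proof (induction "card S" arbitrary: S)
  case 0
  then show ?case by simp
next
  case (Suc N)
  then have "S \<noteq> {}" by auto
  then obtain k where k: "k \<in> S" "\<And>l. l \<in> S \<Longrightarrow> card (L k) \<le> card (L l)"
    using ex_min_if_finite[of "(\<lambda>k. card (L k)) ` S"] Suc.prems(1) by (auto simp: not_less)
  have kl: "L k \<subseteq> L l" if "l \<in> S" for l
  proof (cases "L l \<subseteq> L k")
    case True
    then have "L l = L k"
      using k(2)[OF that] Suc.prems(3)[OF k(1)] by (simp add: card_seteq)
    then show ?thesis by simp
  qed (use Suc.prems(4)[OF that k(1)] in auto)
  let ?S = "S - {k}"
  let ?t = "\<Sum>l\<in>?S. a l"
  have tot: "(\<Sum>l\<in>S. a l) = a k + ?t"
    using Suc.prems(1) k(1) by (simp add: sum.remove)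
  have t0: "0 \<le> ?t" using Suc.prems(2) by (intro sum_nonneg) auto
  have ak: "0 \<le> a k" using Suc.prems(2) k(1) by simp
  have IH: "?t ^ Suc n \<le> real (Suc n) * (\<Sum>j\<in>?S. a j * (\<Sum>l\<in>{l\<in>?S. L j \<subseteq> L l}. a l) ^ n)"
    using Suc.hyps(2) Suc.prems k(1) by (intro Suc.hyps(1)) auto
  \<comment> \<open>Returning from \<open>?S\<close> to \<open>S\<close> can only add the
    nonnegative term \<open>a k\<close> to an inner sum.\<close>
  also have "\<dots> \<le> real (Suc n) * (\<Sum>j\<in>?S. a j * (\<Sum>l\<in>{l\<in>S. L j \<subseteq> L l}. a l) ^ n)"
    using Suc.prems(1,2)
    by (intro mult_left_mono sum_mono mult_left_mono power_mono sum_mono2 sum_nonneg) auto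
  finally have 1: "?t ^ Suc n \<le> real (Suc n) * (\<Sum>j\<in>?S. a j * (\<Sum>l\<in>{l\<in>S. L j \<subseteq> L l}. a l) ^ n)" .
  have "(a k + ?t) ^ Suc n - ?t ^ Suc n \<le> real (Suc n) * (a k * (a k + ?t) ^ n)"
  proof -
    have "(a k + ?t) ^ Suc n - ?t ^ Suc n
        = a k * (\<Sum>i<Suc n. ?t ^ (n - i) * (a k + ?t) ^ i)"
      using power_diff_sumr2[of "a k + ?t" "Suc n" ?t] by (simp del: sum.lessThan_Suc)
    also have "\<dots> \<le> a k * (\<Sum>i<Suc n. (a k + ?t) ^ n)"
    proof -
      have "?t ^ (n - i) * (a k + ?t) ^ i \<le> (a k + ?t) ^ n" if "i < Suc n" for i
      proof -
        have "?t ^ (n - i) * (a k + ?t) ^ i \<le> (a k + ?t) ^ (n - i) * (a k + ?t) ^ i"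
          using t0 ak by (intro mult_right_mono power_mono) auto
        also have "\<dots> = (a k + ?t) ^ n" using that by (simp flip: power_add)
        finally show ?thesis .
      qed
      then show ?thesis using ak by (intro mult_left_mono sum_mono) auto
    qed
    also have "\<dots> = real (Suc n) * (a k * (a k + ?t) ^ n)"
      by (simp only: sum_constant card_lessThan mult.left_commute)
    finally show ?thesis .
  qed
  moreover have "{l\<in>S. L k \<subseteq> L l} = S" using kl by auto
  ultimately show ?case
    using 1 Suc.prems(1) k(1) tot
    by (simp add: sum.remove[of S k "\<lambda>j. a j * (\<Sum>l\<in>{l\<in>S. L j \<subseteq> L l}. a l) ^ n"] distrib_left)
qed

text \<open>The sets containing a given point form a chain, so \<open>power_sum_chain_le\<close>
  applies pointwise. Its inner sums \<open>s k\<close> are constant on \<open>L k\<close>, hence the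
  average \<open>a k\<close> may be replaced by \<open>u k\<close> itself under the sum over
  \<open>L k\<close>, and \<open>s k\<close> is at most \<open>h\<close> there. What remains is
  \<open>N\<close> times the integral of \<open>U * h ^ n\<close>, and half of the integral of
  \<open>h ^ N\<close> is absorbed.\<close>

lemma dual_doob:
  fixes \<mu> :: "'a \<Rightarrow> real" and u :: "'k \<Rightarrow> 'a \<Rightarrow> real" and L :: "'k \<Rightarrow> 'a set"
  assumes fin: "finite X" "finite G" and \<mu>: "\<And>x. x \<in> X \<Longrightarrow> 0 \<le> \<mu> x"
    and L: "\<And>k. k \<in> G \<Longrightarrow> L k \<subseteq> X" "\<And>k. k \<in> G \<Longrightarrow> 0 < sum \<mu> (L k)"
    and lam: "\<And>k l. k \<in> G \<Longrightarrow> l \<in> G \<Longrightarrow> L k \<inter> L l \<noteq> {} \<Longrightarrow> L k \<subseteq> L l \<or> L l \<subseteq> L k"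
    and u: "\<And>k x. k \<in> G \<Longrightarrow> x \<in> X \<Longrightarrow> 0 \<le> u k x"
    and N: "N = Suc n"
  shows "(\<Sum>x\<in>X. \<mu> x * (\<Sum>k\<in>G. if x \<in> L k then (\<Sum>w\<in>L k. \<mu> w * u k w) / sum \<mu> (L k) else 0) ^ N)
    \<le> real (2 * N) ^ N * (\<Sum>x\<in>X. \<mu> x * (\<Sum>k\<in>G. u k x) ^ N)"
proof -
  define a where "a k = (\<Sum>w\<in>L k. \<mu> w * u k w) / sum \<mu> (L k)" for k
  define h where "h x = (\<Sum>k\<in>G. if x \<in> L k then a k else 0)" for x
  define U where "U x = (\<Sum>k\<in>G. u k x)" for x
  define s where "s k = (\<Sum>l\<in>{l\<in>G. L k \<subseteq> L l}. a l)" for k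
  have a0: "0 \<le> a k" if "k \<in> G" for k
    unfolding a_def using L[OF that] \<mu> u[OF that]
    by (intro divide_nonneg_pos sum_nonneg mult_nonneg_nonneg) auto
  have s0: "0 \<le> s k" if "k \<in> G" for k
    unfolding s_def using a0 by (intro sum_nonneg) auto
  have h0: "0 \<le> h x" for x unfolding h_def using a0 by (intro sum_nonneg) auto
  have U0: "0 \<le> U x" if "x \<in> X" for x unfolding U_def using u that by (intro sum_nonneg) auto
  have h_eq: "h x = (\<Sum>k\<in>{k\<in>G. x \<in> L k}. a k)" for x
    unfolding h_def using fin(2) by (simp add: sum.If_cases Int_def)
  have s_le: "s k \<le> h x" if "k \<in> G" "x \<in> L k" for k x
    unfolding s_def h_eq using that a0 fin(2) by (intro sum_mono2) auto
  have pt: "h x ^ N \<le> real N * (\<Sum>k\<in>G. if x \<in> L k then a k * s k ^ n else 0)" for x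
  proof -
    let ?S = "{k\<in>G. x \<in> L k}"
    have "h x ^ N \<le> real N * (\<Sum>k\<in>?S. a k * (\<Sum>l\<in>{l\<in>?S. L k \<subseteq> L l}. a l) ^ n)"
      unfolding h_eq N
    proof (rule power_sum_chain_le)
      show "L k \<subseteq> L l \<or> L l \<subseteq> L k" if "k \<in> ?S" "l \<in> ?S" for k l
        using lam[of k l] that by blast
    qed (use fin a0 finite_subset[OF L(1) fin(1)] in auto)
    also have "(\<Sum>k\<in>?S. a k * (\<Sum>l\<in>{l\<in>?S. L k \<subseteq> L l}. a l) ^ n) = (\<Sum>k\<in>?S. a k * s k ^ n)"
    proof (intro sum.cong refl)
      fix k assume "k \<in> ?S"
      then have "{l\<in>?S. L k \<subseteq> L l} = {l\<in>G. L k \<subseteq> L l}" by auto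
      then show "a k * (\<Sum>l\<in>{l\<in>?S. L k \<subseteq> L l}. a l) ^ n = a k * s k ^ n" by (simp add: s_def)
    qed
    finally show ?thesis using fin(2) by (simp add: sum.If_cases Int_def)
  qed
  have "(\<Sum>x\<in>X. \<mu> x * h x ^ N)
      \<le> (\<Sum>x\<in>X. \<mu> x * (real N * (\<Sum>k\<in>G. if x \<in> L k then a k * s k ^ n else 0)))"
    using \<mu> pt by (intro sum_mono mult_left_mono) auto
  also have "\<dots> = real N * (\<Sum>k\<in>G. \<Sum>x\<in>X. if x \<in> L k then \<mu> x * (a k * s k ^ n) else 0)"
    by (subst sum.swap) (auto simp: sum_distrib_left intro!: sum.cong)
  also have "(\<Sum>k\<in>G. \<Sum>x\<in>X. if x \<in> L k then \<mu> x * (a k * s k ^ n) else 0)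
      = (\<Sum>k\<in>G. \<Sum>x\<in>L k. \<mu> x * (u k x * s k ^ n))"
  proof (rule sum.cong[OF refl])
    fix k assume k: "k \<in> G"
    have "(\<Sum>x\<in>X. if x \<in> L k then \<mu> x * (a k * s k ^ n) else 0) = (\<Sum>x\<in>L k. \<mu> x * (a k * s k ^ n))"
      using L(1)[OF k] fin(1) by (simp add: sum.If_cases Int_absorb1)
    also have "\<dots> = sum \<mu> (L k) * a k * s k ^ n"
      by (simp add: sum_distrib_right mult.assoc)
    also have "sum \<mu> (L k) * a k = (\<Sum>x\<in>L k. \<mu> x * u k x)"
      using L(2)[OF k] by (simp add: a_def)
    finally show "(\<Sum>x\<in>X. if x \<in> L k then \<mu> x * (a k * s k ^ n) else 0)
        = (\<Sum>x\<in>L k. \<mu> x * (u k x * s k ^ n))"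
      by (simp add: sum_distrib_right mult.assoc)
  qed
  also have "real N * (\<Sum>k\<in>G. \<Sum>x\<in>L k. \<mu> x * (u k x * s k ^ n))
      \<le> real N * (\<Sum>k\<in>G. \<Sum>x\<in>X. \<mu> x * (u k x * h x ^ n))"
  proof (rule mult_left_mono[OF sum_mono])
    fix k assume k: "k \<in> G"
    have "(\<Sum>x\<in>L k. \<mu> x * (u k x * s k ^ n)) \<le> (\<Sum>x\<in>L k. \<mu> x * (u k x * h x ^ n))"
      using L(1)[OF k] u[OF k] \<mu> s0[OF k] s_le[OF k]
      by (intro sum_mono mult_left_mono power_mono) auto
    also have "\<dots> \<le> (\<Sum>x\<in>X. \<mu> x * (u k x * h x ^ n))"
      using L(1)[OF k] u[OF k] \<mu> h0 fin by (intro sum_mono2) auto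
    finally show "(\<Sum>x\<in>L k. \<mu> x * (u k x * s k ^ n)) \<le> (\<Sum>x\<in>X. \<mu> x * (u k x * h x ^ n))" .
  qed simp
  also have "(\<Sum>k\<in>G. \<Sum>x\<in>X. \<mu> x * (u k x * h x ^ n)) = (\<Sum>x\<in>X. \<mu> x * (U x * h x ^ n))"
    by (subst sum.swap) (simp add: U_def sum_distrib_left sum_distrib_right)
  also have "real N * (\<Sum>x\<in>X. \<mu> x * (U x * h x ^ n)) = (\<Sum>x\<in>X. \<mu> x * (real N * (U x * h x ^ n)))"
    by (simp add: sum_distrib_left mult_ac)
  finally have 1: "(\<Sum>x\<in>X. \<mu> x * h x ^ N) \<le> (\<Sum>x\<in>X. \<mu> x * (real N * (U x * h x ^ n)))" .
  have young: "real N * (U x * h x ^ n) \<le> (h x ^ N + (real (2 * N) * U x) ^ N) / 2" if "x \<in> X" for x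
  proof -
    \<comment> \<open>The factor 2 in \<open>c\<close> leaves coefficient 1/2 in front of
      \<open>h x ^ N\<close>, which permits the absorption.\<close>
    define c where "c = real (2 * N) * U x"
    have c0: "0 \<le> c" using U0[OF that] by (simp add: c_def)
    have "c * h x ^ n \<le> h x ^ N + c ^ N"
    proof (cases "c \<le> h x")
      case True
      then have "c * h x ^ n \<le> h x ^ N" using h0 by (simp add: N mult_right_mono)
      then show ?thesis using c0 by (simp add: add_increasing2)
    next
      case False
      then have "c * h x ^ n \<le> c ^ N" using h0[of x] c0 by (simp add: N mult_left_mono power_mono)
      then show ?thesis using h0[of x] by (simp add: add_increasing)
    qed
    moreover have "real N * (U x * h x ^ n) = c * h x ^ n / 2" by (simp add: c_def)
    ultimately show ?thesis by (simp add: c_def)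
  qed
  have "(\<Sum>x\<in>X. \<mu> x * (real N * (U x * h x ^ n)))
      \<le> (\<Sum>x\<in>X. \<mu> x * ((h x ^ N + (real (2 * N) * U x) ^ N) / 2))"
    using \<mu> young by (intro sum_mono mult_left_mono) auto
  also have "\<dots> = ((\<Sum>x\<in>X. \<mu> x * h x ^ N) + (\<Sum>x\<in>X. \<mu> x * (real (2 * N) * U x) ^ N)) / 2"
    by (simp add: sum.distrib distrib_left flip: sum_divide_distrib)
  finally have 2: "(\<Sum>x\<in>X. \<mu> x * (real N * (U x * h x ^ n)))
      \<le> ((\<Sum>x\<in>X. \<mu> x * h x ^ N) + (\<Sum>x\<in>X. \<mu> x * (real (2 * N) * U x) ^ N)) / 2" .
  have "p \<le> (p + q) / 2 \<Longrightarrow> p \<le> q" for p q :: real by simp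
  from this[OF order_trans[OF 1 2]]
  have "(\<Sum>x\<in>X. \<mu> x * h x ^ N) \<le> (\<Sum>x\<in>X. \<mu> x * (real (2 * N) * U x) ^ N)" .
  also have "\<dots> = real (2 * N) ^ N * (\<Sum>x\<in>X. \<mu> x * U x ^ N)"
    by (simp add: power_mult_distrib sum_distrib_left mult_ac)
  finally show ?thesis unfolding h_def a_def U_def .
qed

section \<open>Finite sparse families in product spaces\<close>

lemma sum_PiE_insert:
  assumes "j \<notin> D"
  shows "(\<Sum>x\<in>PiE (insert j D) X. f x) = (\<Sum>y\<in>PiE D X. \<Sum>w\<in>X j. f (y(j := w)))"
proof -
  have "(\<Sum>x\<in>PiE (insert j D) X. f x) = (\<Sum>(w, y)\<in>X j \<times> PiE D X. f (y(j := w)))"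
    unfolding PiE_insert_eq
    by (subst sum.reindex[OF inj_combinator[OF assms]]) (simp add: case_prod_unfold)
  also have "\<dots> = (\<Sum>w\<in>X j. \<Sum>y\<in>PiE D X. f (y(j := w)))"
    by (simp add: sum.cartesian_product)
  also have "\<dots> = (\<Sum>y\<in>PiE D X. \<Sum>w\<in>X j. f (y(j := w)))"
    by (rule sum.swap)
  finally show ?thesis .
qed

text \<open>Sparseness is relaxed to a fractional form: the weights \<open>\<epsilon> k\<close> replace the indicators of the sets \<open>E\<^sub>k\<close>,
  which need not be unions of atoms.\<close>

locale finite_sparse =
  fixes m :: nat and X :: "nat \<Rightarrow> 'a set" and \<mu> :: "nat \<Rightarrow> 'a \<Rightarrow> real"
    and G :: "'k set" and L :: "'k \<Rightarrow> nat \<Rightarrow> 'a set"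
    and \<epsilon> :: "'k \<Rightarrow> (nat \<Rightarrow> 'a) \<Rightarrow> real" and \<eta> :: real
  assumes finite_X: "i < m \<Longrightarrow> finite (X i)"
    and \<mu>_nonneg: "i < m \<Longrightarrow> a \<in> X i \<Longrightarrow> 0 \<le> \<mu> i a"
    and finite_G: "finite G"
    and L_subset: "k \<in> G \<Longrightarrow> i < m \<Longrightarrow> L k i \<subseteq> X i"
    and L_pos: "k \<in> G \<Longrightarrow> i < m \<Longrightarrow> 0 < sum (\<mu> i) (L k i)"
    and laminar: "k \<in> G \<Longrightarrow> l \<in> G \<Longrightarrow> i < m \<Longrightarrow> L k i \<inter> L l i \<noteq> {} \<Longrightarrow> L k i \<subseteq> L l i \<or> L l i \<subseteq> L k i"
    and incomp: "k \<in> G \<Longrightarrow> l \<in> G \<Longrightarrow> (\<And>i. i < m \<Longrightarrow> L k i \<subseteq> L l i) \<Longrightarrow> k = l"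
    and \<epsilon>_nonneg: "k \<in> G \<Longrightarrow> 0 \<le> \<epsilon> k x"
    and \<epsilon>_sum: "x \<in> PiE {..<m} X \<Longrightarrow> (\<Sum>k\<in>G. \<epsilon> k x) \<le> 1"
    and \<epsilon>_mass: "k \<in> G \<Longrightarrow> (\<Sum>x\<in>PiE {..<m} (L k). (\<Prod>i<m. \<mu> i (x i)) * \<epsilon> k x)
        = \<eta> * (\<Sum>x\<in>PiE {..<m} (L k). \<Prod>i<m. \<mu> i (x i))"
    and \<eta>_pos: "0 < \<eta>"
begin

section \<open>Weights on the product space and averaging in one coordinate at a time\<close>

abbreviation \<Omega> where "\<Omega> \<equiv> PiE {..<m} X"
abbreviation R where "R k \<equiv> PiE {..<m} (L k)"
abbreviation wt where "wt x \<equiv> (\<Prod>i<m. \<mu> i (x i))"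
definition W where "W S = (\<Sum>x\<in>S. wt x)"

text \<open>Mean of \<open>u k\<close> over the sides \<open>L k i\<close> with \<open>i\<close> in
  \<open>D\<close>, the other coordinates frozen at \<open>x\<close>. Partial sets \<open>D\<close>
  are allowed so that the mean over the whole rectangle can be built up coordinate by
  coordinate.\<close>

definition average :: "nat set \<Rightarrow> ('k \<Rightarrow> (nat \<Rightarrow> 'a) \<Rightarrow> real) \<Rightarrow> 'k \<Rightarrow> (nat \<Rightarrow> 'a) \<Rightarrow> real"
  where "average D u k x = (if \<forall>i\<in>D. x i \<in> L k i
    then (\<Sum>y\<in>PiE D (L k). (\<Prod>i\<in>D. \<mu> i (y i)) * u k (override_on x y D)) / (\<Prod>i\<in>D. sum (\<mu> i) (L k i))
    else 0)"

lemma finite_\<Omega>: "finite \<Omega>" using finite_X by (intro finite_PiE) auto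

lemma R_subset: "k \<in> G \<Longrightarrow> R k \<subseteq> \<Omega>" using L_subset by (auto simp: PiE_iff)

lemma wt_nonneg: "x \<in> \<Omega> \<Longrightarrow> 0 \<le> wt x" using \<mu>_nonneg by (auto intro!: prod_nonneg)

lemma W_R: "k \<in> G \<Longrightarrow> W (R k) = (\<Prod>i<m. sum (\<mu> i) (L k i))"
  unfolding W_def using finite_subset[OF L_subset finite_X] by (subst prod_sum_PiE) auto

lemma W_R_pos: "k \<in> G \<Longrightarrow> 0 < W (R k)"
  using L_pos by (auto simp: W_R intro!: prod_pos)

lemma finite_L: "k \<in> G \<Longrightarrow> i < m \<Longrightarrow> finite (L k i)"
  using finite_subset[OF L_subset finite_X] .

lemma average_empty: "average {} u = u"
  by (intro ext) (simp add: average_def)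

text \<open>Fubini in coordinate \<open>j\<close>: the average over \<open>insert j D\<close> is a
  one-coordinate average of the average over \<open>D\<close>.\<close>

lemma average_insert:
  assumes "k \<in> G" "finite D" "insert j D \<subseteq> {..<m}" "j \<notin> D"
  shows "average (insert j D) u k x
    = (if x j \<in> L k j then (\<Sum>w\<in>L k j. \<mu> j w * average D u k (x(j := w))) / sum (\<mu> j) (L k j) else 0)"
proof (cases "\<forall>i\<in>insert j D. x i \<in> L k i")
  case True
  have 1: "average D u k (x(j := w)) = (\<Sum>y\<in>PiE D (L k). (\<Prod>i\<in>D. \<mu> i (y i))
      * u k (override_on x (y(j := w)) (insert j D))) / (\<Prod>i\<in>D. sum (\<mu> i) (L k i))" for w
  proof -
    have "override_on (x(j := w)) y D = override_on x (y(j := w)) (insert j D)" for y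
      using assms(4) by (auto simp: override_on_def)
    then show ?thesis using True assms(4) by (auto simp: average_def)
  qed
  have 2: "(\<Prod>i\<in>insert j D. \<mu> i ((y(j := w)) i)) = \<mu> j w * (\<Prod>i\<in>D. \<mu> i (y i))" for y w
  proof -
    have "(\<Prod>i\<in>D. \<mu> i ((y(j := w)) i)) = (\<Prod>i\<in>D. \<mu> i (y i))"
      using assms(4) by (intro prod.cong) auto
    then show ?thesis using assms by simp
  qed
  have "average (insert j D) u k x = (\<Sum>y\<in>PiE D (L k). \<Sum>w\<in>L k j. \<mu> j w * ((\<Prod>i\<in>D. \<mu> i (y i))
      * u k (override_on x (y(j := w)) (insert j D)))) / (sum (\<mu> j) (L k j) * (\<Prod>i\<in>D. sum (\<mu> i) (L k i)))"
    using True assms unfolding average_def sum_PiE_insert[OF assms(4)] 2 by (simp add: mult.assoc)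
  also have "\<dots> = (\<Sum>w\<in>L k j. \<mu> j w * average D u k (x(j := w))) / sum (\<mu> j) (L k j)"
    unfolding 1 by (subst sum.swap) (simp add: sum_divide_distrib sum_distrib_left mult_ac)
  finally show ?thesis using True by simp
next
  case False
  \<comment> \<open>If the failing coordinate lies in \<open>D\<close>, moving coordinate
    \<open>j\<close> does not repair it, so both sides vanish.\<close>
  show ?thesis
  proof (cases "x j \<in> L k j")
    case True
    then have "\<not> (\<forall>i\<in>D. x i \<in> L k i)" using False by auto
    moreover have "(\<forall>i\<in>D. (x(j := w)) i \<in> L k i) \<longleftrightarrow> (\<forall>i\<in>D. x i \<in> L k i)" for w
      using assms(4) by (intro ball_cong) auto
    ultimately have "average D u k (x(j := w)) = 0" for w
      by (simp only: average_def if_False)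
    moreover have "average (insert j D) u k x = 0" by (simp only: average_def False if_False)
    ultimately show ?thesis by simp
  qed (auto simp: average_def)
qed

lemma average_nonneg:
  assumes "k \<in> G" "D \<subseteq> {..<m}" "x \<in> \<Omega>" "\<And>x. x \<in> \<Omega> \<Longrightarrow> 0 \<le> u k x"
  shows "0 \<le> average D u k x"
proof -
  have "override_on x y D \<in> \<Omega>" if "y \<in> PiE D (L k)" for y
    using that assms(2,3) L_subset[OF assms(1)] by (force simp: override_on_def PiE_iff extensional_def)
  moreover have "0 \<le> (\<Prod>i\<in>D. \<mu> i (y i))" if "y \<in> PiE D (L k)" for y
    using that assms(2) L_subset[OF assms(1)] \<mu>_nonneg by (intro prod_nonneg) (auto simp: PiE_iff subset_iff)
  moreover have "0 \<le> (\<Prod>i\<in>D. sum (\<mu> i) (L k i))"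
    using assms(2) L_pos[OF assms(1)] by (intro prod_nonneg) (auto intro: less_imp_le)
  ultimately show ?thesis using assms(4)
    by (auto simp: average_def intro!: divide_nonneg_nonneg sum_nonneg mult_nonneg_nonneg)
qed

lemma average_step:
  assumes j: "j < m" and u: "\<And>k x. k \<in> G \<Longrightarrow> x \<in> \<Omega> \<Longrightarrow> 0 \<le> u k x" and N: "N = Suc n"
  shows "(\<Sum>x\<in>\<Omega>. wt x * (\<Sum>k\<in>G. if x j \<in> L k j
        then (\<Sum>w\<in>L k j. \<mu> j w * u k (x(j := w))) / sum (\<mu> j) (L k j) else 0) ^ N)
    \<le> real (2 * N) ^ N * (\<Sum>x\<in>\<Omega>. wt x * (\<Sum>k\<in>G. u k x) ^ N)" (is "?lhs \<le> ?C * ?rhs")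
proof -
  define D where "D = {..<m} - {j}"
  have D: "{..<m} = insert j D" "j \<notin> D" "finite D" using j by (auto simp: D_def)
  have wt_upd: "wt (y(j := w)) = (\<Prod>i\<in>D. \<mu> i (y i)) * \<mu> j w" for y w
  proof -
    have "(\<Prod>i\<in>D. \<mu> i ((y(j := w)) i)) = (\<Prod>i\<in>D. \<mu> i (y i))"
      using D(2) by (intro prod.cong) auto
    then show ?thesis unfolding D(1) using D by simp
  qed
  have split: "(\<Sum>x\<in>\<Omega>. wt x * f x) = (\<Sum>y\<in>PiE D X. (\<Prod>i\<in>D. \<mu> i (y i)) * (\<Sum>w\<in>X j. \<mu> j w * f (y(j := w))))" for f
    using sum_PiE_insert[OF D(2), where f="\<lambda>x. wt x * f x" and X=X]
    unfolding wt_upd by (simp add: D(1) sum_distrib_left mult.assoc)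
  have "?lhs = (\<Sum>y\<in>PiE D X. (\<Prod>i\<in>D. \<mu> i (y i)) * (\<Sum>w\<in>X j. \<mu> j w * (\<Sum>k\<in>G. if w \<in> L k j
        then (\<Sum>v\<in>L k j. \<mu> j v * u k (y(j := v))) / sum (\<mu> j) (L k j) else 0) ^ N))"
    unfolding split fun_upd_upd fun_upd_same ..
  also have "\<dots> \<le> (\<Sum>y\<in>PiE D X. (\<Prod>i\<in>D. \<mu> i (y i)) * (?C * (\<Sum>w\<in>X j. \<mu> j w * (\<Sum>k\<in>G. u k (y(j := w))) ^ N)))"
  proof (intro sum_mono mult_left_mono)
    fix y assume y: "y \<in> PiE D X"
    show "0 \<le> (\<Prod>i\<in>D. \<mu> i (y i))" using y \<mu>_nonneg by (auto simp: D_def PiE_iff intro!: prod_nonneg)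
    have upd: "y(j := w) \<in> \<Omega>" if "w \<in> X j" for w
      unfolding D(1) using y that by (intro PiE_fun_upd)
    show "(\<Sum>w\<in>X j. \<mu> j w * (\<Sum>k\<in>G. if w \<in> L k j
        then (\<Sum>v\<in>L k j. \<mu> j v * u k (y(j := v))) / sum (\<mu> j) (L k j) else 0) ^ N)
      \<le> ?C * (\<Sum>w\<in>X j. \<mu> j w * (\<Sum>k\<in>G. u k (y(j := w))) ^ N)"
      by (rule dual_doob[where u="\<lambda>k v. u k (y(j := v))"])
        (use j upd u N finite_X finite_G \<mu>_nonneg L_subset L_pos laminar in auto)
  qed
  also have "\<dots> = ?C * ?rhs"
    unfolding split by (simp add: sum_distrib_left mult_ac)
  finally show ?thesis .
qed

lemma average_bound:
  assumes "finite D" "D \<subseteq> {..<m}" and u: "\<And>k x. k \<in> G \<Longrightarrow> x \<in> \<Omega> \<Longrightarrow> 0 \<le> u k x" and N: "N = Suc n"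
  shows "(\<Sum>x\<in>\<Omega>. wt x * (\<Sum>k\<in>G. average D u k x) ^ N)
    \<le> (real (2 * N) ^ N) ^ card D * (\<Sum>x\<in>\<Omega>. wt x * (\<Sum>k\<in>G. u k x) ^ N)"
  using assms(1,2)
proof (induction rule: finite_induct)
  case empty
  then show ?case by (simp add: average_empty)
next
  case (insert j D)
  have "(\<Sum>x\<in>\<Omega>. wt x * (\<Sum>k\<in>G. average (insert j D) u k x) ^ N)
    = (\<Sum>x\<in>\<Omega>. wt x * (\<Sum>k\<in>G. if x j \<in> L k j
        then (\<Sum>w\<in>L k j. \<mu> j w * average D u k (x(j := w))) / sum (\<mu> j) (L k j) else 0) ^ N)"
    using insert by (simp add: average_insert)
  also have "\<dots> \<le> real (2 * N) ^ N * (\<Sum>x\<in>\<Omega>. wt x * (\<Sum>k\<in>G. average D u k x) ^ N)"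
    using insert.prems u by (intro average_step[OF _ _ N] average_nonneg) auto
  also have "\<dots> \<le> real (2 * N) ^ N * ((real (2 * N) ^ N) ^ card D * (\<Sum>x\<in>\<Omega>. wt x * (\<Sum>k\<in>G. u k x) ^ N))"
    using insert by (intro mult_left_mono) auto
  finally show ?case using insert by (simp add: mult.assoc)
qed

section \<open>Moments of the counting function of a subfamily\<close>

definition cnt :: "'k set \<Rightarrow> (nat \<Rightarrow> 'a) \<Rightarrow> real" where "cnt J x = (\<Sum>k\<in>J. of_bool (x \<in> R k))"

lemma cnt_nonneg: "0 \<le> cnt J x" by (simp add: cnt_def sum_nonneg)

lemma sum_cnt: "J \<subseteq> G \<Longrightarrow> (\<Sum>x\<in>\<Omega>. wt x * cnt J x) = (\<Sum>k\<in>J. W (R k))"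
proof -
  assume J: "J \<subseteq> G"
  have "(\<Sum>x\<in>\<Omega>. wt x * cnt J x) = (\<Sum>k\<in>J. \<Sum>x\<in>\<Omega>. wt x * of_bool (x \<in> R k))"
    by (subst sum.swap) (simp add: cnt_def sum_distrib_left)
  also have "\<dots> = (\<Sum>k\<in>J. W (R k))"
  proof (rule sum.cong[OF refl])
    fix k assume "k \<in> J"
    then have "R k \<subseteq> \<Omega>" using J R_subset by blast
    then show "(\<Sum>x\<in>\<Omega>. wt x * of_bool (x \<in> R k)) = W (R k)"
      using finite_\<Omega> by (simp add: W_def Int_absorb1 flip: sum.inter_restrict if_distrib cong: if_cong)
  qed
  finally show ?thesis .
qed

text \<open>\<open>average_bound\<close> is used with \<open>u\<close> equal to
  \<open>\<epsilon>\<close> on the rectangles of \<open>J\<close>. The full averages add up to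
  \<open>\<eta> * cnt J\<close>, while the sum of the \<open>u k\<close> is at most 1, so its
  \<open>N\<close>-th power is below its first power, whose integral is \<open>\<eta>\<close> times
  the total weight. Cancelling one factor \<open>\<eta>\<close> leaves
  \<open>\<eta> ^ n\<close>.\<close>

lemma sum_cnt_power:
  assumes J: "J \<subseteq> G" and N: "N = Suc n"
  shows "\<eta> ^ n * (\<Sum>x\<in>\<Omega>. wt x * cnt J x ^ N) \<le> (real (2 * N) ^ N) ^ m * (\<Sum>k\<in>J. W (R k))"
proof -
  define u where "u k x = (if k \<in> J \<and> x \<in> R k then \<epsilon> k x else 0)" for k x
  have u0: "0 \<le> u k x" if "k \<in> G" for k x using \<epsilon>_nonneg[OF that] by (simp add: u_def)
  have avg: "average {..<m} u k x = (if k \<in> J then \<eta> * of_bool (x \<in> R k) else 0)"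
    if "k \<in> G" "x \<in> \<Omega>" for k x
  proof (cases "x \<in> R k")
    case True
    have ov: "override_on x y {..<m} = y" if "y \<in> R k" for y
      using that \<open>x \<in> \<Omega>\<close> by (auto simp: override_on_def fun_eq_iff PiE_iff extensional_def)
    have "average {..<m} u k x = (\<Sum>y\<in>R k. wt y * u k y) / W (R k)"
      using True ov by (auto simp: average_def W_R[OF that(1)])
    also have "\<dots> = (if k \<in> J then \<eta> else 0)"
      using W_R_pos[OF that(1)] \<epsilon>_mass[OF that(1)] by (simp add: u_def W_def)
    finally show ?thesis using True by simp
  next
    case False
    then have "\<not> (\<forall>i\<in>{..<m}. x i \<in> L k i)" using that(2) by (auto simp: PiE_iff)
    then have "average {..<m} u k x = 0" by (simp only: average_def if_False)
    then show ?thesis using False by simp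
  qed
  have sumavg: "(\<Sum>k\<in>G. average {..<m} u k x) = \<eta> * cnt J x" if "x \<in> \<Omega>" for x
  proof -
    have "(\<Sum>k\<in>G. average {..<m} u k x) = (\<Sum>k\<in>G. if k \<in> J then \<eta> * of_bool (x \<in> R k) else 0)"
      using avg that by (intro sum.cong) auto
    also have "\<dots> = (\<Sum>k\<in>J. \<eta> * of_bool (x \<in> R k))"
      using J finite_G by (simp add: sum.If_cases Int_absorb1)
    finally show ?thesis by (simp add: cnt_def sum_distrib_left)
  qed
  have usum: "0 \<le> (\<Sum>k\<in>G. u k x)" "(\<Sum>k\<in>G. u k x) \<le> 1" if "x \<in> \<Omega>" for x
  proof -
    have "(\<Sum>k\<in>G. u k x) \<le> (\<Sum>k\<in>G. \<epsilon> k x)" using \<epsilon>_nonneg by (intro sum_mono) (simp add: u_def)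
    then show "(\<Sum>k\<in>G. u k x) \<le> 1" using \<epsilon>_sum[OF that] by simp
  qed (use u0 in \<open>auto intro: sum_nonneg\<close>)
  have "(\<Sum>x\<in>\<Omega>. wt x * (\<Sum>k\<in>G. u k x) ^ N) \<le> (\<Sum>x\<in>\<Omega>. wt x * (\<Sum>k\<in>G. u k x))"
    using usum wt_nonneg by (intro sum_mono mult_left_mono) (auto simp: N intro!: mult_left_le power_le_one)
  also have "\<dots> = (\<Sum>k\<in>G. \<Sum>x\<in>\<Omega>. wt x * u k x)"
    by (subst sum.swap) (simp add: sum_distrib_left)
  also have "\<dots> = (\<Sum>k\<in>G. if k \<in> J then \<eta> * W (R k) else 0)"
  proof (rule sum.cong[OF refl])
    fix k assume k: "k \<in> G"
    have "(\<Sum>x\<in>\<Omega>. wt x * u k x) = (\<Sum>x\<in>R k. wt x * u k x)"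
      using R_subset[OF k] finite_\<Omega> by (intro sum.mono_neutral_right) (auto simp: u_def)
    then show "(\<Sum>x\<in>\<Omega>. wt x * u k x) = (if k \<in> J then \<eta> * W (R k) else 0)"
      using \<epsilon>_mass[OF k] by (simp add: u_def W_def)
  qed
  also have "\<dots> = \<eta> * (\<Sum>k\<in>J. W (R k))"
    using J finite_G by (simp add: sum.If_cases Int_absorb1 sum_distrib_left)
  finally have U: "(\<Sum>x\<in>\<Omega>. wt x * (\<Sum>k\<in>G. u k x) ^ N) \<le> \<eta> * (\<Sum>k\<in>J. W (R k))" .
  have "\<eta> * (\<eta> ^ n * (\<Sum>x\<in>\<Omega>. wt x * cnt J x ^ N)) = (\<Sum>x\<in>\<Omega>. wt x * (\<Sum>k\<in>G. average {..<m} u k x) ^ N)"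
    using sumavg by (simp add: N power_mult_distrib sum_distrib_left mult_ac)
  also have "\<dots> \<le> (real (2 * N) ^ N) ^ m * (\<Sum>x\<in>\<Omega>. wt x * (\<Sum>k\<in>G. u k x) ^ N)"
    using average_bound[of "{..<m}" u N n] u0 N by auto
  also have "\<dots> \<le> (real (2 * N) ^ N) ^ m * (\<eta> * (\<Sum>k\<in>J. W (R k)))"
    using U by (intro mult_left_mono) auto
  also have "\<dots> = \<eta> * ((real (2 * N) ^ N) ^ m * (\<Sum>k\<in>J. W (R k)))"
    by (rule mult.left_commute)
  finally have "\<eta> * (\<eta> ^ n * (\<Sum>x\<in>\<Omega>. wt x * cnt J x ^ N)) \<le> \<eta> * ((real (2 * N) ^ N) ^ m * (\<Sum>k\<in>J. W (R k)))" .
  then show ?thesis using \<eta>_pos by (simp only: mult_le_cancel_left_pos)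
qed

end

section \<open>Types of points\<close>

text \<open>Iterated summation, starting with coordinate 0: once the coordinates above
  \<open>i\<close> are fixed, coordinate \<open>i\<close> ranges over a set of mass at most
  \<open>n i\<close>.\<close>

lemma sum_prod_fibres_le:
  fixes \<mu> :: "nat \<Rightarrow> 'a \<Rightarrow> real" and n :: "nat \<Rightarrow> real"
  assumes S: "finite S" "S \<subseteq> PiE {..<m} X"
    and \<mu>: "\<And>i a. i < m \<Longrightarrow> a \<in> X i \<Longrightarrow> 0 \<le> \<mu> i a"
    and n: "\<And>i. i < m \<Longrightarrow> 0 \<le> n i"
    and fib: "\<And>i x. i < m \<Longrightarrow> x \<in> S \<Longrightarrow>
      sum (\<mu> i) ((\<lambda>y. y i) ` {y\<in>S. \<forall>k. i < k \<and> k < m \<longrightarrow> y k = x k}) \<le> n i"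
  shows "(\<Sum>x\<in>S. \<Prod>i<m. \<mu> i (x i)) \<le> (\<Prod>i<m. n i)"
proof -
  \<comment> \<open>Coordinates from \<open>j\<close> on are frozen and only those below are summed.
    In the induction step the points are grouped by the value \<open>w\<close> of coordinate
    \<open>j\<close>; each group is a slice of the previous kind, and the values \<open>w\<close>
    fill one of the fibres in \<open>fib\<close>.\<close>
  have star: "(\<Sum>y\<in>{y\<in>S. \<forall>k. j \<le> k \<and> k < m \<longrightarrow> y k = x k}. \<Prod>i<j. \<mu> i (y i)) \<le> (\<Prod>i<j. n i)"
    if "j \<le> m" "x \<in> S" for j x
    using that
  proof (induction j arbitrary: x)
    case 0
    have "{y\<in>S. \<forall>k. 0 \<le> k \<and> k < m \<longrightarrow> y k = x k} = {x}"
    proof (intro equalityI subsetI)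
      fix y assume "y \<in> {y\<in>S. \<forall>k. 0 \<le> k \<and> k < m \<longrightarrow> y k = x k}"
      then show "y \<in> {x}" using 0(2) S(2) PiE_ext[of y "{..<m}" X x] by auto
    qed (use 0(2) in auto)
    then show ?case by simp
  next
    case (Suc j)
    let ?P = "{y\<in>S. \<forall>k. Suc j \<le> k \<and> k < m \<longrightarrow> y k = x k}"
    let ?V = "(\<lambda>y. y j) ` ?P"
    have le: "(\<Sum>y\<in>{y. y \<in> ?P \<and> y j = w}. \<Prod>i<Suc j. \<mu> i (y i)) \<le> (\<Prod>i<j. n i) * \<mu> j w"
      if w: "w \<in> ?V" for w
    proof -
      obtain z where z: "z \<in> ?P" "z j = w" using w by blast
      have "(\<forall>k. Suc j \<le> k \<and> k < m \<longrightarrow> y k = x k) \<and> y j = w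
          \<longleftrightarrow> (\<forall>k. j \<le> k \<and> k < m \<longrightarrow> y k = z k)" for y
      proof -
        have "\<forall>k. Suc j \<le> k \<and> k < m \<longrightarrow> z k = x k" "j < m" using z(1) Suc.prems(1) by simp_all
        moreover from this have "(\<forall>k. j \<le> k \<and> k < m \<longrightarrow> y k = z k)
            \<longleftrightarrow> (\<forall>k. Suc j \<le> k \<and> k < m \<longrightarrow> y k = z k) \<and> y j = z j"
          unfolding Suc_le_eq by (metis le_eq_less_or_eq)
        ultimately show ?thesis using z(2) by (simp cong: conj_cong)
      qed
      then have eq: "{y. y \<in> ?P \<and> y j = w} = {y\<in>S. \<forall>k. j \<le> k \<and> k < m \<longrightarrow> y k = z k}"
        by blast
      have "(\<Sum>y\<in>{y. y \<in> ?P \<and> y j = w}. \<Prod>i<Suc j. \<mu> i (y i))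
          = (\<Sum>y\<in>{y. y \<in> ?P \<and> y j = w}. \<Prod>i<j. \<mu> i (y i)) * \<mu> j w"
        unfolding sum_distrib_right by (intro sum.cong) auto
      also have "\<dots> \<le> (\<Prod>i<j. n i) * \<mu> j w"
        unfolding eq using Suc.IH[of z] Suc.prems z \<mu>[of j w] S(2)
        by (intro mult_right_mono) (auto simp: PiE_iff subset_iff)
      finally show ?thesis .
    qed
    have "(\<Sum>y\<in>?P. \<Prod>i<Suc j. \<mu> i (y i)) = (\<Sum>w\<in>?V. \<Sum>y\<in>{y. y \<in> ?P \<and> y j = w}. \<Prod>i<Suc j. \<mu> i (y i))"
      using S(1) by (intro sum.image_gen) auto
    also have "\<dots> \<le> (\<Sum>w\<in>?V. (\<Prod>i<j. n i) * \<mu> j w)"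
      using le by (rule sum_mono)
    also have "\<dots> = (\<Prod>i<j. n i) * sum (\<mu> j) ?V"
      by (simp add: sum_distrib_left)
    also have "\<dots> \<le> (\<Prod>i<j. n i) * n j"
      using fib[of j x] Suc.prems n by (intro mult_left_mono prod_nonneg) (auto simp: Suc_le_eq)
    finally show ?case by simp
  qed
  show ?thesis
  proof (cases "S = {}")
    case True
    then show ?thesis using n by (auto intro: prod_nonneg)
  next
    case False
    then obtain x where "x \<in> S" by auto
    moreover have "{y\<in>S. \<forall>k. m \<le> k \<and> k < m \<longrightarrow> y k = x k} = S" by auto
    ultimately show ?thesis using star[of m x] by simp
  qed
qed

section \<open>Recursive construction of types\<close>

text \<open>The labelling \<open>T\<close> is a parameter because \<open>btype\<close> inserts its
  own earlier stages here.\<close>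

definition slot :: "nat \<Rightarrow> (nat \<Rightarrow> 'a) set \<Rightarrow> ((nat \<Rightarrow> 'a) \<Rightarrow> nat \<Rightarrow> nat) \<Rightarrow> nat \<Rightarrow> (nat \<Rightarrow> 'a) \<Rightarrow> 'a set"
  where "slot m A T j x = (\<lambda>y. y j) ` {y\<in>A. T y = T x \<and> (\<forall>k. j < k \<and> k < m \<longrightarrow> y k = x k)}"

text \<open>Entry j of the type is taken relative to the points that agree in the entries below j and in the
  coordinates above j, so that both fibres and classes of points of equal type are controlled.\<close>

primrec btype :: "nat \<Rightarrow> (nat \<Rightarrow> 'a \<Rightarrow> real) \<Rightarrow> (nat \<Rightarrow> 'a set) \<Rightarrow> (nat \<Rightarrow> 'a) set
    \<Rightarrow> nat \<Rightarrow> (nat \<Rightarrow> 'a) \<Rightarrow> nat \<Rightarrow> nat"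
  where
    "btype m \<mu> L A 0 = (\<lambda>x i. undefined)"
  | "btype m \<mu> L A (Suc j) = (\<lambda>x. (btype m \<mu> L A j x)
      (j := nat \<lfloor>log 4 (sum (\<mu> j) (L j) / sum (\<mu> j) (slot m A (btype m \<mu> L A j) j x))\<rfloor>))"

declare btype.simps(2) [simp del]

lemma btype_Suc: "btype m \<mu> L A (Suc j) x = (btype m \<mu> L A j x)
    (j := nat \<lfloor>log 4 (sum (\<mu> j) (L j) / sum (\<mu> j) (slot m A (btype m \<mu> L A j) j x))\<rfloor>)"
  by (simp add: btype.simps)

text \<open>Stage \<open>Suc i\<close> writes entry \<open>i\<close>, and no later stage touches
  it.\<close>

lemma btype_apply: "btype m \<mu> L A j x i = (if i < j then btype m \<mu> L A (Suc i) x i else undefined)"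
  by (induction j) (auto simp: less_Suc_eq btype_Suc)

lemma btype_eq_mono:
  assumes "btype m \<mu> L A j y = btype m \<mu> L A j x" "i \<le> j"
  shows "btype m \<mu> L A i y = btype m \<mu> L A i x"
proof
  fix k
  show "btype m \<mu> L A i y k = btype m \<mu> L A i x k"
    using fun_cong[OF assms(1), of k] assms(2)
      btype_apply[of m \<mu> L A i y k] btype_apply[of m \<mu> L A i x k]
      btype_apply[of m \<mu> L A j y k] btype_apply[of m \<mu> L A j x k]
    by (cases "k < i") (metis order_less_le_trans)+
qed

text \<open>Since the recursion starts from \<open>undefined\<close>, the full type is an
  extensional function on \<open>{..<m}\<close>; this lets types be enumerated as members of a
  finite product set.\<close>

lemma btype_PiE: "btype m \<mu> L A m x \<in> PiE {..<m} (\<lambda>_. UNIV)"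
  by (auto simp: PiE_iff extensional_def btype_apply[of m \<mu> L A m])

lemma slot_cong:
  assumes "T y = T x" "\<And>k. j < k \<Longrightarrow> k < m \<Longrightarrow> y k = x k"
  shows "slot m A T j y = slot m A T j x"
  using assms by (simp add: slot_def cong: conj_cong)

section \<open>Thin fibres and large classes of points of equal type\<close>

text \<open>\<open>A\<close> stands for the part of a test set inside one rectangle with sides
  \<open>L i\<close>. Positive weights on \<open>A\<close> keep the slots from being null, so the
  quotients in \<open>btype\<close> are meaningful.\<close>

locale weighted_box =
  fixes m :: nat and \<mu> :: "nat \<Rightarrow> 'a \<Rightarrow> real" and L :: "nat \<Rightarrow> 'a set" and A :: "(nat \<Rightarrow> 'a) set"
  assumes A_subset: "A \<subseteq> PiE {..<m} L"
    and fin_L: "i < m \<Longrightarrow> finite (L i)"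
    and \<mu>_nonneg: "i < m \<Longrightarrow> a \<in> L i \<Longrightarrow> 0 \<le> \<mu> i a"
    and \<mu>_pos: "x \<in> A \<Longrightarrow> i < m \<Longrightarrow> 0 < \<mu> i (x i)"
begin

lemma fin_A: "finite A"
  by (rule finite_subset[OF A_subset finite_PiE]) (auto simp: fin_L)

lemma slot_subset: "j < m \<Longrightarrow> slot m A T j x \<subseteq> L j"
  using A_subset by (auto simp: slot_def PiE_iff subset_iff)

text \<open>The slot contains \<open>x j\<close>, which has positive weight, and is contained in
  \<open>L j\<close>. So the quotient inside the logarithm is at least 1, and rounding the logarithm
  down loses at most a factor 4.\<close>

lemma slot_bounds:
  assumes "j < m" "x \<in> A"
  shows "sum (\<mu> j) (slot m A (btype m \<mu> L A j) j x) \<le> sum (\<mu> j) (L j) / 4 ^ btype m \<mu> L A (Suc j) x j"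
    and "sum (\<mu> j) (L j) / 4 ^ Suc (btype m \<mu> L A (Suc j) x j) \<le> sum (\<mu> j) (slot m A (btype m \<mu> L A j) j x)"
proof -
  let ?Y = "slot m A (btype m \<mu> L A j) j x"
  let ?r = "sum (\<mu> j) (L j) / sum (\<mu> j) ?Y"
  have fY: "finite ?Y" using slot_subset[OF assms(1)] fin_L[OF assms(1)] finite_subset by blast
  have "x j \<in> ?Y" using assms by (auto simp: slot_def)
  then have "\<mu> j (x j) \<le> sum (\<mu> j) ?Y"
    using fY slot_subset[OF assms(1)] \<mu>_nonneg[OF assms(1)] by (intro member_le_sum) auto
  then have Y: "0 < sum (\<mu> j) ?Y" using \<mu>_pos[OF assms(2,1)] by linarith
  have "sum (\<mu> j) ?Y \<le> sum (\<mu> j) (L j)"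
    using slot_subset[OF assms(1)] fin_L[OF assms(1)] \<mu>_nonneg[OF assms(1)] by (intro sum_mono2) auto
  then have r: "1 \<le> ?r" using Y by simp
  define b where "b = nat \<lfloor>log 4 ?r\<rfloor>"
  have b: "btype m \<mu> L A (Suc j) x j = b" by (simp add: b_def btype_Suc)
  have pw: "4 ^ nat \<lfloor>log 4 v\<rfloor> \<le> v" "v \<le> 4 ^ Suc (nat \<lfloor>log 4 v\<rfloor>)" if "1 \<le> v" for v :: real
  proof -
    define n where "n = nat \<lfloor>log 4 v\<rfloor>"
    have "0 \<le> log 4 v" using that by simp
    then have "real n \<le> log 4 v" "log 4 v \<le> real (Suc n)"
      unfolding n_def by linarith+
    then have "4 powr real n \<le> v" "v \<le> 4 powr real (Suc n)"
      using that le_log_iff[of 4 v "real n"] log_le_iff[of 4 v "real (Suc n)"] by linarith+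
    then show "4 ^ nat \<lfloor>log 4 v\<rfloor> \<le> v" "v \<le> 4 ^ Suc (nat \<lfloor>log 4 v\<rfloor>)"
      unfolding n_def[symmetric] by (simp_all add: powr_realpow del: of_nat_Suc power_Suc)
  qed
  have "4 ^ b \<le> ?r" "?r \<le> 4 ^ Suc b"
    unfolding b_def by (rule pw[OF r])+
  then have "4 ^ b * sum (\<mu> j) ?Y \<le> sum (\<mu> j) (L j)" "sum (\<mu> j) (L j) \<le> 4 ^ Suc b * sum (\<mu> j) ?Y"
    using Y by (simp_all only: pos_le_divide_eq pos_divide_le_eq)
  then show "sum (\<mu> j) ?Y \<le> sum (\<mu> j) (L j) / 4 ^ btype m \<mu> L A (Suc j) x j"
    "sum (\<mu> j) (L j) / 4 ^ Suc (btype m \<mu> L A (Suc j) x j) \<le> sum (\<mu> j) ?Y"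
    unfolding b by (simp_all only: pos_le_divide_eq pos_divide_le_eq zero_less_power zero_less_numeral mult.commute)
qed

text \<open>Points of equal full type also agree at stage \<open>i\<close>, so the fibre is
  contained in a slot.\<close>

lemma btype_fibre_le:
  assumes "i < m" "x \<in> A"
  shows "sum (\<mu> i) ((\<lambda>y. y i) ` {y\<in>A. btype m \<mu> L A m y = btype m \<mu> L A m x \<and> (\<forall>k. i < k \<and> k < m \<longrightarrow> y k = x k)})
    \<le> sum (\<mu> i) (L i) / 4 ^ btype m \<mu> L A m x i"
proof -
  have "(\<lambda>y. y i) ` {y\<in>A. btype m \<mu> L A m y = btype m \<mu> L A m x \<and> (\<forall>k. i < k \<and> k < m \<longrightarrow> y k = x k)}
      \<subseteq> slot m A (btype m \<mu> L A i) i x"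
    unfolding slot_def using btype_eq_mono[of m \<mu> L A m _ x i] assms(1)
    by (intro image_mono Collect_mono) (metis less_imp_le)
  moreover have "finite (slot m A (btype m \<mu> L A i) i x)"
    using slot_subset[OF assms(1)] fin_L[OF assms(1)] finite_subset by blast
  moreover have "0 \<le> \<mu> i b" if "b \<in> slot m A (btype m \<mu> L A i) i x" for b
    using slot_subset[OF assms(1)] \<mu>_nonneg[OF assms(1)] that by blast
  ultimately have "sum (\<mu> i) ((\<lambda>y. y i) ` {y\<in>A. btype m \<mu> L A m y = btype m \<mu> L A m x \<and> (\<forall>k. i < k \<and> k < m \<longrightarrow> y k = x k)})
      \<le> sum (\<mu> i) (slot m A (btype m \<mu> L A i) i x)"
    by (intro sum_mono2) blast+
  also have "\<dots> \<le> sum (\<mu> i) (L i) / 4 ^ btype m \<mu> L A (Suc i) x i"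
    by (rule slot_bounds(1)[OF assms])
  also have "btype m \<mu> L A (Suc i) x i = btype m \<mu> L A m x i"
    using assms(1) by (subst (2) btype_apply) simp
  finally show ?thesis .
qed

text \<open>Built up coordinate by coordinate: the values of coordinate \<open>j\<close> fill a
  whole slot, whose mass is bounded below by \<open>slot_bounds\<close>, and over each such value
  lies a class of the previous stage, bounded below by induction.\<close>

lemma btype_class_ge:
  assumes "x \<in> A"
  shows "(\<Prod>i<m. sum (\<mu> i) (L i) / 4 ^ Suc (btype m \<mu> L A m x i))
    \<le> (\<Sum>y\<in>{y\<in>A. btype m \<mu> L A m y = btype m \<mu> L A m x}. \<Prod>i<m. \<mu> i (y i))"
proof -
  define F where "F j x = {y\<in>A. btype m \<mu> L A j y = btype m \<mu> L A j x \<and> (\<forall>k. j \<le> k \<and> k < m \<longrightarrow> y k = x k)}" for j x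
  have "(\<Prod>i<j. sum (\<mu> i) (L i) / 4 ^ Suc (btype m \<mu> L A j x i)) \<le> (\<Sum>y\<in>F j x. \<Prod>i<j. \<mu> i (y i))"
    if "j \<le> m" "x \<in> A" for j x
    using that
  proof (induction j arbitrary: x)
    case 0
    then have "x \<in> F 0 x" by (simp add: F_def)
    moreover have "finite (F 0 x)" using fin_A by (simp add: F_def)
    ultimately have "0 < card (F 0 x)" by (auto simp: card_gt_0_iff)
    then have "1 \<le> real (card (F 0 x))" by linarith
    then show ?case by simp
  next
    case (Suc j)
    then have j: "j < m" by simp
    define P where "P = {y\<in>A. btype m \<mu> L A j y = btype m \<mu> L A j x \<and> (\<forall>k. j < k \<and> k < m \<longrightarrow> y k = x k)}"
    \<comment> \<open>Entry \<open>j\<close> is computed from the stage \<open>j\<close> type and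
      the coordinates above \<open>j\<close> alone. Hence it is constant on \<open>P\<close>, and
      demanding equality of this further entry removes no points.\<close>
    have P_F: "P = F (Suc j) x"
    proof -
      have "btype m \<mu> L A (Suc j) y = btype m \<mu> L A (Suc j) x"
        if "btype m \<mu> L A j y = btype m \<mu> L A j x" "\<forall>k. j < k \<and> k < m \<longrightarrow> y k = x k" for y
        using that slot_cong[of "btype m \<mu> L A j" y x j m A] by (simp add: btype_Suc)
      moreover have "btype m \<mu> L A j y = btype m \<mu> L A j x"
        if "btype m \<mu> L A (Suc j) y = btype m \<mu> L A (Suc j) x" for y
        using btype_eq_mono[OF that] by simp
      ultimately show ?thesis unfolding P_def F_def Suc_le_eq by blast
    qed
    let ?V = "(\<lambda>y. y j) ` P"
    have V: "?V = slot m A (btype m \<mu> L A j) j x" by (simp add: slot_def P_def)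
    have finP: "finite P" using fin_A by (simp add: P_def)
    let ?c = "\<Prod>i<j. sum (\<mu> i) (L i) / 4 ^ Suc (btype m \<mu> L A j x i)"
    have c0: "0 \<le> ?c" using \<mu>_nonneg j by (intro prod_nonneg divide_nonneg_nonneg sum_nonneg) auto
    have ge: "?c * \<mu> j w \<le> (\<Sum>y\<in>{y. y \<in> P \<and> y j = w}. \<Prod>i<Suc j. \<mu> i (y i))" if w: "w \<in> ?V" for w
    proof -
      obtain z where z: "z \<in> P" "z j = w" using w by auto
      then have zA: "z \<in> A" "btype m \<mu> L A j z = btype m \<mu> L A j x" unfolding P_def by blast+
      have sub: "F j z \<subseteq> {y. y \<in> P \<and> y j = w}"
      proof
        fix y assume "y \<in> F j z"
        then have y: "y \<in> A" "btype m \<mu> L A j y = btype m \<mu> L A j z" "\<forall>k. j \<le> k \<and> k < m \<longrightarrow> y k = z k"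
          unfolding F_def by blast+
        have "\<forall>k. j < k \<and> k < m \<longrightarrow> z k = x k" using z(1) unfolding P_def by blast
        then have "\<forall>k. j < k \<and> k < m \<longrightarrow> y k = x k" using y(3) by simp
        moreover have "y j = w" using y(3) j z(2) by blast
        ultimately show "y \<in> {y. y \<in> P \<and> y j = w}"
          unfolding P_def using y(1) trans[OF y(2) zA(2)] by blast
      qed
      have "?c * \<mu> j w \<le> (\<Sum>y\<in>F j z. \<Prod>i<j. \<mu> i (y i)) * \<mu> j w"
        using Suc.IH[of z] zA j z(2) \<mu>_pos[OF zA(1) j] by (intro mult_right_mono) auto
      also have "\<dots> = (\<Sum>y\<in>F j z. \<Prod>i<Suc j. \<mu> i (y i))"
        unfolding sum_distrib_right using sub by (intro sum.cong) auto
      also have "\<dots> \<le> (\<Sum>y\<in>{y. y \<in> P \<and> y j = w}. \<Prod>i<Suc j. \<mu> i (y i))"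
      proof (rule sum_mono2[OF _ sub])
        show "finite {y. y \<in> P \<and> y j = w}" using finP by simp
        fix y assume "y \<in> {y. y \<in> P \<and> y j = w} - F j z"
        then have "y \<in> A" unfolding P_def by blast
        then show "0 \<le> (\<Prod>i<Suc j. \<mu> i (y i))"
          using \<mu>_pos j by (intro prod_nonneg) (auto simp: less_imp_le)
      qed
      finally show ?thesis .
    qed
    have "btype m \<mu> L A (Suc j) x i = btype m \<mu> L A j x i" if "i < j" for i
      using that by (simp add: btype_Suc)
    then have "(\<Prod>i<Suc j. sum (\<mu> i) (L i) / 4 ^ Suc (btype m \<mu> L A (Suc j) x i))
        = ?c * (sum (\<mu> j) (L j) / 4 ^ Suc (btype m \<mu> L A (Suc j) x j))"
      by simp
    also have "\<dots> \<le> ?c * sum (\<mu> j) ?V"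
      unfolding V using slot_bounds(2)[OF j Suc.prems(2)] c0 by (intro mult_left_mono)
    also have "\<dots> = (\<Sum>w\<in>?V. ?c * \<mu> j w)" by (simp add: sum_distrib_left)
    also have "\<dots> \<le> (\<Sum>w\<in>?V. \<Sum>y\<in>{y. y \<in> P \<and> y j = w}. \<Prod>i<Suc j. \<mu> i (y i))"
      using ge by (rule sum_mono)
    also have "\<dots> = (\<Sum>y\<in>P. \<Prod>i<Suc j. \<mu> i (y i))"
      using finP by (intro sum.image_gen[symmetric])
    finally show ?case by (simp only: P_F)
  qed
  from this[OF order_refl assms] have "(\<Prod>i<m. sum (\<mu> i) (L i) / 4 ^ Suc (btype m \<mu> L A m x i))
    \<le> (\<Sum>y\<in>F m x. \<Prod>i<m. \<mu> i (y i))" .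
  moreover have "F m x = {y\<in>A. btype m \<mu> L A m y = btype m \<mu> L A m x}"
    unfolding F_def by auto
  ultimately show ?thesis by (simp only:)
qed

end

section \<open>Overlaps\<close>

lemma sum_half_power_le:
  assumes "finite S" "inj_on f S"
  shows "(\<Sum>a\<in>S. (1 / 2 :: real) ^ f a) \<le> 2"
proof -
  have "(\<Sum>a\<in>S. (1 / 2 :: real) ^ f a) = (\<Sum>j\<in>f ` S. (1 / 2) ^ j)"
    using assms(2) by (simp add: sum.reindex)
  also have "\<dots> \<le> (\<Sum>j. (1 / 2) ^ j)"
    using assms(1) by (intro sum_le_suminf summable_geometric) auto
  also have "\<dots> = 2" by (simp add: suminf_geometric)
  finally show ?thesis .
qed

text \<open>If \<open>v\<close> is at most \<open>t\<close>, it is traded for \<open>t\<close>;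
  otherwise \<open>t\<close> lies below the larger of \<open>u\<close> and \<open>v\<close>, and a
  power of that one dominates the product.\<close>

lemma mult_power_le_powers:
  fixes u v t :: real
  assumes "0 \<le> u" "0 \<le> v" "0 \<le> t"
  shows "u * v * t ^ p \<le> t ^ Suc p * u + u ^ Suc (Suc p) + v ^ Suc (Suc p)"
proof -
  have nn: "0 \<le> t ^ Suc p * u" "0 \<le> u ^ Suc (Suc p)" "0 \<le> v ^ Suc (Suc p)" using assms by auto
  consider "v \<le> t" | "t < v" "u \<le> v" | "t < v" "v < u" by linarith
  then show ?thesis
  proof cases
    case 1
    then have "u * v * t ^ p \<le> u * t * t ^ p" using assms by (intro mult_right_mono mult_left_mono) auto
    also have "\<dots> = t ^ Suc p * u" by simp
    finally show ?thesis using nn by linarith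
  next
    case 2
    then have "u * v * t ^ p \<le> v * v * v ^ p" using assms by (intro mult_mono power_mono) auto
    also have "\<dots> = v ^ Suc (Suc p)" by simp
    finally show ?thesis using nn by linarith
  next
    case 3
    then have "u * v * t ^ p \<le> u * u * u ^ p" using assms by (intro mult_mono power_mono) auto
    also have "\<dots> = u ^ Suc (Suc p)" by simp
    finally show ?thesis using nn by linarith
  qed
qed

text \<open>Translation of a type along the diagonal direction \<open>(1, ..., 1)\<close>;
  \<open>restrict\<close> keeps it extensional.\<close>

definition shift :: "nat \<Rightarrow> (nat \<Rightarrow> nat) \<Rightarrow> nat \<Rightarrow> nat \<Rightarrow> nat"
  where "shift m \<beta> c = restrict (\<lambda>i. \<beta> i + c) {..<m}"

lemma shift_apply: "i < m \<Longrightarrow> shift m \<beta> c i = \<beta> i + c" by (simp add: shift_def)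

lemma shift_shift: "shift m (shift m \<beta> a) b = shift m \<beta> (a + b)"
  by (auto simp: shift_def fun_eq_iff)

lemma sum_shift: "(\<Sum>i<m. shift m \<beta> c i) = (\<Sum>i<m. \<beta> i) + m * c"
  by (simp add: shift_apply sum.distrib)

text \<open>The second summand is the constant of \<open>sum_cnt_power\<close> for the exponent
  \<open>2 * m + 1\<close>; the 1 accounts for the linear term in the pointwise inequality behind
  \<open>gram_bound\<close>.\<close>

definition gram_const :: "nat \<Rightarrow> real"
  where "gram_const m = 1 + (real (2 * Suc (2 * m)) ^ Suc (2 * m)) ^ m"

lemma gram_const_ge: "1 \<le> gram_const m" by (simp add: gram_const_def)

section \<open>Gram bound for the overlaps of two subfamilies\<close>

context finite_sparse
begin

lemma W_nonneg: "S \<subseteq> \<Omega> \<Longrightarrow> 0 \<le> W S"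
  unfolding W_def using wt_nonneg by (intro sum_nonneg) auto

lemma sum_of_bool_W: "S \<subseteq> \<Omega> \<Longrightarrow> (\<Sum>x\<in>\<Omega>. wt x * of_bool (x \<in> S)) = W S"
  unfolding W_def using finite_\<Omega>
  by (intro sum.mono_neutral_cong_right) auto

lemma W_R_Int:
  assumes "k \<in> G" "l \<in> G"
  shows "W (R k \<inter> R l) = (\<Prod>i<m. sum (\<mu> i) (L k i \<inter> L l i))"
  unfolding W_def PiE_Int using finite_L[OF assms(1)] by (subst prod_sum_PiE) auto

lemma sum_cnt_cnt:
  assumes "I \<subseteq> G" "J \<subseteq> G"
  shows "(\<Sum>x\<in>\<Omega>. wt x * (cnt I x * cnt J x)) = (\<Sum>k\<in>I. \<Sum>l\<in>J. W (R k \<inter> R l))"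
proof -
  have prod: "cnt I x * cnt J x = (\<Sum>k\<in>I. \<Sum>l\<in>J. of_bool (x \<in> R k \<inter> R l))" for x
    by (simp only: cnt_def sum_product Int_iff of_bool_conj)
  have "(\<Sum>x\<in>\<Omega>. wt x * (cnt I x * cnt J x)) = (\<Sum>x\<in>\<Omega>. \<Sum>k\<in>I. \<Sum>l\<in>J. wt x * of_bool (x \<in> R k \<inter> R l))"
    by (simp only: prod sum_distrib_left)
  also have "\<dots> = (\<Sum>k\<in>I. \<Sum>l\<in>J. \<Sum>x\<in>\<Omega>. wt x * of_bool (x \<in> R k \<inter> R l))"
    by (rule trans[OF sum.swap sum.cong[OF refl sum.swap]])
  also have "\<dots> = (\<Sum>k\<in>I. \<Sum>l\<in>J. W (R k \<inter> R l))"
  proof (rule sum.cong[OF refl], rule sum.cong[OF refl])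
    fix k l assume "k \<in> I" "l \<in> J"
    then have "R k \<inter> R l \<subseteq> \<Omega>" using R_subset assms by blast
    then show "(\<Sum>x\<in>\<Omega>. wt x * of_bool (x \<in> R k \<inter> R l)) = W (R k \<inter> R l)" by (rule sum_of_bool_W)
  qed
  finally show ?thesis .
qed

text \<open>Integrates \<open>u v \<le> \<tau> u + \<tau>\<^sup>-\<^sup>p (u\<^sup>p\<^sup>+\<^sup>2 + v\<^sup>p\<^sup>+\<^sup>2)\<close> with \<open>\<tau> = 2\<^sup>c / \<eta>\<close> and \<open>p = 2 m - 1\<close>;
  the high moment is what produces the factor \<open>4\<^sup>-\<^sup>m\<^sup>c\<close>.\<close>

lemma gram_bound:
  assumes I: "I \<subseteq> G" and J: "J \<subseteq> G" and m: "0 < m"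
  shows "\<eta> * (\<Sum>k\<in>I. \<Sum>l\<in>J. W (R k \<inter> R l))
    \<le> gram_const m * 2 ^ c * ((\<Sum>k\<in>I. W (R k)) + (\<Sum>l\<in>J. W (R l)) / 4 ^ (m * c))"
proof -
  define p where "p = 2 * m - 1"
  have p: "2 * m = Suc p" using m by (simp add: p_def)
  define C where "C = (real (2 * Suc (2 * m)) ^ Suc (2 * m)) ^ m"
  have C0: "0 \<le> C" by (simp add: C_def)
  define s where "s = (\<Sum>k\<in>I. W (R k))"
  define t where "t = (\<Sum>k\<in>J. W (R k))"
  define Q where "Q = (\<Sum>k\<in>I. \<Sum>l\<in>J. W (R k \<inter> R l))"
  have st: "0 \<le> s" "0 \<le> t"
    unfolding s_def t_def using W_R_pos I J by (auto intro!: sum_nonneg intro: less_imp_le)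
  have pw: "\<eta> ^ Suc p * (\<Sum>x\<in>\<Omega>. wt x * cnt I x ^ Suc (Suc p)) \<le> C * s"
    "\<eta> ^ Suc p * (\<Sum>x\<in>\<Omega>. wt x * cnt J x ^ Suc (Suc p)) \<le> C * t"
    using sum_cnt_power[OF I refl, of "2 * m"] sum_cnt_power[OF J refl, of "2 * m"]
    unfolding s_def t_def C_def p by simp_all
  define \<tau> where "\<tau> = 2 ^ c / \<eta>"
  have \<tau>0: "0 < \<tau>" using \<eta>_pos by (simp add: \<tau>_def)
  have "\<tau> ^ p * Q = (\<Sum>x\<in>\<Omega>. wt x * (cnt I x * cnt J x * \<tau> ^ p))"
    unfolding Q_def sum_cnt_cnt[OF I J, symmetric] by (simp add: sum_distrib_left mult_ac)
  also have "\<dots> \<le> (\<Sum>x\<in>\<Omega>. wt x * (\<tau> ^ Suc p * cnt I x + cnt I x ^ Suc (Suc p) + cnt J x ^ Suc (Suc p)))"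
    using wt_nonneg cnt_nonneg \<tau>0 by (intro sum_mono mult_left_mono mult_power_le_powers) auto
  also have "\<dots> = \<tau> ^ Suc p * (\<Sum>x\<in>\<Omega>. wt x * cnt I x) + (\<Sum>x\<in>\<Omega>. wt x * cnt I x ^ Suc (Suc p))
      + (\<Sum>x\<in>\<Omega>. wt x * cnt J x ^ Suc (Suc p))"
    by (simp add: distrib_left sum.distrib sum_distrib_left mult_ac)
  also have "(\<Sum>x\<in>\<Omega>. wt x * cnt I x) = s" unfolding s_def by (rule sum_cnt[OF I])
  \<comment> \<open>The factor \<open>\<eta> ^ Suc p\<close> matches the moment bounds
    \<open>pw\<close> and turns the powers of \<open>\<tau>\<close> into powers of
    \<open>2 ^ c\<close>, with one factor \<open>\<eta>\<close> left over on the left.\<close>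
  finally have "\<eta> ^ Suc p * (\<tau> ^ p * Q) \<le> \<eta> ^ Suc p * (\<tau> ^ Suc p * s
      + (\<Sum>x\<in>\<Omega>. wt x * cnt I x ^ Suc (Suc p)) + (\<Sum>x\<in>\<Omega>. wt x * cnt J x ^ Suc (Suc p)))"
    using \<eta>_pos by (intro mult_left_mono) auto
  also have "\<dots> \<le> (\<eta> * \<tau>) ^ Suc p * s + C * s + C * t"
    using pw unfolding power_mult_distrib distrib_left by (simp only: mult.assoc add_mono order_refl)
  finally have "\<eta> * ((\<eta> * \<tau>) ^ p * Q) \<le> (\<eta> * \<tau>) ^ Suc p * s + C * s + C * t"
    by (simp add: power_mult_distrib mult_ac)
  moreover have "\<eta> * \<tau> = 2 ^ c" using \<eta>_pos by (simp add: \<tau>_def)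
  ultimately have 1: "(2 ^ c) ^ p * (\<eta> * Q) \<le> (2 ^ c) ^ Suc p * s + C * s + C * t"
    by (simp add: mult.left_commute)
  have pc: "(2 ^ c) ^ Suc p = (4 :: real) ^ (m * c)"
  proof -
    have "(2 ^ c) ^ Suc p = ((2 :: real) ^ 2) ^ (m * c)"
      unfolding p[symmetric] power_mult[symmetric] by (simp add: mult_ac)
    then show ?thesis by simp
  qed
  have c1: "(1 :: real) \<le> (2 ^ c) ^ Suc p" by (intro one_le_power) simp
  \<comment> \<open>The moment term of \<open>I\<close> is merged into the linear term, so that
    after division by \<open>(2 ^ c) ^ p\<close> only the mass \<open>t\<close> of \<open>J\<close>
    carries the small factor.\<close>
  have "C * s \<le> C * ((2 ^ c) ^ Suc p * s)"
    using C0 st c1 by (intro mult_left_mono) (auto intro: mult_le_cancel_right1[THEN iffD2])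
  moreover have "0 \<le> t" "C * t \<le> (1 + C) * t" using st C0 by (auto simp: distrib_right)
  ultimately have "(2 ^ c) ^ p * (\<eta> * Q) \<le> (1 + C) * ((2 ^ c) ^ Suc p * s + t)"
    using 1 by (simp add: algebra_simps)
  also have "\<dots> = (2 ^ c) ^ p * ((1 + C) * 2 ^ c * (s + t / (2 ^ c) ^ Suc p))"
    by (simp add: field_simps)
  finally have "\<eta> * Q \<le> (1 + C) * 2 ^ c * (s + t / (2 ^ c) ^ Suc p)"
    by (subst (asm) mult_le_cancel_left_pos) auto
  then show ?thesis unfolding pc by (simp add: gram_const_def C_def Q_def s_def t_def)
qed

text \<open>Fractional substitute for adding up disjoint subsets of the rectangles: at each point of
  the union the weights \<open>\<epsilon> k\<close> sum to at most 1.\<close>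

lemma sum_W_R_le: "\<eta> * (\<Sum>k\<in>G. W (R k)) \<le> W (\<Union>k\<in>G. R k)"
proof -
  have sub: "(\<Union>k\<in>G. R k) \<subseteq> \<Omega>" using R_subset by blast
  have "\<eta> * (\<Sum>k\<in>G. W (R k)) = (\<Sum>k\<in>G. \<Sum>x\<in>R k. wt x * \<epsilon> k x)"
    using \<epsilon>_mass by (simp add: W_def sum_distrib_left)
  also have "\<dots> \<le> (\<Sum>k\<in>G. \<Sum>x\<in>(\<Union>k\<in>G. R k). wt x * \<epsilon> k x)"
  proof (rule sum_mono, rule sum_mono2)
    fix k x assume "k \<in> G" "x \<in> (\<Union>k\<in>G. R k) - R k"
    moreover from this have "x \<in> \<Omega>" using sub by blast
    ultimately show "0 \<le> wt x * \<epsilon> k x" using wt_nonneg \<epsilon>_nonneg by (intro mult_nonneg_nonneg)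
  qed (use finite_subset[OF sub finite_\<Omega>] in blast)+
  also have "\<dots> = (\<Sum>x\<in>(\<Union>k\<in>G. R k). wt x * (\<Sum>k\<in>G. \<epsilon> k x))"
    by (subst sum.swap) (simp add: sum_distrib_left)
  also have "\<dots> \<le> (\<Sum>x\<in>(\<Union>k\<in>G. R k). wt x * 1)"
  proof (rule sum_mono)
    fix x assume "x \<in> (\<Union>k\<in>G. R k)"
    then have "x \<in> \<Omega>" by (rule subsetD[OF sub])
    then show "wt x * (\<Sum>k\<in>G. \<epsilon> k x) \<le> wt x * 1" by (intro mult_left_mono \<epsilon>_sum wt_nonneg)
  qed
  finally show ?thesis by (simp only: W_def mult_1_right)
qed

end

section \<open>Pieces of a test set, and overlaps of pieces whose types lie on one diagonal\<close>

locale finite_sparse_set = finite_sparse +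
  fixes A
  assumes A_\<Omega>: "A \<subseteq> \<Omega>" and A_pos: "\<And>x i. x \<in> A \<Longrightarrow> i < m \<Longrightarrow> 0 < \<mu> i (x i)" and m_pos: "0 < m"
begin

definition kind where "kind k x = btype m \<mu> (L k) (A \<inter> R k) m x"

definition piece where "piece k \<beta> = {x \<in> A \<inter> R k. kind k x = \<beta>}"

definition mass where "mass \<beta> = (\<Sum>k\<in>G. W (piece k \<beta>))"

lemma box: "k \<in> G \<Longrightarrow> weighted_box m \<mu> (L k) (A \<inter> R k)"
  using finite_L L_subset \<mu>_nonneg A_pos by unfold_locales blast+

lemma piece_subset: "piece k \<beta> \<subseteq> A" "piece k \<beta> \<subseteq> R k" "piece k \<beta> \<subseteq> \<Omega>"
  using A_\<Omega> unfolding piece_def by blast+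

lemma finite_piece: "finite (piece k \<beta>)"
  by (rule finite_subset[OF piece_subset(3) finite_\<Omega>])

lemma W_piece_nonneg: "0 \<le> W (piece k \<beta>)" "0 \<le> W (piece k \<beta> \<inter> S)"
  using piece_subset(3) by (blast intro: W_nonneg)+

lemma mass_nonneg: "0 \<le> mass \<beta>" unfolding mass_def using W_piece_nonneg by (intro sum_nonneg)

lemma kind_PiE: "kind k x \<in> PiE {..<m} (\<lambda>_. UNIV)"
  unfolding kind_def by (rule btype_PiE)

lemma shift_0: "\<beta> \<in> PiE {..<m} (\<lambda>_. UNIV) \<Longrightarrow> shift m \<beta> 0 = \<beta>"
  by (auto simp: shift_def fun_eq_iff PiE_iff extensional_def)

lemma shift_inj: "shift m \<beta> c = shift m \<beta> c' \<Longrightarrow> c = c'"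
  using m_pos shift_apply[of 0 m \<beta>] by (metis add_left_cancel)

text \<open>The additional \<open>m\<close> in the exponent is the rounding loss, one factor 4 in
  each coordinate. A single point in the piece makes the lower bound for its class
  available.\<close>

lemma W_R_le_piece:
  assumes "k \<in> G" "piece k \<beta> \<noteq> {}"
  shows "W (R k) \<le> 4 ^ ((\<Sum>i<m. \<beta> i) + m) * W (piece k \<beta>)"
proof -
  obtain x where x: "x \<in> A \<inter> R k" "kind k x = \<beta>" using assms(2) by (auto simp: piece_def)
  have "(\<Prod>i<m. sum (\<mu> i) (L k i) / 4 ^ Suc (\<beta> i)) \<le> W (piece k \<beta>)"
    using weighted_box.btype_class_ge[OF box[OF assms(1)] x(1)] x(2)
    unfolding W_def piece_def kind_def by simp
  moreover have "(\<Prod>i<m. sum (\<mu> i) (L k i) / 4 ^ Suc (\<beta> i)) = W (R k) / 4 ^ ((\<Sum>i<m. \<beta> i) + m)"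
  proof -
    have "(\<Prod>i<m. (4::real) ^ Suc (\<beta> i)) = 4 ^ (\<Sum>i<m. Suc (\<beta> i))" by (simp add: power_sum)
    also have "(\<Sum>i<m. Suc (\<beta> i)) = (\<Sum>i<m. \<beta> i) + m" by (simp only: sum_Suc card_lessThan)
    finally show ?thesis by (simp only: prod_dividef W_R[OF assms(1)])
  qed
  ultimately show ?thesis by (simp only: pos_divide_le_eq zero_less_power zero_less_numeral mult.commute)
qed

lemma fibre_piece_le:
  assumes "k \<in> G" "i < m" "x \<in> piece k \<beta>"
  shows "sum (\<mu> i) ((\<lambda>y. y i) ` {y\<in>piece k \<beta>. \<forall>j. i < j \<and> j < m \<longrightarrow> y j = x j}) \<le> sum (\<mu> i) (L k i) / 4 ^ \<beta> i"
proof -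
  have x: "x \<in> A \<inter> R k" "kind k x = \<beta>" using assms(3) by (auto simp: piece_def)
  have "{y\<in>piece k \<beta>. \<forall>j. i < j \<and> j < m \<longrightarrow> y j = x j}
    = {y \<in> A \<inter> R k. btype m \<mu> (L k) (A \<inter> R k) m y = btype m \<mu> (L k) (A \<inter> R k) m x
        \<and> (\<forall>j. i < j \<and> j < m \<longrightarrow> y j = x j)}"
    unfolding piece_def x(2)[symmetric] kind_def mem_Collect_eq conj_assoc ..
  then show ?thesis
    using weighted_box.btype_fibre_le[OF box[OF assms(1)] assms(2) x(1)] x(2)
    by (simp only: kind_def)
qed

text \<open>In each coordinate the piece belonging to the shorter side controls the fibre. Where
  \<open>L l i\<close> is strictly shorter, the shifted type gives an additional
  \<open>4 ^ c\<close>; for \<open>k \<noteq> l\<close> incomparability provides at least one such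
  coordinate.\<close>

lemma W_piece_Int_le:
  assumes k: "k \<in> G" and l: "l \<in> G" and ne: "c = 0 \<or> k \<noteq> l"
  shows "W (piece k \<beta> \<inter> piece l (shift m \<beta> c)) \<le> W (R k \<inter> R l) / 4 ^ ((\<Sum>i<m. \<beta> i) + c)"
proof (cases "piece k \<beta> \<inter> piece l (shift m \<beta> c) = {}")
  case True
  have "R k \<inter> R l \<subseteq> \<Omega>" using R_subset[OF k] by blast
  then have "0 \<le> W (R k \<inter> R l)" by (rule W_nonneg)
  then show ?thesis using True by (simp add: W_def[of "{}"])
next
  case False
  let ?S = "piece k \<beta> \<inter> piece l (shift m \<beta> c)"
  \<comment> \<open>The gain in coordinate \<open>i\<close>, as an exponent of 4. On a tie or when
    \<open>L k i\<close> is shorter, the fibres of the piece of \<open>k\<close> are used and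
    nothing is gained.\<close>
  define e where "e i = (if L l i \<subset> L k i then c else 0)" for i
  define n where "n i = sum (\<mu> i) (L k i \<inter> L l i) / 4 ^ (\<beta> i + e i)" for i
  have meet: "L k i \<inter> L l i \<noteq> {}" if "i < m" for i
    using False piece_subset(2) that by (fastforce simp: PiE_iff)
  have e_cases: "L l i \<subset> L k i \<or> L k i \<subseteq> L l i" if "i < m" for i
    using laminar[OF k l that meet[OF that]] by blast
  have sum0: "0 \<le> sum (\<mu> i) (L k i \<inter> L l i)" if "i < m" for i
    using \<mu>_nonneg[OF that] L_subset[OF k that] by (intro sum_nonneg) blast
  have "W ?S \<le> (\<Prod>i<m. n i)"
    unfolding W_def
  proof (rule sum_prod_fibres_le)
    show "?S \<subseteq> \<Omega>" using piece_subset(3) by blast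
    show "finite ?S" by (rule finite_Int) (simp add: finite_piece)
    show "0 \<le> \<mu> i a" if "i < m" "a \<in> X i" for i a using \<mu>_nonneg that .
    show "0 \<le> n i" if "i < m" for i using sum0[OF that] by (simp add: n_def)
  next
    fix i x assume i: "i < m" and x: "x \<in> ?S"
    have le: "sum (\<mu> i) ((\<lambda>y. y i) ` {y\<in>?S. \<forall>k. i < k \<and> k < m \<longrightarrow> y k = x k})
      \<le> sum (\<mu> i) ((\<lambda>y. y i) ` {y\<in>T. \<forall>k. i < k \<and> k < m \<longrightarrow> y k = x k})"
      if "?S \<subseteq> T" "T \<subseteq> \<Omega>" for T
    proof (rule sum_mono2)
      show "finite ((\<lambda>y. y i) ` {y \<in> T. \<forall>k. i < k \<and> k < m \<longrightarrow> y k = x k})"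
        using finite_subset[OF that(2) finite_\<Omega>] by simp
      show "0 \<le> \<mu> i b" if "b \<in> (\<lambda>y. y i) ` {y\<in>T. \<forall>k. i < k \<and> k < m \<longrightarrow> y k = x k}
          - (\<lambda>y. y i) ` {y\<in>?S. \<forall>k. i < k \<and> k < m \<longrightarrow> y k = x k}" for b
        using that \<open>T \<subseteq> \<Omega>\<close> i by (auto intro!: \<mu>_nonneg)
    qed (use that(1) in blast)
    show "sum (\<mu> i) ((\<lambda>y. y i) ` {y\<in>?S. \<forall>k. i < k \<and> k < m \<longrightarrow> y k = x k}) \<le> n i"
    proof (cases "L l i \<subset> L k i")
      case True
      have "sum (\<mu> i) ((\<lambda>y. y i) ` {y\<in>?S. \<forall>k. i < k \<and> k < m \<longrightarrow> y k = x k})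
        \<le> sum (\<mu> i) (L l i) / 4 ^ shift m \<beta> c i"
        using x by (intro order_trans[OF le[of "piece l (shift m \<beta> c)"] fibre_piece_le[OF l i]] piece_subset(3)) auto
      also have "L l i = L k i \<inter> L l i" using True by blast
      finally show ?thesis using True i by (simp add: n_def e_def shift_apply)
    next
      case False
      have "sum (\<mu> i) ((\<lambda>y. y i) ` {y\<in>?S. \<forall>k. i < k \<and> k < m \<longrightarrow> y k = x k})
        \<le> sum (\<mu> i) (L k i) / 4 ^ \<beta> i"
        using x by (intro order_trans[OF le[of "piece k \<beta>"] fibre_piece_le[OF k i]] piece_subset(3)) auto
      also have "L k i = L k i \<inter> L l i" using False e_cases[OF i] by blast
      finally show ?thesis using False by (simp add: n_def e_def)
    qed
  qed
  also have "(\<Prod>i<m. n i) = W (R k \<inter> R l) / 4 ^ ((\<Sum>i<m. \<beta> i) + (\<Sum>i<m. e i))"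
    unfolding n_def prod_dividef W_R_Int[OF k l] by (simp add: power_sum power_add prod.distrib)
  also have "\<dots> \<le> W (R k \<inter> R l) / 4 ^ ((\<Sum>i<m. \<beta> i) + c)"
  proof -
    have "c \<le> (\<Sum>i<m. e i)"
    proof (cases "c = 0")
      case False
      then have "k \<noteq> l" using ne by blast
      then obtain i where i: "i < m" "\<not> L k i \<subseteq> L l i" using incomp[OF k l] by blast
      then have "e i = c" using e_cases by (auto simp: e_def)
      then show ?thesis using i(1) member_le_sum[of i "{..<m}" e] by simp
    qed simp
    moreover have "0 \<le> W (R k \<inter> R l)" using R_subset[OF k] by (intro W_nonneg) blast
    ultimately show ?thesis by (intro divide_left_mono power_increasing) auto
  qed
  finally show ?thesis .
qed

text \<open>The case \<open>c = 0\<close>, \<open>k = l\<close> of \<open>W_piece_Int_le\<close>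
  bounds each piece by a fraction of its rectangle; the rectangles are then summed by
  \<open>sum_W_R_le\<close>.\<close>

lemma mass_le:
  assumes "\<beta> \<in> PiE {..<m} (\<lambda>_. UNIV)"
  shows "\<eta> * mass \<beta> \<le> W (\<Union>k\<in>G. R k) / 4 ^ (\<Sum>i<m. \<beta> i)"
proof -
  have "mass \<beta> \<le> (\<Sum>k\<in>G. W (R k) / 4 ^ (\<Sum>i<m. \<beta> i))"
    unfolding mass_def
    using W_piece_Int_le[of _ _ 0 \<beta>] shift_0[OF assms] by (intro sum_mono) fastforce
  then have "\<eta> * mass \<beta> \<le> (\<eta> * (\<Sum>k\<in>G. W (R k))) / 4 ^ (\<Sum>i<m. \<beta> i)"
    using \<eta>_pos by (simp add: sum_divide_distrib[symmetric] field_simps)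
  also have "\<dots> \<le> W (\<Union>k\<in>G. R k) / 4 ^ (\<Sum>i<m. \<beta> i)"
    using sum_W_R_le by (intro divide_right_mono) auto
  finally show ?thesis .
qed

text \<open>Only rectangles with nonempty pieces occur, and their weights are comparable with those
  of the pieces. The overlap estimate contributes \<open>4 ^ (b + c)\<close> in the denominator, the
  Gram bound costs \<open>2 ^ c\<close>, and the comparison costs \<open>4 ^ (b + m)\<close>; the
  net decay is \<open>(1 / 2) ^ c\<close>.\<close>

lemma pair_bound:
  assumes \<beta>: "\<beta> \<in> PiE {..<m} (\<lambda>_. UNIV)"
  shows "\<eta> * (\<Sum>k\<in>G. \<Sum>l\<in>G. W (piece k \<beta> \<inter> piece l (shift m \<beta> c)))
    \<le> gram_const m * 4 ^ m * (1 / 2) ^ c * (mass \<beta> + mass (shift m \<beta> c))"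
proof -
  define ix where "ix \<beta> = {k\<in>G. piece k \<beta> \<noteq> {}}" for \<beta>
  define b where "b = (\<Sum>i<m. \<beta> i)"
  have ixG: "ix \<beta> \<subseteq> G" "finite (ix \<beta>)" for \<beta> using finite_G by (auto simp: ix_def)
  have W0: "0 \<le> W (R k \<inter> R l)" if "k \<in> G" for k l
    using R_subset[OF that] by (intro W_nonneg) blast
  have big: "(\<Sum>k\<in>ix \<beta>. W (R k)) \<le> 4 ^ ((\<Sum>i<m. \<beta> i) + m) * mass \<beta>" for \<beta>
  proof -
    have "(\<Sum>k\<in>ix \<beta>. W (R k)) \<le> (\<Sum>k\<in>ix \<beta>. 4 ^ ((\<Sum>i<m. \<beta> i) + m) * W (piece k \<beta>))"
      using W_R_le_piece by (intro sum_mono) (auto simp: ix_def)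
    also have "\<dots> \<le> (\<Sum>k\<in>G. 4 ^ ((\<Sum>i<m. \<beta> i) + m) * W (piece k \<beta>))"
      using ixG finite_G W_piece_nonneg by (intro sum_mono2) auto
    finally show ?thesis by (simp add: mass_def sum_distrib_left)
  qed
  have summand: "W (piece k \<beta> \<inter> piece l (shift m \<beta> c))
      \<le> (if k \<in> ix \<beta> \<and> l \<in> ix (shift m \<beta> c) then W (R k \<inter> R l) / 4 ^ (b + c) else 0)"
    if "k \<in> G" "l \<in> G" for k l
  proof (cases "k \<in> ix \<beta> \<and> l \<in> ix (shift m \<beta> c)")
    case True
    show ?thesis
    proof (cases "c = 0 \<or> k \<noteq> l")
      case False
      \<comment> \<open>Here \<open>k = l\<close> and \<open>c\<close> is nonzero: a point has only
        one type relative to \<open>k\<close>, so the two pieces are disjoint.\<close>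
      then have "\<beta> \<noteq> shift m \<beta> c" using shift_inj[of \<beta> 0 c] shift_0[OF \<beta>] by auto
      then have "piece k \<beta> \<inter> piece l (shift m \<beta> c) = {}" using False by (auto simp: piece_def)
      then show ?thesis using True W0[OF that(1)] by (simp add: W_def[of "{}"])
    qed (use True W_piece_Int_le[OF that] in \<open>simp add: b_def\<close>)
  next
    case False
    then have "piece k \<beta> \<inter> piece l (shift m \<beta> c) = {}" using that by (auto simp: ix_def)
    then show ?thesis using False by (auto simp: W_def[of "{}"])
  qed
  have "(\<Sum>k\<in>G. \<Sum>l\<in>G. W (piece k \<beta> \<inter> piece l (shift m \<beta> c)))
    \<le> (\<Sum>k\<in>G. \<Sum>l\<in>G. if k \<in> ix \<beta> \<and> l \<in> ix (shift m \<beta> c) then W (R k \<inter> R l) / 4 ^ (b + c) else 0)"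
    using summand by (intro sum_mono)
  also have "\<dots> = (\<Sum>k\<in>ix \<beta>. \<Sum>l\<in>ix (shift m \<beta> c). W (R k \<inter> R l) / 4 ^ (b + c))"
  proof -
    have "(\<Sum>l\<in>G. if k \<in> ix \<beta> \<and> l \<in> ix (shift m \<beta> c) then W (R k \<inter> R l) / 4 ^ (b + c) else 0)
      = (if k \<in> ix \<beta> then \<Sum>l\<in>ix (shift m \<beta> c). W (R k \<inter> R l) / 4 ^ (b + c) else 0)" for k
      using ixG(1)[of "shift m \<beta> c"] finite_G by (simp add: sum.If_cases Int_absorb1)
    then show ?thesis using ixG(1)[of \<beta>] finite_G by (simp add: sum.If_cases Int_absorb1)
  qed
  also have "\<dots> = (\<Sum>k\<in>ix \<beta>. \<Sum>l\<in>ix (shift m \<beta> c). W (R k \<inter> R l)) / 4 ^ (b + c)"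
    by (simp add: sum_divide_distrib)
  finally have "\<eta> * (\<Sum>k\<in>G. \<Sum>l\<in>G. W (piece k \<beta> \<inter> piece l (shift m \<beta> c)))
    \<le> \<eta> * ((\<Sum>k\<in>ix \<beta>. \<Sum>l\<in>ix (shift m \<beta> c). W (R k \<inter> R l)) / 4 ^ (b + c))"
    using \<eta>_pos by (intro mult_left_mono) auto
  also have "\<dots> \<le> gram_const m * 2 ^ c * ((\<Sum>k\<in>ix \<beta>. W (R k))
      + (\<Sum>k\<in>ix (shift m \<beta> c). W (R k)) / 4 ^ (m * c)) / 4 ^ (b + c)"
    using gram_bound[OF ixG(1) ixG(1) m_pos, of "shift m \<beta> c" \<beta> c]
    unfolding times_divide_eq_right by (intro divide_right_mono) auto
  also have "\<dots> \<le> gram_const m * 2 ^ c * (4 ^ (b + m) * mass \<beta> + 4 ^ (b + m) * mass (shift m \<beta> c)) / 4 ^ (b + c)"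
  proof -
    \<comment> \<open>The shifted type has entry sum \<open>b + m * c\<close>, so comparing its
      rectangles with their pieces costs a further \<open>4 ^ (m * c)\<close>, exactly what the Gram
      bound supplies.\<close>
    have "(\<Sum>k\<in>ix (shift m \<beta> c). W (R k)) / 4 ^ (m * c) \<le> 4 ^ (b + m) * mass (shift m \<beta> c)"
      using big[of "shift m \<beta> c"] by (simp add: sum_shift b_def power_add pos_divide_le_eq mult_ac)
    then show ?thesis using big[of \<beta>] gram_const_ge[of m]
      by (intro divide_right_mono mult_left_mono add_mono) (auto simp: b_def)
  qed
  also have "\<dots> = gram_const m * 4 ^ m * (2 ^ c / 4 ^ c) * (mass \<beta> + mass (shift m \<beta> c))"
    by (simp add: power_add field_simps)
  also have "2 ^ c / 4 ^ c = (1 / 2 :: real) ^ c"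
    by (simp add: power_divide[symmetric])
  finally show ?thesis .
qed

end

section \<open>Diagonals\<close>

text \<open>With truncated subtraction \<open>(c - c') + (c' - c)\<close> is the distance of
  \<open>c\<close> and \<open>c'\<close>. On each side of \<open>c\<close> the distances are
  distinct, giving two geometric series.\<close>

lemma sum_half_power_dist_le:
  "(\<Sum>c'\<le>B. (1 / 2 :: real) ^ ((c - c') + (c' - c))) \<le> 4"
proof -
  have split: "{..B} = {c'\<in>{..B}. c' \<le> c} \<union> {c'\<in>{..B}. c < c'}" by auto
  have "(\<Sum>c'\<le>B. (1 / 2 :: real) ^ ((c - c') + (c' - c)))
      = (\<Sum>c'\<in>{c'\<in>{..B}. c' \<le> c}. (1 / 2) ^ ((c - c') + (c' - c)))
      + (\<Sum>c'\<in>{c'\<in>{..B}. c < c'}. (1 / 2) ^ ((c - c') + (c' - c)))"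
    by (subst split, rule sum.union_disjoint) auto
  also have "\<dots> \<le> 2 + 2"
    by (intro add_mono sum_half_power_le) (auto simp: inj_on_def)
  finally show ?thesis by simp
qed

section \<open>Total mass along one diagonal\<close>

context finite_sparse_set
begin

text \<open>With H the number of pieces on the diagonal at a point, almost orthogonality bounds \<open>\<integral>H\<^sup>2\<close> by a multiple
  of \<open>\<integral>H / \<eta>\<close>; this bounds \<open>\<integral>H\<close> because H vanishes off A.\<close>

lemma diagonal_bound:
  assumes d: "d \<in> PiE {..<m} (\<lambda>_. UNIV)"
  shows "\<eta> * (\<Sum>c\<le>B. mass (shift m d c)) \<le> 32 * (gram_const m * 4 ^ m) * W A"
proof -
  define C where "C = gram_const m * 4 ^ m"
  have C: "1 \<le> C" unfolding C_def
    using mult_mono[OF gram_const_ge[of m] one_le_power[of "4::real" m]] gram_const_ge[of m] by simp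
  define h where "h c = mass (shift m d c)" for c
  have h0: "0 \<le> h c" for c by (simp add: h_def mass_nonneg)
  define P where "P c c' = (\<Sum>k\<in>G. \<Sum>l\<in>G. W (piece k (shift m d c) \<inter> piece l (shift m d c')))" for c c'
  define f where "f c x = (\<Sum>k\<in>G. of_bool (x \<in> piece k (shift m d c)) :: real)" for c x
  define H where "H x = (\<Sum>c\<le>B. f c x)" for x
  have f0: "0 \<le> f c x" for c x by (simp add: f_def sum_nonneg)
  have H0: "0 \<le> H x" for x by (simp add: H_def f0 sum_nonneg)
  have P_sym: "P c c' = P c' c" for c c'
    unfolding P_def by (subst sum.swap) (simp add: Int_commute)
  have P1: "\<eta> * P c c' \<le> C * (1 / 2) ^ (c' - c) * (h c + h c')" if "c \<le> c'" for c c'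
    using pair_bound[of "shift m d c" "c' - c"] that
    by (simp add: P_def h_def C_def shift_shift) (simp add: shift_def)
  have P2: "\<eta> * P c c' \<le> C * ((1 / 2) ^ ((c - c') + (c' - c)) * (h c + h c'))" for c c'
    using P1[of c c'] P1[of c' c] P_sym[of c c'] by (cases "c \<le> c'") (simp_all add: mult.assoc add.commute)
  have sum_f: "(\<Sum>x\<in>\<Omega>. wt x * f c x) = h c" for c
  proof -
    have "(\<Sum>x\<in>\<Omega>. wt x * f c x) = (\<Sum>k\<in>G. \<Sum>x\<in>\<Omega>. wt x * of_bool (x \<in> piece k (shift m d c)))"
      unfolding f_def sum_distrib_left by (rule sum.swap)
    then show ?thesis by (simp only: sum_of_bool_W[OF piece_subset(3)] h_def mass_def)
  qed
  have sum_H: "(\<Sum>x\<in>\<Omega>. wt x * H x) = (\<Sum>c\<le>B. h c)"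
    unfolding H_def sum_distrib_left by (subst sum.swap) (simp only: sum_f)
  have ff: "(\<Sum>x\<in>\<Omega>. wt x * (f c x * f c' x)) = P c c'" for c c'
  proof -
    have prod: "f c x * f c' x = (\<Sum>k\<in>G. \<Sum>l\<in>G. of_bool (x \<in> piece k (shift m d c) \<inter> piece l (shift m d c')))" for x
      by (simp only: f_def sum_product Int_iff of_bool_conj)
    have "(\<Sum>x\<in>\<Omega>. wt x * (f c x * f c' x)) = (\<Sum>x\<in>\<Omega>. \<Sum>k\<in>G. \<Sum>l\<in>G.
        wt x * of_bool (x \<in> piece k (shift m d c) \<inter> piece l (shift m d c')))"
      by (simp only: prod sum_distrib_left)
    also have "\<dots> = (\<Sum>k\<in>G. \<Sum>l\<in>G. \<Sum>x\<in>\<Omega>. wt x * of_bool (x \<in> piece k (shift m d c) \<inter> piece l (shift m d c')))"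
      by (rule trans[OF sum.swap sum.cong[OF refl sum.swap]])
    also have "\<dots> = P c c'"
      unfolding P_def using piece_subset(3)
      by (intro sum.cong refl sum_of_bool_W) blast
    finally show ?thesis .
  qed
  have "\<eta> * (\<Sum>x\<in>\<Omega>. wt x * (H x * H x)) = (\<Sum>c\<le>B. \<Sum>c'\<le>B. \<eta> * P c c')"
  proof -
    have prod: "H x * H x = (\<Sum>c\<le>B. \<Sum>c'\<le>B. f c x * f c' x)" for x
      by (simp only: H_def sum_product)
    have "(\<Sum>x\<in>\<Omega>. wt x * (H x * H x)) = (\<Sum>x\<in>\<Omega>. \<Sum>c\<le>B. \<Sum>c'\<le>B. wt x * (f c x * f c' x))"
      by (simp only: prod sum_distrib_left)
    also have "\<dots> = (\<Sum>c\<le>B. \<Sum>c'\<le>B. \<Sum>x\<in>\<Omega>. wt x * (f c x * f c' x))"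
      by (rule trans[OF sum.swap sum.cong[OF refl sum.swap]])
    finally show ?thesis by (simp only: ff sum_distrib_left)
  qed
  also have "\<dots> \<le> (\<Sum>c\<le>B. \<Sum>c'\<le>B. C * ((1 / 2) ^ ((c - c') + (c' - c)) * (h c + h c')))"
    using P2 by (intro sum_mono)
  also have "\<dots> = C * ((\<Sum>c\<le>B. \<Sum>c'\<le>B. (1 / 2) ^ ((c - c') + (c' - c)) * h c)
      + (\<Sum>c\<le>B. \<Sum>c'\<le>B. (1 / 2) ^ ((c - c') + (c' - c)) * h c'))"
    by (simp only: sum_distrib_left distrib_left sum.distrib)
  also have "(\<Sum>c\<le>B. \<Sum>c'\<le>B. (1 / 2) ^ ((c - c') + (c' - c)) * h c')
      = (\<Sum>c\<le>B. \<Sum>c'\<le>B. (1 / 2) ^ ((c - c') + (c' - c)) * h c)"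
    by (subst sum.swap) (simp only: add.commute)
  \<comment> \<open>Schur test: every row of the matrix with entries
    \<open>(1 / 2) ^ |c - c'|\<close> sums to at most 4.\<close>
  also have "C * (\<dots> + \<dots>) \<le> C * (4 * (\<Sum>c\<le>B. h c) + 4 * (\<Sum>c\<le>B. h c))"
  proof -
    have "(\<Sum>c\<le>B. \<Sum>c'\<le>B. (1 / 2) ^ ((c - c') + (c' - c)) * h c) \<le> (\<Sum>c\<le>B. 4 * h c)"
      unfolding sum_distrib_right[symmetric]
      using sum_half_power_dist_le h0 by (intro sum_mono mult_right_mono)
    then have "(\<Sum>c\<le>B. \<Sum>c'\<le>B. (1 / 2) ^ ((c - c') + (c' - c)) * h c) \<le> 4 * (\<Sum>c\<le>B. h c)"
      by (simp only: sum_distrib_left)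
    then show ?thesis using C by (intro mult_left_mono add_mono) auto
  qed
  finally have sq: "\<eta> * (\<Sum>x\<in>\<Omega>. wt x * (H x * H x)) \<le> 8 * C * (\<Sum>c\<le>B. h c)" by simp
  \<comment> \<open>The choice makes the second moment term, at most
    \<open>8 * C / \<eta> / \<kappa>\<close> times the total mass, equal to half of that mass, which
    is then absorbed.\<close>
  define \<kappa> where "\<kappa> = 16 * C / \<eta>"
  have \<kappa>: "0 < \<kappa>" using C \<eta>_pos by (simp add: \<kappa>_def)
  have "H x \<le> \<kappa> * of_bool (x \<in> A) + H x * H x / \<kappa>" for x
  proof (cases "x \<in> A")
    case True
    show ?thesis
    proof (cases "H x \<le> \<kappa>")
      case False
      then have "\<kappa> * H x \<le> H x * H x" using H0 by (intro mult_right_mono) auto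
      then have "H x \<le> H x * H x / \<kappa>" using \<kappa> by (simp add: pos_le_divide_eq mult.commute)
      then show ?thesis using \<kappa> by (simp add: add_increasing)
    qed (use True H0[of x] \<kappa> in \<open>simp add: add_increasing2\<close>)
  next
    case False
    then have "x \<notin> piece k \<beta>" for k \<beta> using piece_subset(1) by blast
    then have "H x = 0" by (simp add: H_def f_def)
    then show ?thesis using False by simp
  qed
  then have "(\<Sum>x\<in>\<Omega>. wt x * H x) \<le> (\<Sum>x\<in>\<Omega>. wt x * (\<kappa> * of_bool (x \<in> A) + H x * H x / \<kappa>))"
    using wt_nonneg by (intro sum_mono mult_left_mono) auto
  also have "\<dots> = \<kappa> * (\<Sum>x\<in>\<Omega>. wt x * of_bool (x \<in> A)) + (\<Sum>x\<in>\<Omega>. wt x * (H x * H x)) / \<kappa>"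
    by (simp add: distrib_left sum.distrib sum_distrib_left sum_divide_distrib mult.left_commute)
  also have "(\<Sum>x\<in>\<Omega>. wt x * of_bool (x \<in> A)) = W A" by (rule sum_of_bool_W[OF A_\<Omega>])
  finally have 1: "(\<Sum>c\<le>B. h c) \<le> \<kappa> * W A + (\<Sum>x\<in>\<Omega>. wt x * (H x * H x)) / \<kappa>"
    by (simp only: sum_H)
  have "(\<Sum>x\<in>\<Omega>. wt x * (H x * H x)) / \<kappa> = \<eta> * (\<Sum>x\<in>\<Omega>. wt x * (H x * H x)) / (16 * C)"
    by (simp add: \<kappa>_def)
  also have "\<dots> \<le> 8 * C * (\<Sum>c\<le>B. h c) / (16 * C)"
    using sq C by (intro divide_right_mono) auto
  also have "\<dots> = (\<Sum>c\<le>B. h c) / 2" using C by simp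
  finally have "(\<Sum>c\<le>B. h c) \<le> 2 * \<kappa> * W A" using 1 by linarith
  then have "\<eta> * (\<Sum>c\<le>B. h c) \<le> \<eta> * (2 * \<kappa> * W A)" using \<eta>_pos by (intro mult_left_mono) auto
  also have "\<dots> = 32 * C * W A" using \<eta>_pos by (simp add: \<kappa>_def)
  finally show ?thesis unfolding h_def C_def .
qed

text \<open>Each step along the diagonal divides the bound of \<open>mass_le\<close> by
  \<open>4 ^ m\<close>, so the starting point dominates. This serves the diagonals that start far
  out.\<close>

lemma diagonal_tail:
  assumes d: "d \<in> PiE {..<m} (\<lambda>_. UNIV)"
  shows "\<eta> * (\<Sum>c\<le>B. mass (shift m d c)) \<le> 2 / 4 ^ (\<Sum>i<m. d i) * W (\<Union>k\<in>G. R k)"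
proof -
  have W0: "0 \<le> W (\<Union>k\<in>G. R k)" using R_subset by (intro W_nonneg) blast
  have "\<eta> * mass (shift m d c) \<le> (1 / 2) ^ c * (W (\<Union>k\<in>G. R k) / 4 ^ (\<Sum>i<m. d i))" for c
  proof -
    have "\<eta> * mass (shift m d c) \<le> W (\<Union>k\<in>G. R k) / 4 ^ (\<Sum>i<m. d i) / 4 ^ (m * c)"
      using mass_le[of "shift m d c"] by (simp add: sum_shift power_add) (simp add: shift_def)
    also have "\<dots> \<le> W (\<Union>k\<in>G. R k) / 4 ^ (\<Sum>i<m. d i) / 2 ^ c"
    proof -
      have "(2::real) ^ c \<le> 4 ^ c" by (intro power_mono) auto
      also have "\<dots> \<le> 4 ^ (m * c)" using m_pos by (intro power_increasing) auto
      finally show ?thesis using W0 by (intro divide_left_mono) auto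
    qed
    finally show ?thesis by (simp add: power_divide mult.commute)
  qed
  then have "(\<Sum>c\<le>B. \<eta> * mass (shift m d c)) \<le> (\<Sum>c\<le>B. (1 / 2) ^ c * (W (\<Union>k\<in>G. R k) / 4 ^ (\<Sum>i<m. d i)))"
    by (intro sum_mono)
  also have "\<dots> = (\<Sum>c\<le>B. (1 / 2) ^ c) * (W (\<Union>k\<in>G. R k) / 4 ^ (\<Sum>i<m. d i))"
    by (simp only: sum_distrib_right)
  also have "\<dots> \<le> 2 * (W (\<Union>k\<in>G. R k) / 4 ^ (\<Sum>i<m. d i))"
    using W0 by (intro mult_right_mono sum_half_power_le) auto
  finally show ?thesis by (simp add: sum_distrib_left)
qed

end

section \<open>Counting the starting points of diagonals\<close>

text \<open>A diagonal starts at a type with a zero entry. Once the vanishing entry is chosen,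
  \<open>m - 1\<close> entries remain free: this is the origin of the exponent \<open>m - 1\<close>
  in the theorem.\<close>

lemma card_zero_somewhere_le:
  "card {d \<in> PiE {..<m} (\<lambda>_. {..K::nat}). \<exists>i<m. d i = 0} \<le> m * (K + 1) ^ (m - 1)"
proof -
  define Z where "Z i = PiE {..<m} (\<lambda>j. if j = i then {0} else {..K})" for i :: nat
  have "{d \<in> PiE {..<m} (\<lambda>_. {..K}). \<exists>i<m. d i = 0} \<subseteq> (\<Union>i<m. Z i)"
    by (auto simp: Z_def PiE_iff)
  moreover have "finite (Z i)" for i unfolding Z_def by (intro finite_PiE) auto
  ultimately have "card {d \<in> PiE {..<m} (\<lambda>_. {..K}). \<exists>i<m. d i = 0} \<le> card (\<Union>i<m. Z i)"
    by (intro card_mono) auto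
  also have "\<dots> \<le> (\<Sum>i<m. card (Z i))" by (rule card_UN_le) simp
  also have "\<dots> = (\<Sum>i<m. (K + 1) ^ (m - 1))"
  proof (rule sum.cong[OF refl])
    fix i assume "i \<in> {..<m}"
    then have "card (Z i) = (\<Prod>j\<in>{..<m} - {i}. card (if j = i then {0} else {..K}))"
      unfolding Z_def by (subst card_PiE) (auto simp: prod.remove[of _ i])
    also have "\<dots> = (\<Prod>j\<in>{..<m} - {i}. K + 1)" by (intro prod.cong) auto
    finally show "card (Z i) = (K + 1) ^ (m - 1)" using \<open>i \<in> {..<m}\<close> by simp
  qed
  finally show ?thesis by simp
qed

lemma sum_UN_le:
  fixes f :: "'b \<Rightarrow> real"
  assumes "finite I" "\<And>i. i \<in> I \<Longrightarrow> finite (S i)" "\<And>x. 0 \<le> f x"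
  shows "sum f (\<Union>i\<in>I. S i) \<le> (\<Sum>i\<in>I. sum f (S i))"
  using assms(1,2)
proof (induction rule: finite_induct)
  case (insert i I)
  have "sum f (S i \<union> (\<Union>i\<in>I. S i)) + sum f (S i \<inter> (\<Union>i\<in>I. S i)) = sum f (S i) + sum f (\<Union>i\<in>I. S i)"
    using insert by (intro sum.union_inter) auto
  moreover have "0 \<le> sum f (S i \<inter> (\<Union>i\<in>I. S i))" using assms(3) by (rule sum_nonneg)
  moreover have "sum f (\<Union>i\<in>I. S i) \<le> (\<Sum>i\<in>I. sum f (S i))" using insert by blast
  moreover have "(\<Sum>i\<in>insert i I. sum f (S i)) = sum f (S i) + (\<Sum>i\<in>I. sum f (S i))"
    using insert by simp
  moreover have "(\<Union>i\<in>insert i I. S i) = S i \<union> (\<Union>i\<in>I. S i)" by simp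
  ultimately show ?case by (simp only:)
qed simp

text \<open>Union bound over the coordinate \<open>i\<close> that exceeds \<open>K\<close>; for
  fixed \<open>i\<close> the sum factors into \<open>m\<close> geometric series, and the one for
  coordinate \<open>i\<close> carries the small factor.\<close>

lemma sum_quarter_tail_le:
  "(\<Sum>d\<in>{d \<in> PiE {..<m} (\<lambda>_. {..B::nat}). \<exists>i<m. K < d i}. 1 / 4 ^ (\<Sum>i<m. d i)) \<le> real m * 2 ^ m / (4::real) ^ K"
proof -
  define Z where "Z i j = (if j = i then {K<..B} else {..B})" for i j :: nat
  have fin: "finite (PiE {..<m} (Z i))" for i by (intro finite_PiE) (auto simp: Z_def)
  have "(\<Sum>d\<in>{d \<in> PiE {..<m} (\<lambda>_. {..B}). \<exists>i<m. K < d i}. 1 / (4::real) ^ (\<Sum>i<m. d i))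
    \<le> (\<Sum>d\<in>(\<Union>i<m. PiE {..<m} (Z i)). 1 / 4 ^ (\<Sum>i<m. d i))"
    using fin by (intro sum_mono2) (auto simp: PiE_iff Z_def)
  also have "\<dots> \<le> (\<Sum>i<m. \<Sum>d\<in>PiE {..<m} (Z i). 1 / 4 ^ (\<Sum>i<m. d i))"
    using fin by (intro sum_UN_le) auto
  also have "\<dots> \<le> (\<Sum>i<m. 2 ^ m / 4 ^ K)"
  proof (rule sum_mono)
    fix i assume i: "i \<in> {..<m}"
    have "(\<Sum>d\<in>PiE {..<m} (Z i). 1 / (4::real) ^ (\<Sum>i<m. d i)) = (\<Sum>d\<in>PiE {..<m} (Z i). \<Prod>j<m. 1 / 4 ^ d j)"
      by (simp add: power_sum prod_dividef)
    also have "\<dots> = (\<Prod>j<m. \<Sum>a\<in>Z i j. 1 / 4 ^ a)"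
      by (rule prod_sum_PiE[symmetric]) (auto simp: Z_def)
    also have "\<dots> \<le> (\<Prod>j<m. if j = i then 2 / 4 ^ K else 2)"
    proof (rule prod_mono)
      fix j
      \<comment> \<open>The offset is \<open>c = K\<close> in the distinguished coordinate, where
        all exponents exceed \<open>K\<close> and truncated subtraction is injective, and
        \<open>c = 0\<close> in the others.\<close>
      have le2: "(\<Sum>a\<in>S. (1::real) / 4 ^ (a - c)) \<le> 2" if "finite S" "inj_on (\<lambda>a. a - c) S" for S and c :: nat
      proof -
        have "(1::real) / 4 ^ (a - c) \<le> (1 / 2) ^ (a - c)" for a
          by (simp add: power_one_over[symmetric] power_mono)
        then have "(\<Sum>a\<in>S. (1::real) / 4 ^ (a - c)) \<le> (\<Sum>a\<in>S. (1 / 2) ^ (a - c))" by (intro sum_mono)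
        also have "\<dots> \<le> 2" using that by (rule sum_half_power_le)
        finally show ?thesis .
      qed
      have "(\<Sum>a\<in>Z i j. (1::real) / 4 ^ a) \<le> (if j = i then 2 / 4 ^ K else 2)"
      proof (cases "j = i")
        case True
        have "(\<Sum>a\<in>Z i j. (1::real) / 4 ^ a) = (\<Sum>a\<in>Z i j. 1 / 4 ^ (a - K)) / 4 ^ K"
          unfolding sum_divide_distrib
          by (intro sum.cong refl) (use True in \<open>auto simp: Z_def power_add[symmetric]\<close>)
        also have "\<dots> \<le> 2 / 4 ^ K"
          by (intro divide_right_mono le2) (auto simp: Z_def True inj_on_def)
        finally show ?thesis using True by simp
      next
        case False
        then show ?thesis using le2[of "Z i j" 0] by (simp add: Z_def)
      qed
      then show "0 \<le> (\<Sum>a\<in>Z i j. (1::real) / 4 ^ a) \<and> (\<Sum>a\<in>Z i j. (1::real) / 4 ^ a) \<le> (if j = i then 2 / 4 ^ K else 2)"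
        by (simp add: sum_nonneg)
    qed
    also have "\<dots> = (2 / 4 ^ K) * (\<Prod>j\<in>{..<m} - {i}. if j = i then 2 / 4 ^ K else 2)"
      using i by (subst prod.remove[of _ i]) auto
    also have "(\<Prod>j\<in>{..<m} - {i}. if j = i then 2 / 4 ^ K else 2) = (\<Prod>j\<in>{..<m} - {i}. 2 :: real)"
      by (intro prod.cong) auto
    also have "2 / 4 ^ K * \<dots> = 2 ^ m / 4 ^ K"
      using i by (cases m) auto
    finally show "(\<Sum>d\<in>PiE {..<m} (Z i). 1 / (4::real) ^ (\<Sum>i<m. d i)) \<le> 2 ^ m / 4 ^ K" .
  qed
  finally show ?thesis by simp
qed

text \<open>The factor \<open>32 * (gram_const m * 4 ^ m)\<close> is that of
  \<open>diagonal_bound\<close>, \<open>m\<close> counts the choices of a distinguished coordinate,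
  and \<open>2 ^ m\<close> comes from the geometric series of the tail.\<close>

definition main_const :: "nat \<Rightarrow> real"
  where "main_const m = 32 * real m * 2 ^ m * (gram_const m * 4 ^ m)"

lemma main_const_pos: "0 < m \<Longrightarrow> 0 < main_const m"
  using gram_const_ge[of m] by (simp add: main_const_def)

text \<open>The witness \<open>c\<close> is the smallest entry of \<open>\<beta>\<close>;
  subtracting it from all entries gives the starting point.\<close>

lemma ex_shift:
  assumes "0 < m" "\<beta> \<in> PiE {..<m} (\<lambda>_. {..B})"
  shows "\<exists>d c. d \<in> {d \<in> PiE {..<m} (\<lambda>_. {..B}). \<exists>i<m. d i = 0} \<and> c \<le> B \<and> \<beta> = shift m d c"
proof -
  define c where "c = Min (\<beta> ` {..<m})"
  have le: "c \<le> \<beta> i" if "i < m" for i unfolding c_def using that by (intro Min_le) auto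
  have "c \<in> \<beta> ` {..<m}" unfolding c_def using assms(1) by (intro Min_in) auto
  then obtain i0 where i0: "i0 < m" "\<beta> i0 = c" by auto
  define d where "d = restrict (\<lambda>i. \<beta> i - c) {..<m}"
  have "\<beta> = shift m d c"
    using le assms(2) by (auto simp: d_def shift_def fun_eq_iff PiE_iff extensional_def)
  moreover have "d \<in> PiE {..<m} (\<lambda>_. {..B})" using assms(2) by (auto simp: d_def PiE_iff intro: le_diff_conv[THEN iffD2] trans_le_add1)
  moreover have "d i0 = 0" using i0 by (simp add: d_def)
  moreover have "c \<le> B" using i0 assms(2) by (auto simp: PiE_iff)
  ultimately show ?thesis using i0(1) by blast
qed

section \<open>Summation over all diagonals and the level set estimate\<close>

context finite_sparse_set
begin

lemma sum_W_eq_sum_mass: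
  assumes B: "\<And>k x i. k \<in> G \<Longrightarrow> x \<in> A \<Longrightarrow> i < m \<Longrightarrow> kind k x i \<le> B"
  shows "(\<Sum>k\<in>G. W (A \<inter> R k)) = (\<Sum>\<beta>\<in>PiE {..<m} (\<lambda>_. {..B}). mass \<beta>)"
proof -
  have "W (A \<inter> R k) = (\<Sum>\<beta>\<in>PiE {..<m} (\<lambda>_. {..B}). W (piece k \<beta>))" if "k \<in> G" for k
  proof -
    have "finite (A \<inter> R k)" by (rule finite_subset[OF _ finite_\<Omega>]) (use A_\<Omega> in blast)
    moreover have "finite (PiE {..<m} (\<lambda>_. {..B}))" by (intro finite_PiE) auto
    moreover have "kind k ` (A \<inter> R k) \<subseteq> PiE {..<m} (\<lambda>_. {..B})"
    proof
      fix \<beta> assume "\<beta> \<in> kind k ` (A \<inter> R k)"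
      then obtain x where "x \<in> A" "\<beta> = kind k x" by blast
      then show "\<beta> \<in> PiE {..<m} (\<lambda>_. {..B})"
        using kind_PiE[of k x] B[OF that] by (auto simp: PiE_iff)
    qed
    ultimately show ?thesis unfolding W_def piece_def by (rule sum.group[symmetric])
  qed
  then have "(\<Sum>k\<in>G. W (A \<inter> R k)) = (\<Sum>k\<in>G. \<Sum>\<beta>\<in>PiE {..<m} (\<lambda>_. {..B}). W (piece k \<beta>))"
    by (intro sum.cong refl)
  also have "\<dots> = (\<Sum>\<beta>\<in>PiE {..<m} (\<lambda>_. {..B}). mass \<beta>)" unfolding mass_def by (rule sum.swap)
  finally show ?thesis .
qed

text \<open>Diagonals are split by their starting points: those with all entries at most
  \<open>K\<close> are few and use \<open>diagonal_bound\<close>, the others use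
  \<open>diagonal_tail\<close>, whose bounds are summable with total of order
  \<open>4 ^ - K\<close>.\<close>

lemma sum_W_Int_le:
  "\<eta> * (\<Sum>k\<in>G. W (A \<inter> R k)) \<le> main_const m * (real (K + 1) ^ (m - 1) * W A + W (\<Union>k\<in>G. R k) / 4 ^ K)"
proof -
  have fA: "finite A" by (rule finite_subset[OF A_\<Omega> finite_\<Omega>])
  \<comment> \<open>Finitely many points and rectangles produce finitely many types.
    \<open>B\<close> only makes the sums finite and does not enter the final bound.\<close>
  obtain B where B: "\<And>k x i. k \<in> G \<Longrightarrow> x \<in> A \<Longrightarrow> i < m \<Longrightarrow> kind k x i \<le> B"
  proof -
    have "finite ((\<lambda>(k, x, i). kind k x i) ` (G \<times> A \<times> {..<m}))"
      using finite_G fA by (intro finite_imageI finite_cartesian_product) auto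
    then obtain B where "\<forall>b\<in>(\<lambda>(k, x, i). kind k x i) ` (G \<times> A \<times> {..<m}). b \<le> B"
      using finite_nat_set_iff_bounded_le by blast
    then show ?thesis by (intro that[of B]) force
  qed
  define T where "T = PiE {..<m} (\<lambda>_. {..B})"
  define D where "D = {d \<in> T. \<exists>i<m. d i = 0}"
  define D1 where "D1 = {d \<in> D. \<forall>i<m. d i \<le> K}"
  define D2 where "D2 = {d \<in> D. \<exists>i<m. K < d i}"
  define V where "V = W (\<Union>k\<in>G. R k)"
  define C where "C = gram_const m * 4 ^ m"
  have C: "1 \<le> C" unfolding C_def
    using mult_mono[OF gram_const_ge[of m] one_le_power[of "4::real" m]] gram_const_ge[of m] by simp
  have V0: "0 \<le> V" unfolding V_def using R_subset by (intro W_nonneg) blast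
  have WA: "0 \<le> W A" by (rule W_nonneg[OF A_\<Omega>])
  have finT: "finite T" unfolding T_def by (intro finite_PiE) auto
  have finD: "finite D" using finT by (simp add: D_def)
  have TU: "d \<in> PiE {..<m} (\<lambda>_. UNIV)" if "d \<in> T" for d using that by (auto simp: T_def PiE_iff)
  \<comment> \<open>The diagonals may leave the box \<open>T\<close>; as masses are nonnegative, a
    covering suffices.\<close>
  have sub: "T \<subseteq> (\<lambda>(d, c). shift m d c) ` (D \<times> {..B})"
  proof
    fix \<beta> assume "\<beta> \<in> T"
    then obtain d c where "d \<in> D" "c \<le> B" "\<beta> = shift m d c"
      using ex_shift[OF m_pos] unfolding T_def D_def by blast
    then show "\<beta> \<in> (\<lambda>(d, c). shift m d c) ` (D \<times> {..B})" by force
  qed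
  define q where "q d = \<eta> * (\<Sum>c\<le>B. mass (shift m d c))" for d
  have "(\<Sum>k\<in>G. W (A \<inter> R k)) = (\<Sum>\<beta>\<in>T. mass \<beta>)"
    unfolding T_def by (rule sum_W_eq_sum_mass[OF B])
  also have "\<dots> \<le> (\<Sum>\<beta>\<in>(\<lambda>(d, c). shift m d c) ` (D \<times> {..B}). mass \<beta>)"
    using finD mass_nonneg by (intro sum_mono2[OF _ sub]) auto
  also have "\<dots> \<le> (\<Sum>(d, c)\<in>D \<times> {..B}. mass (shift m d c))"
    using sum_image_le[of "D \<times> {..B}" mass "\<lambda>(d, c). shift m d c"] finD mass_nonneg
    by (auto simp: case_prod_unfold comp_def)
  also have "\<dots> = (\<Sum>d\<in>D. \<Sum>c\<le>B. mass (shift m d c))"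
    by (simp add: sum.cartesian_product)
  finally have "\<eta> * (\<Sum>k\<in>G. W (A \<inter> R k)) \<le> \<eta> * (\<Sum>d\<in>D. \<Sum>c\<le>B. mass (shift m d c))"
    using \<eta>_pos by (intro mult_left_mono) auto
  also have "\<dots> = (\<Sum>d\<in>D. q d)" unfolding q_def by (rule sum_distrib_left)
  also have "\<dots> = (\<Sum>d\<in>D1. q d) + (\<Sum>d\<in>D2. q d)"
  proof -
    have "D = D1 \<union> D2" by (auto simp: D1_def D2_def not_le)
    moreover have "D1 \<inter> D2 = {}" by (auto simp: D1_def D2_def not_le[symmetric])
    ultimately show ?thesis using finD by (simp add: sum.union_disjoint)
  qed
  also have "(\<Sum>d\<in>D1. q d) \<le> real (m * (K + 1) ^ (m - 1)) * (32 * C * W A)"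
  proof -
    have "(\<Sum>d\<in>D1. q d) \<le> (\<Sum>d\<in>D1. 32 * C * W A)"
      unfolding q_def C_def using TU by (intro sum_mono diagonal_bound) (auto simp: D1_def D_def)
    also have "\<dots> = real (card D1) * (32 * C * W A)" by simp
    also have "\<dots> \<le> real (m * (K + 1) ^ (m - 1)) * (32 * C * W A)"
    proof (rule mult_right_mono)
      have "D1 \<subseteq> {d \<in> PiE {..<m} (\<lambda>_. {..K}). \<exists>i<m. d i = 0}"
        by (auto simp: D1_def D_def T_def PiE_iff)
      moreover have "finite {d \<in> PiE {..<m} (\<lambda>_. {..K}). \<exists>i<m. d i = 0}"
        by (intro finite_Collect_conjI disjI1) (simp add: finite_PiE)
      ultimately have "card D1 \<le> card {d \<in> PiE {..<m} (\<lambda>_. {..K}). \<exists>i<m. d i = 0}"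
        by (rule card_mono[rotated])
      also have "\<dots> \<le> m * (K + 1) ^ (m - 1)" by (rule card_zero_somewhere_le)
      finally show "real (card D1) \<le> real (m * (K + 1) ^ (m - 1))" by (simp only: of_nat_le_iff)
    qed (use C WA in simp)
    finally show ?thesis .
  qed
  also have "(\<Sum>d\<in>D2. q d) \<le> real m * 2 ^ m / 4 ^ K * (2 * V)"
  proof -
    have "(\<Sum>d\<in>D2. q d) \<le> (\<Sum>d\<in>D2. 1 / 4 ^ (\<Sum>i<m. d i) * (2 * V))"
    proof (rule sum_mono)
      fix d assume "d \<in> D2"
      then have "q d \<le> 2 / 4 ^ (\<Sum>i<m. d i) * V"
        unfolding q_def V_def using TU by (intro diagonal_tail) (auto simp: D2_def D_def)
      then show "q d \<le> 1 / 4 ^ (\<Sum>i<m. d i) * (2 * V)" by simp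
    qed
    also have "\<dots> = (\<Sum>d\<in>D2. 1 / 4 ^ (\<Sum>i<m. d i)) * (2 * V)"
      by (simp only: sum_distrib_right)
    also have "\<dots> \<le> real m * 2 ^ m / 4 ^ K * (2 * V)"
    proof (rule mult_right_mono)
      have "(\<Sum>d\<in>D2. 1 / 4 ^ (\<Sum>i<m. d i)) \<le> (\<Sum>d\<in>{d \<in> PiE {..<m} (\<lambda>_. {..B}). \<exists>i<m. K < d i}. 1 / (4::real) ^ (\<Sum>i<m. d i))"
        using finT by (intro sum_mono2) (auto simp: D2_def D_def T_def)
      also have "\<dots> \<le> real m * 2 ^ m / 4 ^ K" by (rule sum_quarter_tail_le)
      finally show "(\<Sum>d\<in>D2. 1 / 4 ^ (\<Sum>i<m. d i)) \<le> real m * 2 ^ m / (4::real) ^ K" .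
    qed (use V0 in simp)
    finally show ?thesis .
  qed
  also have "real (m * (K + 1) ^ (m - 1)) * (32 * C * W A) + real m * 2 ^ m / 4 ^ K * (2 * V)
      \<le> main_const m * (real (K + 1) ^ (m - 1) * W A) + main_const m * (V / 4 ^ K)"
  proof (rule add_mono)
    have "real (m * (K + 1) ^ (m - 1)) * (32 * C * W A) = 1 * (32 * real m * C * (real (K + 1) ^ (m - 1) * W A))"
      by (simp add: mult_ac)
    also have "\<dots> \<le> 2 ^ m * (32 * real m * C * (real (K + 1) ^ (m - 1) * W A))"
      using C WA by (intro mult_right_mono) auto
    finally show "real (m * (K + 1) ^ (m - 1)) * (32 * C * W A) \<le> main_const m * (real (K + 1) ^ (m - 1) * W A)"
      by (simp add: main_const_def C_def mult_ac)
    have "real m * 2 ^ m / 4 ^ K * (2 * V) = 2 * (real m * 2 ^ m * (V / 4 ^ K))" by simp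
    also have "\<dots> \<le> (32 * C) * (real m * 2 ^ m * (V / 4 ^ K))"
      using C V0 by (intro mult_right_mono) auto
    finally show "real m * 2 ^ m / 4 ^ K * (2 * V) \<le> main_const m * (V / 4 ^ K)"
      by (simp add: main_const_def C_def mult_ac)
  qed
  finally show ?thesis by (simp add: V_def distrib_left)
qed

end

text \<open>On the level set \<open>A\<close> the integral of the counting function is at least the
  threshold times \<open>W A\<close>. The 2 in the threshold lets the term with \<open>W A\<close>
  from \<open>sum_W_Int_le\<close> be absorbed, leaving the exponentially small one.\<close>

lemma (in finite_sparse) level_set_bound:
  assumes m: "0 < m"
  shows "W {x \<in> \<Omega>. (\<forall>i<m. 0 < \<mu> i (x i)) \<and> 2 * main_const m / \<eta> * real (K + 1) ^ (m - 1) \<le> cnt G x}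
    \<le> W (\<Union>k\<in>G. R k) / 4 ^ K"
proof -
  define A where "A = {x \<in> \<Omega>. (\<forall>i<m. 0 < \<mu> i (x i)) \<and> 2 * main_const m / \<eta> * real (K + 1) ^ (m - 1) \<le> cnt G x}"
  interpret finite_sparse_set m X \<mu> G L \<epsilon> \<eta> A
    by unfold_locales (auto simp: A_def m)
  define V where "V = W (\<Union>k\<in>G. R k)"
  define Q where "Q = real (K + 1) ^ (m - 1)"
  have Q1: "1 \<le> Q" unfolding Q_def by (rule one_le_power) simp
  have M: "0 < main_const m" by (rule main_const_pos[OF m])
  have "2 * main_const m * (Q * W A) = \<eta> * (\<Sum>x\<in>A. wt x * (2 * main_const m / \<eta> * Q))"
    using \<eta>_pos by (simp add: W_def sum_distrib_left sum_distrib_right mult_ac)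
  also have "\<dots> \<le> \<eta> * (\<Sum>x\<in>A. wt x * cnt G x)"
    using \<eta>_pos wt_nonneg by (intro mult_left_mono sum_mono) (auto simp: A_def Q_def)
  also have "(\<Sum>x\<in>A. wt x * cnt G x) = (\<Sum>k\<in>G. W (A \<inter> R k))"
  proof -
    have "(\<Sum>x\<in>A. wt x * cnt G x) = (\<Sum>k\<in>G. \<Sum>x\<in>A. wt x * of_bool (x \<in> R k))"
      unfolding cnt_def sum_distrib_left by (rule sum.swap)
    also have "\<dots> = (\<Sum>k\<in>G. W (A \<inter> R k))"
    proof (rule sum.cong[OF refl])
      fix k
      have "finite A" by (rule finite_subset[OF A_\<Omega> finite_\<Omega>])
      then show "(\<Sum>x\<in>A. wt x * of_bool (x \<in> R k)) = W (A \<inter> R k)"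
        unfolding W_def by (intro sum.mono_neutral_cong_right) auto
    qed
    finally show ?thesis .
  qed
  also have "\<eta> * \<dots> \<le> main_const m * (Q * W A + V / 4 ^ K)"
    unfolding Q_def V_def by (rule sum_W_Int_le)
  finally have "main_const m * (2 * (Q * W A)) \<le> main_const m * (Q * W A + V / 4 ^ K)"
    by (simp only: mult.assoc mult.left_commute)
  then have "2 * (Q * W A) \<le> Q * W A + V / 4 ^ K"
    using M by (simp only: mult_le_cancel_left_pos)
  moreover have "1 * W A \<le> Q * W A" using Q1 W_nonneg[OF A_\<Omega>] by (rule mult_right_mono)
  ultimately show ?thesis unfolding V_def A_def[symmetric] by simp
qed

section \<open>From atoms to measures\<close>

text \<open>In each coordinate the sides of the finitely many rectangles generate finitely many
  relevant atoms, labelled by the set of indices whose side contains the point. Products of atoms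
  are the cells, their measures are the weights of a finite model, and the sets \<open>E k\<close>
  enter only through their densities in the cells.\<close>

lemma level_set_bound_product:
  fixes N :: "nat \<Rightarrow> 'b measure" and Q :: "'k \<Rightarrow> nat \<Rightarrow> 'b set" and E :: "'k \<Rightarrow> (nat \<Rightarrow> 'b) set"
    and m K :: nat and \<eta> :: real and F :: "'k set"
  defines "M \<equiv> completion (PiM {..<m} N)"
  defines "Rect \<equiv> \<lambda>k. PiE {..<m} (Q k)"
  assumes N: "product_sigma_finite N" and fin: "finite F" and m: "0 < m" and \<eta>: "0 < \<eta>"
    and Q: "\<And>k i. k \<in> F \<Longrightarrow> i < m \<Longrightarrow> Q k i \<in> sets (N i)"
      "\<And>k i. k \<in> F \<Longrightarrow> i < m \<Longrightarrow> 0 < emeasure (N i) (Q k i)"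
      "\<And>k i. k \<in> F \<Longrightarrow> i < m \<Longrightarrow> emeasure (N i) (Q k i) < \<infinity>"
    and lam: "\<And>k l i. k \<in> F \<Longrightarrow> l \<in> F \<Longrightarrow> i < m \<Longrightarrow> Q k i \<inter> Q l i \<noteq> {} \<Longrightarrow> Q k i \<subseteq> Q l i \<or> Q l i \<subseteq> Q k i"
    and inc: "\<And>k l. k \<in> F \<Longrightarrow> l \<in> F \<Longrightarrow> (\<And>i. i < m \<Longrightarrow> Q k i \<subseteq> Q l i) \<Longrightarrow> k = l"
    and E: "disjoint_family_on E F" "\<And>k. k \<in> F \<Longrightarrow> E k \<in> sets M" "\<And>k. k \<in> F \<Longrightarrow> E k \<subseteq> Rect k"
      "\<And>k. k \<in> F \<Longrightarrow> ennreal \<eta> * emeasure M (Rect k) \<le> emeasure M (E k)"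
  shows "emeasure M {x\<in>space M. 2 * main_const m / \<eta> * real (K + 1) ^ (m - 1) \<le> real (card {k\<in>F. x \<in> Rect k})}
    \<le> ennreal ((1 / 4) ^ K) * emeasure M (\<Union>k\<in>F. Rect k)"
proof -
  interpret product_sigma_finite N by (rule N)
  \<comment> \<open>Rectangles and cells are measurable in the uncompleted product, where the
    product formula holds; the \<open>E k\<close> are measurable in the completion only.\<close>
  define P where "P = PiM {..<m} N"
  have M_P: "M = completion P" by (simp add: M_def P_def)
  have spM: "space M = space P" by (simp add: M_P)
  have setsM: "S \<in> sets M" if "S \<in> sets P" for S using that by (simp add: M_P sets_completionI_sets)
  have emM: "emeasure M S = emeasure P S" if "S \<in> sets P" for S using that by (simp add: M_P main_part)
  define \<phi> where "\<phi> i z = {k\<in>F. z \<in> Q k i}" for i z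
  \<comment> \<open>Leaving out the label of points in no side ensures that every atom labelled by
    \<open>X i\<close> lies in some \<open>Q k i\<close> and so has finite measure.\<close>
  define X where "X i = \<phi> i ` (\<Union>k\<in>F. Q k i)" for i
  define atom where "atom i a = {z\<in>space (N i). \<phi> i z = a}" for i a
  define \<mu> where "\<mu> i a = measure (N i) (atom i a)" for i a
  define L where "L k i = {a\<in>X i. k \<in> a}" for k i
  define \<Phi> where "\<Phi> y = restrict (\<lambda>i. \<phi> i (y i)) {..<m}" for y
  define cells where "cells S = {y\<in>space P. \<Phi> y \<in> S}" for S
  define \<Omega> where "\<Omega> = PiE {..<m} X"
  define R where "R k = PiE {..<m} (L k)" for k
  define wt where "wt x = (\<Prod>i<m. \<mu> i (x i))" for x
  have finX: "finite (X i)" for i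
  proof -
    have "X i \<subseteq> Pow F" by (auto simp: X_def \<phi>_def)
    then show ?thesis using fin finite_subset by blast
  qed
  have fin\<Omega>: "finite \<Omega>" unfolding \<Omega>_def using finX by (intro finite_PiE) auto
  have Qsp: "z \<in> space (N i)" if "k \<in> F" "i < m" "z \<in> Q k i" for k i z
    using sets.sets_into_space[OF Q(1)[OF that(1,2)]] that(3) by blast
  have atom_sets: "atom i a \<in> sets (N i)" if "i < m" for i a
  proof (cases "a \<subseteq> F")
    case True
    have "atom i a = {z\<in>space (N i). \<forall>k\<in>F. (z \<in> Q k i) = (k \<in> a)}"
      using True by (auto simp: atom_def \<phi>_def)
    also have "\<dots> \<in> sets (N i)"
    proof (intro sets.sets_Collect_finite_All[OF _ fin])
      fix k assume "k \<in> F"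
      show "{z\<in>space (N i). (z \<in> Q k i) = (k \<in> a)} \<in> sets (N i)"
      proof (cases "k \<in> a")
        case True
        then have "{z\<in>space (N i). (z \<in> Q k i) = (k \<in> a)} = space (N i) \<inter> Q k i" by auto
        then show ?thesis using Q(1)[OF \<open>k \<in> F\<close> that] by auto
      next
        case False
        then have "{z\<in>space (N i). (z \<in> Q k i) = (k \<in> a)} = space (N i) - Q k i" by auto
        then show ?thesis using Q(1)[OF \<open>k \<in> F\<close> that] by auto
      qed
    qed
    finally show ?thesis .
  next
    case False
    then have "atom i a = {}" by (auto simp: atom_def \<phi>_def)
    then show ?thesis by simp
  qed
  have atom_Q: "atom i a \<subseteq> Q k i" if "k \<in> a" for i a k
    using that by (auto simp: atom_def \<phi>_def)
  have atom_fin: "emeasure (N i) (atom i a) < \<infinity>" if i: "i < m" and a: "a \<in> X i" for i a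
  proof -
    obtain k where k: "k \<in> a" "k \<in> F" using a by (auto simp: X_def \<phi>_def)
    then have "emeasure (N i) (atom i a) \<le> emeasure (N i) (Q k i)"
      using Q(1) i by (intro emeasure_mono atom_Q) auto
    then show ?thesis using Q(3)[OF k(2) i] by (rule le_less_trans)
  qed
  have \<mu>_em: "emeasure (N i) (atom i a) = ennreal (\<mu> i a)" if "i < m" "a \<in> X i" for i a
    using atom_fin[OF that] by (simp add: \<mu>_def emeasure_eq_ennreal_measure)
  have \<mu>0: "0 \<le> \<mu> i a" for i a by (simp add: \<mu>_def)
  have sum_L: "sum (\<mu> i) (L k i) = measure (N i) (Q k i)" if "k \<in> F" "i < m" for k i
  proof -
    have "Q k i = (\<Union>a\<in>L k i. atom i a)"
      using that Qsp[OF that] by (auto simp: L_def X_def atom_def \<phi>_def)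
    moreover have "measure (N i) (\<Union>a\<in>L k i. atom i a) = sum (\<mu> i) (L k i)"
      unfolding \<mu>_def
    proof (rule measure_finite_Union)
      show "finite (L k i)" using finX by (simp add: L_def)
      show "atom i ` L k i \<subseteq> sets (N i)" using atom_sets that(2) by auto
      show "disjoint_family_on (atom i) (L k i)" by (auto simp: disjoint_family_on_def atom_def)
      show "emeasure (N i) (atom i a) \<noteq> \<infinity>" if "a \<in> L k i" for a
        using atom_fin[of i a] that \<open>i < m\<close> by (auto simp: L_def)
    qed
    ultimately show ?thesis by simp
  qed
  have cell_eq: "cells {x} = PiE {..<m} (\<lambda>i. atom i (x i))" if "x \<in> \<Omega>" for x
  proof -
    have "\<Phi> y = x \<longleftrightarrow> (\<forall>i<m. \<phi> i (y i) = x i)" for y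
      using that by (auto simp: \<Phi>_def \<Omega>_def fun_eq_iff PiE_iff extensional_def)
    then show ?thesis by (auto simp: cells_def P_def space_PiM atom_def PiE_iff dest: extensional_arb)
  qed
  have cell_sets: "cells {x} \<in> sets P" if "x \<in> \<Omega>" for x
    unfolding cell_eq[OF that] P_def using atom_sets by (intro sets_PiM_I_finite) auto
  have cell_em: "emeasure P (cells {x}) = ennreal (wt x)" if "x \<in> \<Omega>" for x
  proof -
    have "emeasure P (cells {x}) = (\<Prod>i<m. emeasure (N i) (atom i (x i)))"
      unfolding cell_eq[OF that] P_def using atom_sets by (intro emeasure_PiM) auto
    also have "\<dots> = (\<Prod>i<m. ennreal (\<mu> i (x i)))"
      using that by (intro prod.cong refl \<mu>_em) (auto simp: \<Omega>_def)
    finally show ?thesis using \<mu>0 by (simp add: wt_def prod_ennreal)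
  qed
  have cells_Un: "cells S = (\<Union>x\<in>S. cells {x})" for S by (auto simp: cells_def)
  have cells_sets: "cells S \<in> sets P" if "S \<subseteq> \<Omega>" for S
    unfolding cells_Un[of S] using that cell_sets finite_subset[OF that fin\<Omega>]
    by (intro sets.finite_UN) auto
  have disj: "disjoint_family_on (\<lambda>x. cells {x}) S" for S
    by (auto simp: disjoint_family_on_def cells_def)
  have wt0: "0 \<le> wt x" for x using \<mu>0 by (simp add: wt_def prod_nonneg)
  have cells_em: "emeasure M (cells S) = ennreal (sum wt S)" if "S \<subseteq> \<Omega>" for S
  proof -
    have "emeasure M (cells S) = emeasure P (\<Union>x\<in>S. cells {x})"
      by (simp only: emM[OF cells_sets[OF that]] cells_Un[of S, symmetric])
    also have "\<dots> = (\<Sum>x\<in>S. emeasure P (cells {x}))"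
      using that cell_sets finite_subset[OF that fin\<Omega>] disj
      by (intro sum_emeasure[symmetric]) auto
    also have "\<dots> = (\<Sum>x\<in>S. ennreal (wt x))"
      using that cell_em by (intro sum.cong) auto
    finally show ?thesis using wt0 by (simp add: sum_ennreal)
  qed
  have R\<Omega>: "R k \<subseteq> \<Omega>" for k by (auto simp: R_def \<Omega>_def L_def PiE_iff)
  have Rect_sp: "Rect k \<subseteq> space P" if "k \<in> F" for k
    using Qsp[OF that] by (auto simp: Rect_def P_def space_PiM PiE_iff)
  have Rect_iff: "y \<in> Rect k \<longleftrightarrow> \<Phi> y \<in> R k" if "y \<in> space P" "k \<in> F" for y k
    using that by (auto simp: Rect_def R_def \<Phi>_def L_def X_def \<phi>_def P_def space_PiM PiE_iff)
  have Rect_cells: "Rect k = cells (R k)" if "k \<in> F" for k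
    using Rect_iff[OF _ that] Rect_sp[OF that] by (auto simp: cells_def)
  have UN_cells: "(\<Union>k\<in>F. Rect k) = cells (\<Union>k\<in>F. R k)"
    using Rect_cells by (auto simp: cells_def)
  have Rect_em: "emeasure M (Rect k) = ennreal (sum wt (R k))" if "k \<in> F" for k
    unfolding Rect_cells[OF that] by (rule cells_em[OF R\<Omega>])
  have R_pos: "0 < sum wt (R k)" if "k \<in> F" for k
  proof -
    have "sum wt (R k) = (\<Prod>i<m. sum (\<mu> i) (L k i))"
      unfolding wt_def R_def using finX by (intro prod_sum_PiE[symmetric]) (auto simp: L_def)
    also have "\<dots> > 0"
      using sum_L[OF that] Q(2,3)[OF that] by (intro prod_pos) (auto simp: measure_def enn2real_positive_iff)
    finally show ?thesis .
  qed
  have Ek_fin: "emeasure M (E k \<inter> S) < \<infinity>" if "k \<in> F" "S \<in> sets M" for k S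
  proof -
    have "Rect k \<in> sets M" using Rect_cells[OF that(1)] cells_sets[OF R\<Omega>] setsM by simp
    then have "emeasure M (E k \<inter> S) \<le> emeasure M (Rect k)"
      using E(3)[OF that(1)] by (intro emeasure_mono) auto
    then show ?thesis using Rect_em[OF that(1)] by (auto intro: le_less_trans)
  qed
  have cellM: "cells {x} \<in> sets M" if "x \<in> \<Omega>" for x by (rule setsM[OF cell_sets[OF that]])
  define e where "e k x = measure M (E k \<inter> cells {x})" for k x
  have e0: "0 \<le> e k x" for k x by (simp add: e_def)
  have e_sum: "(\<Sum>x\<in>R k. e k x) = measure M (E k)" if "k \<in> F" for k
  proof -
    have "E k = (\<Union>x\<in>R k. E k \<inter> cells {x})"
      using E(3)[OF that] Rect_cells[OF that] cells_Un[of "R k"] by blast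
    moreover have "measure M (\<Union>x\<in>R k. E k \<inter> cells {x}) = (\<Sum>x\<in>R k. measure M (E k \<inter> cells {x}))"
    proof (rule measure_finite_Union)
      show "finite (R k)" by (rule finite_subset[OF R\<Omega> fin\<Omega>])
      show "(\<lambda>x. E k \<inter> cells {x}) ` R k \<subseteq> sets M"
        using E(2)[OF that] cellM R\<Omega>[of k] by auto
      show "disjoint_family_on (\<lambda>x. E k \<inter> cells {x}) (R k)"
        by (auto simp: disjoint_family_on_def cells_def)
      show "emeasure M (E k \<inter> cells {x}) \<noteq> \<infinity>" if "x \<in> R k" for x
        using Ek_fin[OF \<open>k \<in> F\<close> cellM] R\<Omega>[of k] that by (metis less_irrefl subsetD)
    qed
    ultimately show ?thesis by (simp add: e_def)
  qed
  have e_sum2: "(\<Sum>k\<in>F. e k x) \<le> wt x" if "x \<in> \<Omega>" for x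
  proof -
    have "(\<Sum>k\<in>F. e k x) = measure M (\<Union>k\<in>F. E k \<inter> cells {x})"
      unfolding e_def
    proof (rule measure_finite_Union[symmetric, OF fin])
      show "(\<lambda>k. E k \<inter> cells {x}) ` F \<subseteq> sets M" using E(2) cellM[OF that] by auto
      show "disjoint_family_on (\<lambda>k. E k \<inter> cells {x}) F"
        using E(1) by (auto simp: disjoint_family_on_def)
      show "emeasure M (E k \<inter> cells {x}) \<noteq> \<infinity>" if "k \<in> F" for k
        using Ek_fin[OF that cellM[OF \<open>x \<in> \<Omega>\<close>]] by (metis less_irrefl)
    qed
    also have "\<dots> \<le> measure M (cells {x})"
    proof (rule measure_mono_fmeasurable)
      show "(\<Union>k\<in>F. E k \<inter> cells {x}) \<in> sets M" using E(2) cellM[OF that] by (intro sets.finite_UN fin) auto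
      show "cells {x} \<in> fmeasurable M"
        using cells_em[of "{x}"] cellM[OF that] that by (intro fmeasurableI) auto
    qed auto
    also have "\<dots> = wt x" using cells_em[of "{x}"] that wt0 by (simp add: measure_def)
    finally show ?thesis .
  qed
  have e_le: "e k x \<le> wt x" if "x \<in> \<Omega>" "k \<in> F" for k x
    using member_le_sum[of k F "\<lambda>k. e k x"] e0 fin that e_sum2[OF that(1)] by fastforce
  have Ek: "\<eta> * sum wt (R k) \<le> measure M (E k)" if "k \<in> F" for k
  proof -
    have "emeasure M (E k) = ennreal (measure M (E k))"
      using Ek_fin[OF that sets.top] E(2)[OF that] sets.sets_into_space[OF E(2)[OF that]]
      by (intro emeasure_eq_ennreal_measure) (auto simp: Int_absorb2)
    then have "ennreal (\<eta> * sum wt (R k)) \<le> ennreal (measure M (E k))"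
      using E(4)[OF that] Rect_em[OF that] \<eta> wt0 by (simp add: ennreal_mult sum_nonneg)
    then show ?thesis by (simp add: ennreal_le_iff)
  qed
  \<comment> \<open>Sparseness gives at least the fraction \<open>\<eta>\<close>; scaling by
    \<open>r k\<close>, which is at most 1, produces the equality required in
    \<open>\<epsilon>_mass\<close>.\<close>
  define r where "r k = \<eta> * sum wt (R k) / measure M (E k)" for k
  have Ek_pos: "0 < measure M (E k)" if "k \<in> F" for k
    using Ek[OF that] mult_pos_pos[OF \<eta> R_pos[OF that]] by linarith
  have r: "0 \<le> r k" "r k \<le> 1" if "k \<in> F" for k
    using Ek[OF that] Ek_pos[OF that] R_pos[OF that] \<eta> by (auto simp: r_def)
  \<comment> \<open>Rescaled density of \<open>E k\<close> in the cell \<open>x\<close>. On a null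
    cell the quotient is 0 by convention, and \<open>e k x\<close> vanishes there too.\<close>
  define \<epsilon> where "\<epsilon> k x = (if k \<in> F then r k * (e k x / wt x) else 0)" for k x
  interpret fs: finite_sparse m X \<mu> F L \<epsilon> \<eta>
  proof (unfold_locales, goal_cases)
    case (1 i) show ?case by (rule finX)
  next
    case (2 i a) show ?case by (rule \<mu>0)
  next
    case 3 show ?case by (rule fin)
  next
    case (4 k i) show ?case by (auto simp: L_def)
  next
    case (5 k i)
    then show ?case using sum_L[OF 5] Q(2,3)[OF 5] by (simp add: measure_def enn2real_positive_iff)
  next
    case (6 k l i)
    then obtain z where "z \<in> Q k i" "z \<in> Q l i" by (auto simp: L_def X_def \<phi>_def)
    then have "Q k i \<subseteq> Q l i \<or> Q l i \<subseteq> Q k i" using lam[OF 6(1-3)] by blast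
    then show ?case using 6(1,2) by (auto simp: L_def X_def \<phi>_def)
  next
    case (7 k l)
    have "Q k i \<subseteq> Q l i" if "i < m" for i
    proof
      fix z assume "z \<in> Q k i"
      then have "\<phi> i z \<in> L k i" using 7(1) by (auto simp: L_def X_def \<phi>_def)
      then have "\<phi> i z \<in> L l i" using 7(3)[OF that] by blast
      then show "z \<in> Q l i" by (auto simp: L_def \<phi>_def)
    qed
    then show ?case using inc[OF 7(1,2)] by blast
  next
    case (8 k x) show ?case using r e0 wt0 by (simp add: \<epsilon>_def)
  next
    case (9 x)
    then have x: "x \<in> \<Omega>" by (simp add: \<Omega>_def)
    have "(\<Sum>k\<in>F. \<epsilon> k x) \<le> (\<Sum>k\<in>F. 1 * (e k x / wt x))"
    proof (rule sum_mono)
      fix k assume "k \<in> F"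
      moreover have "r k * (e k x / wt x) \<le> 1 * (e k x / wt x)"
        by (rule mult_right_mono) (use r(2)[OF \<open>k \<in> F\<close>] e0 wt0 in auto)
      ultimately show "\<epsilon> k x \<le> 1 * (e k x / wt x)" by (simp only: \<epsilon>_def if_True)
    qed
    also have "\<dots> = (\<Sum>k\<in>F. e k x) / wt x" by (simp add: sum_divide_distrib)
    also have "\<dots> \<le> 1" using e_sum2[OF x] wt0[of x] by (auto simp: divide_le_eq_1)
    finally show ?case .
  next
    case (10 k)
    have "(\<Sum>x\<in>R k. wt x * \<epsilon> k x) = (\<Sum>x\<in>R k. r k * e k x)"
    proof (rule sum.cong[OF refl])
      fix x assume "x \<in> R k"
      then have "x \<in> \<Omega>" using R\<Omega> by blast
      then have "e k x = 0" if "wt x = 0" using e_le[of x k] e0[of k x] 10 that by simp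
      then show "wt x * \<epsilon> k x = r k * e k x" using 10 by (cases "wt x = 0") (auto simp: \<epsilon>_def)
    qed
    also have "\<dots> = r k * measure M (E k)" using e_sum[OF 10] by (simp flip: sum_distrib_left)
    also have "\<dots> = \<eta> * sum wt (R k)" using Ek_pos[OF 10] by (simp add: r_def)
    finally show ?case by (simp add: R_def wt_def)
  next
    case 11 show ?case by (rule \<eta>)
  qed
  define T where "T = 2 * main_const m / \<eta> * real (K + 1) ^ (m - 1)"
  have T: "0 < T" using main_const_pos[OF m] \<eta> by (simp add: T_def)
  have cnt_card: "fs.cnt F (\<Phi> y) = real (card {k\<in>F. y \<in> Rect k})" if "y \<in> space P" for y
  proof -
    have "fs.cnt F (\<Phi> y) = (\<Sum>k\<in>F. of_bool (y \<in> Rect k))"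
      unfolding fs.cnt_def using Rect_iff[OF that] by (intro sum.cong) (auto simp: R_def)
    also have "\<dots> = real (card (F \<inter> {k. y \<in> Rect k}))" using fin by simp
    also have "F \<inter> {k. y \<in> Rect k} = {k\<in>F. y \<in> Rect k}" by auto
    finally show ?thesis .
  qed
  define B where "B = {x\<in>\<Omega>. T \<le> fs.cnt F x}"
  have set_eq: "{x\<in>space M. T \<le> real (card {k\<in>F. x \<in> Rect k})} = cells B"
  proof -
    \<comment> \<open>The threshold is positive, so a point reaching it lies in some rectangle and
      its labels belong to the finite model.\<close>
    have "\<Phi> y \<in> \<Omega>" if y: "y \<in> space P" "T \<le> real (card {k\<in>F. y \<in> Rect k})" for y
    proof -
      have "{k\<in>F. y \<in> Rect k} \<noteq> {}" using y(2) T by (metis card.empty not_le of_nat_0)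
      then obtain k where "k \<in> F" "y \<in> Rect k" by blast
      then show ?thesis using Rect_iff[OF y(1)] R\<Omega>[of k] by blast
    qed
    then show ?thesis unfolding spM by (auto simp: cells_def B_def cnt_card)
  qed
  \<comment> \<open>The finite estimate concerns cells with positive weight in every coordinate; all
    other cells are null.\<close>
  have "sum wt B = sum wt {x\<in>\<Omega>. (\<forall>i<m. 0 < \<mu> i (x i)) \<and> T \<le> fs.cnt F x}"
  proof (rule sum.mono_neutral_right)
    show "finite B" using fin\<Omega> by (simp add: B_def)
    show "\<forall>x\<in>B - {x\<in>\<Omega>. (\<forall>i<m. 0 < \<mu> i (x i)) \<and> T \<le> fs.cnt F x}. wt x = 0"
    proof
      fix x assume "x \<in> B - {x\<in>\<Omega>. (\<forall>i<m. 0 < \<mu> i (x i)) \<and> T \<le> fs.cnt F x}"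
      then obtain i where "i < m" "\<not> 0 < \<mu> i (x i)" by (auto simp: B_def)
      then have "\<mu> i (x i) = 0" using \<mu>0[of i "x i"] by linarith
      then show "wt x = 0" using \<open>i < m\<close> by (auto simp: wt_def)
    qed
  qed (auto simp: B_def)
  also have "\<dots> \<le> sum wt (\<Union>k\<in>F. R k) / 4 ^ K"
    using fs.level_set_bound[OF m, of K] unfolding fs.W_def T_def \<Omega>_def wt_def R_def .
  finally have "ennreal (sum wt B) \<le> ennreal ((1 / 4) ^ K * sum wt (\<Union>k\<in>F. R k))"
    by (intro ennreal_leI) (simp add: power_divide)
  also have "\<dots> = ennreal ((1 / 4) ^ K) * ennreal (sum wt (\<Union>k\<in>F. R k))"
    using wt0 by (intro ennreal_mult sum_nonneg) auto
  also have "ennreal (sum wt B) = emeasure M (cells B)"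
    by (rule cells_em[symmetric]) (auto simp: B_def)
  also have "ennreal (sum wt (\<Union>k\<in>F. R k)) = emeasure M (\<Union>k\<in>F. Rect k)"
    unfolding UN_cells using R\<Omega> by (intro cells_em[symmetric]) blast
  finally show ?thesis unfolding set_eq[symmetric] T_def .
qed

section \<open>Exponential and power integrability\<close>

lemma ennreal_powr_mono:
  assumes "x \<le> y" "0 \<le> p"
  shows "ennreal_powr x p \<le> ennreal_powr y p"
proof (cases "y = \<infinity>")
  case False
  then have "x \<noteq> \<infinity>" using assms(1) by (auto simp: top_unique)
  moreover have "enn2real x \<le> enn2real y" using assms(1) False by (intro enn2real_mono) (auto simp: top.not_eq_extremum)
  ultimately show ?thesis using False assms(2) by (simp add: ennreal_powr_def powr_mono2 ennreal_leI)
qed (simp add: ennreal_powr_def)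

lemma ennreal_powr_ennreal: "0 \<le> r \<Longrightarrow> ennreal_powr (ennreal r) p = ennreal (r powr p)"
  by (simp add: ennreal_powr_def)

text \<open>The inequality \<open>t \<le> exp t\<close> at \<open>t = u / n\<close>, raised to the
  power \<open>n\<close>. It converts the exponential bound into \<open>L^q\<close> bounds with the
  right growth in \<open>q\<close>.\<close>

lemma powr_le_powr_mult_exp:
  fixes u n :: real
  assumes "0 \<le> u" "0 < n"
  shows "u powr n \<le> n powr n * exp u"
proof -
  have "u / n \<le> exp (u / n)" using exp_ge_add_one_self[of "u / n"] by linarith
  then have "(u / n) powr n \<le> exp (u / n) powr n" using assms by (intro powr_mono2) auto
  also have "\<dots> = exp u" using assms by (simp add: exp_powr_real)
  finally show ?thesis using assms by (simp add: powr_divide field_simps)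
qed

text \<open>One term of the series suffices when \<open>y\<close> is finite: for the last level
  \<open>K\<close> below \<open>y\<close>, the exponential is at most \<open>exp (K + 1)\<close>.
  Replacing \<open>exp 1\<close> by 3 still leaves convergence against level sets decaying like
  \<open>4 ^ - K\<close>. For infinite \<open>y\<close> every term is present and the series
  diverges.\<close>

lemma ennreal_exp_le_level_series:
  assumes "x \<in> B 0" and B: "\<And>K. ennreal (real (Suc K)) < y \<Longrightarrow> x \<in> B (Suc K)"
  shows "ennreal_exp y \<le> (\<Sum>K. ennreal (3 ^ Suc K) * indicator (B K) x)"
proof -
  have term_le: "ennreal (3 ^ Suc K) \<le> (\<Sum>K. ennreal (3 ^ Suc K) * indicator (B K) x)" if "x \<in> B K" for K
    using sum_le_suminf[of "\<lambda>K. ennreal (3 ^ Suc K) * indicator (B K) x" "{K}"] that by simp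
  show ?thesis
  proof (cases y)
    case (real r)
    \<comment> \<open>The last natural number strictly below \<open>r\<close>, or 0 if there is
      none; at level 0 membership holds unconditionally.\<close>
    define K where "K = nat \<lceil>r\<rceil> - 1"
    have rK: "r \<le> real (Suc K)" unfolding K_def by linarith
    have "x \<in> B K"
    proof (cases K)
      case (Suc j)
      then have "real (Suc j) < r" unfolding K_def by linarith
      then have "ennreal (real (Suc j)) < y" using real by (simp add: ennreal_less_iff del: of_nat_Suc)
      then show ?thesis using B[of j] Suc by simp
    qed (use assms(1) in simp)
    have "exp r \<le> exp (real (Suc K))" using rK by simp
    also have "\<dots> = exp 1 ^ Suc K" by (simp only: exp_of_nat_mult[symmetric] mult_1_right)
    also have "\<dots> \<le> 3 ^ Suc K" using exp_le by (intro power_mono) auto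
    finally have "ennreal_exp y \<le> ennreal (3 ^ Suc K)"
      using real by (simp add: ennreal_exp_def ennreal_leI)
    then show ?thesis using term_le[OF \<open>x \<in> B K\<close>] by (rule order_trans)
  next
    case top
    then have "x \<in> B K" for K using assms(1) B by (cases K) auto
    have "of_nat K \<le> (\<Sum>K. ennreal (3 ^ Suc K) * indicator (B K) x)" for K
    proof -
      have "real K < 2 ^ K" by (rule of_nat_less_two_power)
      also have "\<dots> \<le> (3 :: real) ^ K" by (rule power_mono) auto
      also have "\<dots> \<le> 3 ^ Suc K" by simp
      finally have "real K \<le> 3 ^ Suc K" by simp
      then have "ennreal (real K) \<le> ennreal (3 ^ Suc K)" by (rule ennreal_leI)
      then show ?thesis using term_le[OF \<open>x \<in> B K\<close>] unfolding ennreal_of_nat_eq_real_of_nat by (rule order_trans)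
    qed
    then have "(\<Sum>K. ennreal (3 ^ Suc K) * indicator (B K) x) = top"
      by (metis ennreal_Ex_less_of_nat leD less_top)
    then show ?thesis by simp
  qed
qed

text \<open>The terms are bounded by \<open>12 * (3 / 4) ^ K\<close> times \<open>s\<close>, a
  geometric series with sum 48.\<close>

lemma nn_integral_level_series_le:
  assumes "\<And>K. B K \<in> sets M" "\<And>K. emeasure M (B K) \<le> ennreal (4 * (1 / 4) ^ K) * s"
  shows "(\<integral>\<^sup>+x. (\<Sum>K. ennreal (3 ^ Suc K) * indicator (B K) x) \<partial>M) \<le> ennreal 48 * s"
proof -
  have "(\<integral>\<^sup>+x. (\<Sum>K. ennreal (3 ^ Suc K) * indicator (B K) x) \<partial>M)
      = (\<Sum>K. \<integral>\<^sup>+x. ennreal (3 ^ Suc K) * indicator (B K) x \<partial>M)"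
    using assms(1) by (intro nn_integral_suminf) auto
  also have "\<dots> = (\<Sum>K. ennreal (3 ^ Suc K) * emeasure M (B K))"
    using assms(1) by (simp add: nn_integral_cmult_indicator del: power_Suc)
  also have "\<dots> \<le> (\<Sum>K. ennreal (12 * (3 / 4) ^ K) * s)"
  proof (intro suminf_le summableI)
    fix K
    have "ennreal (3 ^ Suc K) * emeasure M (B K) \<le> ennreal (3 ^ Suc K) * (ennreal (4 * (1 / 4) ^ K) * s)"
      using assms(2) by (rule mult_left_mono) simp
    also have "\<dots> = ennreal (3 ^ Suc K * (4 * (1 / 4) ^ K)) * s"
      by (subst ennreal_mult) (auto simp: mult.assoc)
    also have "3 ^ Suc K * (4 * (1 / 4) ^ K) = 12 * (3 / 4 :: real) ^ K" by (simp add: power_divide)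
    finally show "ennreal (3 ^ Suc K) * emeasure M (B K) \<le> ennreal (12 * (3 / 4) ^ K) * s" .
  qed
  also have "\<dots> = (\<Sum>K. ennreal (12 * (3 / 4) ^ K)) * s" by (rule ennreal_suminf_multc)
  also have "(\<Sum>K. ennreal (12 * (3 / 4) ^ K)) = ennreal 48"
  proof -
    have "(\<lambda>K. 12 * (3 / 4 :: real) ^ K) sums (12 * (1 / (1 - 3 / 4)))"
      by (intro sums_mult geometric_sums) simp
    then have "(\<lambda>K. 12 * (3 / 4 :: real) ^ K) sums 48" by simp
    then have "(\<lambda>K. ennreal (12 * (3 / 4) ^ K)) sums ennreal 48" by (subst sums_ennreal) auto
    then show ?thesis by (rule sums_unique[symmetric])
  qed
  finally show ?thesis .
qed

text \<open>The function \<open>y\<close> is scaled so that exceeding \<open>Suc K\<close> means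
  that \<open>h\<close> exceeds the threshold \<open>A / \<eta> * Suc K ^ p\<close>. The level
  series \<open>g\<close> then dominates \<open>ennreal_exp y\<close> on \<open>S\<close>, and it
  also dominates \<open>h ^ q\<close> up to a constant, because a power of \<open>y\<close> is
  bounded by its exponential.\<close>

lemma exp_integral_and_Lq_norm_le:
  fixes h :: "'a \<Rightarrow> ennreal" and p :: nat and A \<eta> :: real
  assumes p: "0 < p" and A: "0 < A" and \<eta>: "0 < \<eta>"
    and S: "S \<in> sets M" "emeasure M S < \<infinity>" and h: "\<And>x. x \<notin> S \<Longrightarrow> h x = 0"
    and B: "\<And>K. B K \<in> sets M" "\<And>K. emeasure M (B K) \<le> ennreal ((1 / 4) ^ K) * emeasure M S"
    and hB: "\<And>K x. x \<in> S \<Longrightarrow> ennreal (A / \<eta> * real (Suc K) ^ p) < h x \<Longrightarrow> x \<in> B K"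
  defines "y \<equiv> \<lambda>x. ennreal (A powr (- 1 / real p)) * ennreal_powr (ennreal \<eta> * h x) (1 / real p)"
  shows "(\<integral>\<^sup>+x\<in>S. (ennreal_exp (y x) - 1) \<partial>M) \<le> ennreal 48 * emeasure M S"
    and "1 \<le> q \<Longrightarrow> Lq_norm M q h
      \<le> ennreal (48 * A * real p ^ p * inverse \<eta> * q ^ p) * ennreal_powr (emeasure M S) (1 / q)"
proof -
  \<comment> \<open>Index shift: level 0 is all of \<open>S\<close>, and level \<open>Suc K\<close>
    is \<open>B K\<close>. This costs the factor 4 in the measure bound.\<close>
  define B' where "B' = case_nat S B"
  define g where "g x = (\<Sum>K. ennreal (3 ^ Suc K) * indicator (B' K) x)" for x
  have B'm: "B' K \<in> sets M" for K using S B by (cases K) (auto simp: B'_def)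
  have "emeasure M (B' K) \<le> ennreal (4 * (1 / 4) ^ K) * emeasure M S" for K
  proof (cases K)
    case 0
    have "1 * emeasure M S \<le> ennreal 4 * emeasure M S" by (rule mult_right_mono) auto
    then show ?thesis using 0 by (simp add: B'_def)
  next
    case (Suc j)
    then show ?thesis using B(2)[of j] by (simp add: B'_def)
  qed
  then have g_int: "(\<integral>\<^sup>+x. g x \<partial>M) \<le> ennreal 48 * emeasure M S"
    unfolding g_def by (intro nn_integral_level_series_le B'm)
  define c where "c = A powr (- 1 / real p)"
  have c: "0 < c" using A by (simp add: c_def)
  have cp: "c powr real p = 1 / A" using A p by (simp add: c_def powr_powr powr_neg_one)
  have y_c: "y x = ennreal c * ennreal_powr (ennreal \<eta> * h x) (1 / real p)" for x by (simp only: y_def c_def)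
  have y_real: "y x = ennreal (c * (\<eta> * r) powr (1 / real p))" if "h x = ennreal r" "0 \<le> r" for x r
    using that \<eta> c by (simp add: y_c ennreal_powr_ennreal ennreal_mult[symmetric] del: ennreal_mult'')
  have exp_le_g: "ennreal_exp (y x) \<le> g x" if x: "x \<in> S" for x
    unfolding g_def
  proof (rule ennreal_exp_le_level_series)
    show "x \<in> B' 0" using x by (simp add: B'_def)
    fix K assume K: "ennreal (real (Suc K)) < y x"
    have "ennreal (A / \<eta> * real (Suc K) ^ p) < h x"
    proof (cases "h x")
      case (real r)
      have "r > A / \<eta> * real (Suc K) ^ p"
      proof (rule ccontr)
        assume "\<not> ?thesis"
        then have "\<eta> * r \<le> A * real (Suc K) powr real p" using \<eta> by (simp add: field_simps powr_realpow)
        then have "(\<eta> * r) powr (1 / real p) \<le> (A * real (Suc K) powr real p) powr (1 / real p)"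
          using real \<eta> by (intro powr_mono2) auto
        also have "\<dots> = A powr (1 / real p) * real (Suc K)"
          using A p by (simp add: powr_mult powr_powr)
        finally have "c * (\<eta> * r) powr (1 / real p) \<le> c * (A powr (1 / real p) * real (Suc K))"
          using c by (intro mult_left_mono) auto
        also have "\<dots> = real (Suc K)"
          using A p by (simp add: c_def powr_minus_divide)
        finally have "y x \<le> ennreal (real (Suc K))" using y_real[OF real(2,1)] by (simp only: ennreal_leI)
        then show False using K by (meson leD)
      qed
      then show ?thesis using real A \<eta> by (simp add: ennreal_less_iff)
    qed simp
    then show "x \<in> B' (Suc K)" using hB[OF x] by (simp add: B'_def)
  qed
  show "(\<integral>\<^sup>+x\<in>S. (ennreal_exp (y x) - 1) \<partial>M) \<le> ennreal 48 * emeasure M S"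
  proof (rule order_trans[OF nn_integral_mono g_int])
    fix x
    show "(ennreal_exp (y x) - 1) * indicator S x \<le> g x"
      using exp_le_g[of x] by (auto simp: indicator_def intro: order_trans[OF diff_le_self_ennreal])
  qed
  assume q: "1 \<le> q"
  define n where "n = real p * q"
  have n: "0 < n" using p q by (simp add: n_def)
  \<comment> \<open>With \<open>n = p * q\<close>, the factor \<open>n powr n\<close> is the
    \<open>q\<close>-th power of \<open>p ^ p * q ^ p\<close>; taking the \<open>q\<close>-th root
    of \<open>D\<close> later yields the growth \<open>q ^ p\<close>.\<close>
  define D where "D = (A * real p ^ p * q ^ p / \<eta>) powr q"
  have pw: "ennreal_powr (h x) q \<le> ennreal D * g x" for x
  proof (cases "x \<in> S")
    case True
    show ?thesis
    proof (cases "h x")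
      case (real r)
      define u where "u = c * (\<eta> * r) powr (1 / real p)"
      have u: "0 \<le> u" using c by (simp add: u_def)
      have "u powr real p = \<eta> * r / A"
        using real \<eta> p A c cp by (simp add: u_def powr_mult powr_powr)
      then have "r = A / \<eta> * u powr real p" using A \<eta> by (simp add: field_simps)
      then have "r powr q = (A / \<eta>) powr q * (u powr real p) powr q"
        using A \<eta> by (simp only: powr_mult)
      then have "r powr q = (A / \<eta>) powr q * u powr n" by (simp only: powr_powr n_def)
      also have "\<dots> \<le> (A / \<eta>) powr q * (n powr n * exp u)"
        using powr_le_powr_mult_exp[OF u n] by (intro mult_left_mono) auto
      also have "\<dots> = D * exp u"
      proof -
        have "n powr n = (n ^ p) powr q"
          using n by (simp add: n_def powr_powr flip: powr_realpow)
        then have "(A / \<eta>) powr q * n powr n = D"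
          unfolding D_def n_def using A \<eta> q p
          by (simp flip: powr_mult add: power_mult_distrib mult.commute mult.left_commute)
        then show ?thesis by simp
      qed
      finally have "ennreal (r powr q) \<le> ennreal (D * exp u)" by (rule ennreal_leI)
      also have "\<dots> = ennreal D * ennreal (exp u)" by (rule ennreal_mult) (auto simp: D_def)
      also have "ennreal (exp u) = ennreal_exp (y x)"
        using y_real[of x r] real u by (simp add: ennreal_exp_def u_def)
      also have "ennreal D * \<dots> \<le> ennreal D * g x" by (intro mult_left_mono exp_le_g True) simp
      finally show ?thesis using real by (simp add: ennreal_powr_ennreal)
    next
      case top
      have "y x = top" using top c \<eta> by (simp add: y_c ennreal_powr_def ennreal_mult_top)
      then have "g x = top" using exp_le_g[OF True] by (simp add: ennreal_exp_def top_unique)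
      moreover have "0 < D" using A \<eta> p q by (simp add: D_def)
      ultimately show ?thesis by (simp add: ennreal_mult_top)
    qed
  next
    case False
    then show ?thesis using h[of x] q by (simp add: ennreal_powr_def)
  qed
  obtain s where s: "emeasure M S = ennreal s" "0 \<le> s" using S(2) by (cases "emeasure M S") auto
  have "(\<integral>\<^sup>+x. ennreal_powr (h x) q \<partial>M) \<le> (\<integral>\<^sup>+x. ennreal D * g x \<partial>M)" by (intro nn_integral_mono pw)
  also have "\<dots> = ennreal D * (\<integral>\<^sup>+x. g x \<partial>M)"
    unfolding g_def using B'm by (intro nn_integral_cmult) auto
  also have "\<dots> \<le> ennreal D * (ennreal 48 * ennreal s)" using g_int s(1) by (intro mult_left_mono) auto
  also have "\<dots> = ennreal (D * (48 * s))" using s(2) by (simp add: ennreal_mult D_def)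
  finally have "Lq_norm M q h \<le> ennreal_powr (ennreal (D * (48 * s))) (1 / q)"
    unfolding Lq_norm_def using q by (intro ennreal_powr_mono) auto
  also have "\<dots> = ennreal ((D * (48 * s)) powr (1 / q))"
    using s(2) by (intro ennreal_powr_ennreal) (auto simp: D_def)
  also have "\<dots> \<le> ennreal (48 * A * real p ^ p * inverse \<eta> * q ^ p * s powr (1 / q))"
  proof (rule ennreal_leI)
    have "D powr (1 / q) = A * real p ^ p * q ^ p / \<eta>"
      using A \<eta> q by (simp add: D_def powr_powr)
    then have "(D * (48 * s)) powr (1 / q) = A * real p ^ p * q ^ p / \<eta> * (48 powr (1 / q) * s powr (1 / q))"
      using s(2) by (simp add: powr_mult D_def)
    \<comment> \<open>The \<open>q\<close>-th root of 48 is bounded by 48 because \<open>q\<close>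
      is at least 1.\<close>
    also have "\<dots> \<le> A * real p ^ p * q ^ p / \<eta> * (48 powr 1 * s powr (1 / q))"
      using A \<eta> q by (intro mult_left_mono mult_right_mono powr_mono) auto
    also have "\<dots> = 48 * A * real p ^ p * inverse \<eta> * q ^ p * s powr (1 / q)" by (simp add: field_simps)
    finally show "(D * (48 * s)) powr (1 / q) \<le> 48 * A * real p ^ p * inverse \<eta> * q ^ p * s powr (1 / q)" .
  qed
  also have "\<dots> = ennreal (48 * A * real p ^ p * inverse \<eta> * q ^ p) * ennreal_powr (emeasure M S) (1 / q)"
    using s A \<eta> q by (simp add: ennreal_powr_ennreal ennreal_mult)
  finally show "Lq_norm M q h
      \<le> ennreal (48 * A * real p ^ p * inverse \<eta> * q ^ p) * ennreal_powr (emeasure M S) (1 / q)" .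
qed

section \<open>Dyadic rectangles\<close>

text \<open>Each cube contains a point with rational coordinates, and disjointness makes the choice
  of such points injective.\<close>

lemma countable_disjoint_half_open_cubes:
  assumes cubes: "\<And>Q. Q \<in> \<C> \<Longrightarrow> \<exists>a l. 0 < l \<and> Q = half_open_cube n a l" and "disjoint \<C>"
  shows "countable \<C>"
proof -
  have "\<exists>z. z \<in> Q \<inter> ({..<n} \<rightarrow>\<^sub>E \<rat>)" if "Q \<in> \<C>" for Q
  proof -
    obtain a l where Q: "0 < l" "Q = half_open_cube n a l" using cubes[OF \<open>Q \<in> \<C>\<close>] by blast
    have "\<exists>t\<in>\<rat>. a j < t \<and> t < a j + l" for j using Rats_dense_in_real[of "a j" "a j + l"] Q(1) by simp
    then obtain t where "t j \<in> \<rat>" "a j < t j" "t j < a j + l" for j by metis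
    then have "restrict t {..<n} \<in> Q \<inter> ({..<n} \<rightarrow>\<^sub>E \<rat>)" by (auto simp: Q(2) half_open_cube_def less_imp_le)
    then show ?thesis by blast
  qed
  then obtain z where z: "\<And>Q. Q \<in> \<C> \<Longrightarrow> z Q \<in> Q \<inter> ({..<n} \<rightarrow>\<^sub>E \<rat>)" by metis
  have "inj_on z \<C>"
  proof (rule inj_onI)
    fix Q R assume "Q \<in> \<C>" "R \<in> \<C>" "z Q = z R"
    then have "Q \<inter> R \<noteq> {}" using z[of Q] z[of R] by auto
    then show "Q = R" using disjointD[OF assms(2) \<open>Q \<in> \<C>\<close> \<open>R \<in> \<C>\<close>] by blast
  qed
  moreover have "countable (z ` \<C>)"
    by (rule countable_subset[of _ "{..<n} \<rightarrow>\<^sub>E \<rat>"]) (use z in \<open>auto intro!: countable_PiE countable_rat\<close>)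
  ultimately show ?thesis by (rule countable_image_inj_on[rotated])
qed

lemma countable_dyadic_grid:
  assumes "dyadic_grid n \<D>"
  shows "countable \<D>"
proof -
  define \<C> where "\<C> k = {Q\<in>\<D>. \<exists>a. Q = half_open_cube n a (2 powi k)}" for k :: int
  have "countable (\<C> k)" for k
  proof (rule countable_disjoint_half_open_cubes)
    show "disjoint (\<C> k)" using assms by (auto simp: dyadic_grid_def \<C>_def partition_on_def)
    show "\<exists>a l. 0 < l \<and> Q = half_open_cube n a l" if "Q \<in> \<C> k" for Q
    proof -
      obtain a where "Q = half_open_cube n a (2 powi k)" using \<open>Q \<in> \<C> k\<close> by (auto simp: \<C>_def)
      then show ?thesis by (intro exI[of _ a] exI[of _ "2 powi k"]) simp
    qed
  qed
  moreover have "\<D> = (\<Union>k. \<C> k)" using assms by (auto simp: dyadic_grid_def \<C>_def)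
  ultimately show ?thesis by simp
qed

lemma countable_dyadic_rectangles:
  assumes "\<And>i. i < m \<Longrightarrow> dyadic_grid (d i) (\<D> i)"
  shows "countable (dyadic_rectangles m \<D>)"
proof -
  have "dyadic_rectangles m \<D> \<subseteq> PiE {..<m} ` PiE {..<m} \<D>"
  proof
    fix I assume "I \<in> dyadic_rectangles m \<D>"
    then obtain Q where Q: "I = PiE {..<m} Q" "\<forall>i<m. Q i \<in> \<D> i" by (auto simp: dyadic_rectangles_def)
    have "I = PiE {..<m} (restrict Q {..<m})" unfolding Q(1) by (rule PiE_cong) simp
    moreover have "restrict Q {..<m} \<in> PiE {..<m} \<D>" using Q(2) by auto
    ultimately show "I \<in> PiE {..<m} ` PiE {..<m} \<D>" by blast
  qed
  moreover have "countable (PiE {..<m} \<D>)"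
    using assms by (intro countable_PiE countable_dyadic_grid) auto
  ultimately show ?thesis by (meson countable_image countable_subset)
qed

lemma sets_half_open_cube: "half_open_cube n a l \<in> sets (\<Pi>\<^sub>M j\<in>{..<n}. (lborel :: real measure))"
  unfolding half_open_cube_def by (rule sets_PiM_I_finite) auto

lemma emeasure_half_open_cube:
  assumes "0 \<le> l"
  shows "emeasure (\<Pi>\<^sub>M j\<in>{..<n}. (lborel :: real measure)) (half_open_cube n a l) = ennreal (l ^ n)"
proof -
  interpret product_sigma_finite "\<lambda>_::nat. lborel :: real measure" ..
  have "emeasure (\<Pi>\<^sub>M j\<in>{..<n}. (lborel :: real measure)) (half_open_cube n a l)
      = (\<Prod>j<n. emeasure lborel {a j..<a j + l})"
    unfolding half_open_cube_def by (rule emeasure_PiM) auto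
  also have "\<dots> = ennreal (l ^ n)" using assms by (simp add: ennreal_power)
  finally show ?thesis .
qed

lemma dyadic_grid_cube:
  assumes "dyadic_grid n \<D>" "Q \<in> \<D>"
  shows "Q \<in> sets (\<Pi>\<^sub>M j\<in>{..<n}. (lborel :: real measure))"
    and "0 < emeasure (\<Pi>\<^sub>M j\<in>{..<n}. (lborel :: real measure)) Q"
    and "emeasure (\<Pi>\<^sub>M j\<in>{..<n}. (lborel :: real measure)) Q < \<infinity>"
proof -
  obtain k :: int and a where Q: "Q = half_open_cube n a (2 powi k)" using assms by (auto simp: dyadic_grid_def)
  then show "Q \<in> sets (\<Pi>\<^sub>M j\<in>{..<n}. (lborel :: real measure))" by (simp add: sets_half_open_cube)
  show "0 < emeasure (\<Pi>\<^sub>M j\<in>{..<n}. (lborel :: real measure)) Q"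
    "emeasure (\<Pi>\<^sub>M j\<in>{..<n}. (lborel :: real measure)) Q < \<infinity>"
    unfolding Q by (simp_all add: emeasure_half_open_cube)
qed

lemma sets_dyadic_rectangle:
  assumes "\<And>i. i < m \<Longrightarrow> dyadic_grid (d i) (\<D> i)" "I \<in> dyadic_rectangles m \<D>"
  shows "I \<in> sets (lebesgue_prod m d)"
proof -
  obtain Q where "I = PiE {..<m} Q" "\<forall>i<m. Q i \<in> \<D> i" using assms(2) by (auto simp: dyadic_rectangles_def)
  then have "I \<in> sets (\<Pi>\<^sub>M i\<in>{..<m}. \<Pi>\<^sub>M j\<in>{..<d i}. (lborel :: real measure))"
    using dyadic_grid_cube(1)[OF assms(1)] by (auto intro!: sets_PiM_I_finite)
  then show ?thesis unfolding lebesgue_prod_def by (rule sets_completionI_sets)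
qed

section \<open>Level sets of finite and countable families of dyadic rectangles\<close>

text \<open>The rectangles serve as their own index set, with sides chosen from the grids.
  Coordinatewise inclusion of the chosen sides implies inclusion of the rectangles, so
  incomparability carries over.\<close>

lemma level_set_bound_dyadic:
  fixes m K :: nat
  assumes m: "0 < m" and \<eta>: "0 < \<eta>" and grid: "\<And>i. i < m \<Longrightarrow> dyadic_grid (d i) (\<D> i)"
    and F: "finite F" "F \<subseteq> dyadic_rectangles m \<D>" "incomparable F" "sparse_family (lebesgue_prod m d) \<eta> F"
  shows "emeasure (lebesgue_prod m d)
      {x\<in>space (lebesgue_prod m d). 2 * main_const m / \<eta> * real (K + 1) ^ (m - 1) \<le> real (card {I\<in>F. x \<in> I})}
    \<le> ennreal ((1 / 4) ^ K) * emeasure (lebesgue_prod m d) (shadow F)"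
proof -
  interpret inner: product_sigma_finite "\<lambda>_::nat. lborel :: real measure" ..
  have outer: "product_sigma_finite (\<lambda>i. \<Pi>\<^sub>M j\<in>{..<d i}. (lborel :: real measure))"
    by (simp add: product_sigma_finite_def inner.sigma_finite)
  have "\<exists>Q. I = PiE {..<m} Q \<and> (\<forall>i<m. Q i \<in> \<D> i)" if "I \<in> F" for I
    using F(2) that by (auto simp: dyadic_rectangles_def)
  then obtain Q where Q: "\<And>I. I \<in> F \<Longrightarrow> PiE {..<m} (Q I) = I" "\<And>I i. I \<in> F \<Longrightarrow> i < m \<Longrightarrow> Q I i \<in> \<D> i"
    by metis
  obtain E where E: "disjoint_family_on E F" "\<And>I. I \<in> F \<Longrightarrow> E I \<in> sets (lebesgue_prod m d)"
    "\<And>I. I \<in> F \<Longrightarrow> E I \<subseteq> I"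
    "\<And>I. I \<in> F \<Longrightarrow> ennreal \<eta> * emeasure (lebesgue_prod m d) I \<le> emeasure (lebesgue_prod m d) (E I)"
    using F(4) by (auto simp: sparse_family_def)
  have lam: "Q I i \<subseteq> Q J i \<or> Q J i \<subseteq> Q I i" if "I \<in> F" "J \<in> F" "i < m" "Q I i \<inter> Q J i \<noteq> {}" for I J i
    using grid[OF that(3)] Q(2)[OF that(1,3)] Q(2)[OF that(2,3)] that(4) by (auto simp: dyadic_grid_def)
  have inc: "I = J" if "I \<in> F" "J \<in> F" "\<And>i. i < m \<Longrightarrow> Q I i \<subseteq> Q J i" for I J
  proof -
    have "PiE {..<m} (Q I) \<subseteq> PiE {..<m} (Q J)" using that(3) by (intro PiE_mono) auto
    then show ?thesis using F(3) that(1,2) Q(1) by (simp add: incomparable_def)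
  qed
  have "emeasure (lebesgue_prod m d)
      {x\<in>space (lebesgue_prod m d). 2 * main_const m / \<eta> * real (K + 1) ^ (m - 1) \<le> real (card {I\<in>F. x \<in> PiE {..<m} (Q I)})}
    \<le> ennreal ((1 / 4) ^ K) * emeasure (lebesgue_prod m d) (\<Union>I\<in>F. PiE {..<m} (Q I))"
    unfolding lebesgue_prod_def
    by (rule level_set_bound_product[OF outer F(1) m \<eta> _ _ _ lam inc E(1)])
      (use dyadic_grid_cube[OF grid] Q E in \<open>auto simp: lebesgue_prod_def\<close>)
  also have "(\<Union>I\<in>F. PiE {..<m} (Q I)) = shadow F" using Q(1) by (auto simp: shadow_def)
  finally show ?thesis using Q(1) by (simp cong: conj_cong)
qed

text \<open>An infinite sum in \<open>ennreal\<close> is the supremum of its finite partial sums, so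
  a strict lower bound is already attained on a finite subfamily.\<close>

lemma counting_function_gtD:
  assumes "ennreal T < counting_function \<G> x" "0 \<le> T"
  obtains F where "finite F" "F \<subseteq> \<G>" "T < real (card {I\<in>F. x \<in> I})"
proof -
  have "counting_function \<G> x = (SUP F\<in>{F. finite F \<and> F \<subseteq> \<G>}. \<Sum>I\<in>F. indicator I x)"
    unfolding counting_function_def by (rule nonneg_infsum_complete) simp
  then obtain F where F: "finite F" "F \<subseteq> \<G>" "ennreal T < (\<Sum>I\<in>F. indicator I x)"
    using assms by (auto simp: less_SUP_iff)
  have "(\<Sum>I\<in>F. indicator I x :: ennreal) = of_nat (card {I\<in>F. x \<in> I})"
    using F(1) by (simp add: indicator_def sum.If_cases Int_def)
  then show ?thesis using that F assms(2) by (simp add: ennreal_of_nat_eq_real_of_nat ennreal_less_iff)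
qed

lemma counting_function_eq_0: "x \<notin> shadow \<G> \<Longrightarrow> counting_function \<G> x = 0"
  unfolding counting_function_def shadow_def by (rule infsum_0) (auto simp: indicator_def)

text \<open>Exhaustion by finite subfamilies, which inherit incomparability and sparseness. The
  bound for their level sets is uniform, so it passes to the increasing union.\<close>

lemma level_set_bound_countable:
  fixes m K :: nat
  assumes m: "0 < m" and \<eta>: "0 < \<eta>" and grid: "\<And>i. i < m \<Longrightarrow> dyadic_grid (d i) (\<D> i)"
    and \<G>: "\<G> \<subseteq> dyadic_rectangles m \<D>" "incomparable \<G>" "sparse_family (lebesgue_prod m d) \<eta> \<G>"
  obtains B where "B \<in> sets (lebesgue_prod m d)"
    "emeasure (lebesgue_prod m d) B \<le> ennreal ((1 / 4) ^ K) * emeasure (lebesgue_prod m d) (shadow \<G>)"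
    "\<And>x. x \<in> space (lebesgue_prod m d) \<Longrightarrow>
      ennreal (2 * main_const m / \<eta> * real (K + 1) ^ (m - 1)) < counting_function \<G> x \<Longrightarrow> x \<in> B"
proof -
  define M where "M = lebesgue_prod m d"
  define T where "T = 2 * main_const m / \<eta> * real (K + 1) ^ (m - 1)"
  have T: "0 \<le> T" using main_const_pos[OF m] \<eta> by (simp add: T_def)
  have ctbl: "countable \<G>" by (rule countable_subset[OF \<G>(1) countable_dyadic_rectangles[OF grid]])
  have sets: "I \<in> sets M" if "I \<in> \<G>" for I
    unfolding M_def by (rule sets_dyadic_rectangle[OF grid]) (use that \<G>(1) in auto)
  \<comment> \<open>The intersection takes care of empty \<open>\<G>\<close>, for which
    \<open>from_nat_into\<close> returns an unspecified value.\<close>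
  define F where "F n = from_nat_into \<G> ` {..<n} \<inter> \<G>" for n
  have F: "finite (F n)" "F n \<subseteq> \<G>" for n by (auto simp: F_def)
  have F_mono: "F i \<subseteq> F j" if "i \<le> j" for i j using that by (auto simp: F_def)
  define V where "V n = {x\<in>space M. T \<le> real (card {I\<in>F n. x \<in> I})}" for n
  have V_sets: "V n \<in> sets M" for n
  proof -
    have "V n = {x\<in>space M. T \<le> (\<Sum>I\<in>F n. indicator I x)}"
      using F(1) by (simp add: V_def indicator_def sum.If_cases Int_def)
    moreover have "I \<in> sets M" if "I \<in> F n" for I using sets F that by blast
    ultimately show ?thesis by simp
  qed
  have "incseq V"
  proof (rule incseq_SucI, rule subsetI)
    fix n x assume x: "x \<in> V n"
    have "card {I\<in>F n. x \<in> I} \<le> card {I\<in>F (Suc n). x \<in> I}"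
      using F(1) F_mono[of n "Suc n"] by (intro card_mono) auto
    then show "x \<in> V (Suc n)" using x by (simp add: V_def)
  qed
  have "emeasure M (V n) \<le> ennreal ((1 / 4) ^ K) * emeasure M (shadow \<G>)" for n
  proof -
    have "incomparable (F n)" using \<G>(2) F(2)[of n] unfolding incomparable_def by blast
    moreover have "sparse_family M \<eta> (F n)"
      using \<G>(3) F(2)[of n] unfolding M_def sparse_family_def
      by (meson disjoint_family_on_mono subsetD)
    ultimately have "emeasure M (V n) \<le> ennreal ((1 / 4) ^ K) * emeasure M (shadow (F n))"
      unfolding V_def M_def T_def using F \<G>(1)
      by (intro level_set_bound_dyadic[where \<D> = \<D>] m \<eta> grid) (auto simp: subset_iff)
    also have "\<dots> \<le> ennreal ((1 / 4) ^ K) * emeasure M (shadow \<G>)"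
    proof (intro mult_left_mono emeasure_mono)
      show "shadow (F n) \<subseteq> shadow \<G>" using F(2)[of n] by (auto simp: shadow_def)
      show "shadow \<G> \<in> sets M" unfolding shadow_def
        using ctbl sets by (intro sets.countable_Union) auto
    qed simp
    finally show ?thesis .
  qed
  then have "emeasure M (\<Union>n. V n) \<le> ennreal ((1 / 4) ^ K) * emeasure M (shadow \<G>)"
    using V_sets \<open>incseq V\<close> by (subst SUP_emeasure_incseq[symmetric]) (auto intro!: SUP_least)
  moreover have "x \<in> (\<Union>n. V n)" if x: "x \<in> space M" "ennreal T < counting_function \<G> x" for x
  proof -
    obtain H where H: "finite H" "H \<subseteq> \<G>" "T < real (card {I\<in>H. x \<in> I})"
      using counting_function_gtD[OF x(2) T] by blast
    have "\<exists>n. H \<subseteq> F n"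
    proof -
      \<comment> \<open>An index beyond all members of \<open>H\<close>; the added 0 keeps the
        maximum defined for empty \<open>H\<close>.\<close>
      define n where "n = Suc (Max (to_nat_on \<G> ` H \<union> {0}))"
      have "I \<in> F n" if "I \<in> H" for I
      proof -
        have "to_nat_on \<G> I < n" using H(1) that by (auto simp: n_def less_Suc_eq_le intro!: Max_ge)
        moreover have "from_nat_into \<G> (to_nat_on \<G> I) = I" using ctbl H(2) that by auto
        ultimately show ?thesis using H(2) that by (force simp: F_def)
      qed
      then show ?thesis by blast
    qed
    then obtain n where "H \<subseteq> F n" by blast
    then have "card {I\<in>H. x \<in> I} \<le> card {I\<in>F n. x \<in> I}" using F(1) by (intro card_mono) auto
    then have "x \<in> V n" using H(3) x(1) by (simp add: V_def)
    then show ?thesis by blast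
  qed
  ultimately show ?thesis using that[of "\<Union>n. V n"] V_sets unfolding M_def T_def by blast
qed

section \<open>Both assertions from the level set estimate\<close>

theorem theorem3p2:
  fixes m D :: nat
  assumes "2 \<le> m"
  shows "\<exists>c C :: real. 0 < c \<and> 0 < C \<and>
    (\<forall>(d :: nat \<Rightarrow> nat) (\<D> :: nat \<Rightarrow> (nat \<Rightarrow> real) set set) (\<eta> :: real)
       (\<G> :: (nat \<Rightarrow> nat \<Rightarrow> real) set set).
      (\<forall>i<m. 1 \<le> d i) \<longrightarrow> (\<Sum>i<m. d i) = D \<longrightarrow>
      (\<forall>i<m. dyadic_grid (d i) (\<D> i)) \<longrightarrow>
      0 < \<eta> \<longrightarrow> \<eta> \<le> 1 \<longrightarrow>
      \<G> \<subseteq> dyadic_rectangles m \<D> \<longrightarrow>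
      incomparable \<G> \<longrightarrow>
      sparse_family (lebesgue_prod m d) \<eta> \<G> \<longrightarrow>
      emeasure (lebesgue_prod m d) (shadow \<G>) < \<infinity> \<longrightarrow>
      (\<forall>q::real. 2 \<le> q \<longrightarrow>
        Lq_norm (lebesgue_prod m d) q (counting_function \<G>)
          \<le> ennreal (C * inverse \<eta> * q ^ (m - 1))
            * ennreal_powr (emeasure (lebesgue_prod m d) (shadow \<G>)) (1 / q)) \<and>
      (\<integral>\<^sup>+x\<in>shadow \<G>.
          (ennreal_exp (ennreal c
             * ennreal_powr (ennreal \<eta> * counting_function \<G> x) (1 / real (m - 1))) - 1)
          \<partial>lebesgue_prod m d)
        \<le> ennreal C * emeasure (lebesgue_prod m d) (shadow \<G>))"
proof -
  define p where "p = m - 1"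
  \<comment> \<open>The coefficient of \<open>(K + 1) ^ p / \<eta>\<close> in the thresholds of the
    level set estimate.\<close>
  define A where "A = 2 * main_const m"
  have m: "0 < m" and p: "0 < p" using assms by (auto simp: p_def)
  have A: "0 < A" using main_const_pos[OF m] by (simp add: A_def)
  \<comment> \<open>A single constant serves both parts: 48 is that of the exponential integral, and
    \<open>48 * A * real p ^ p\<close> that of the norm bound.\<close>
  have main: "(\<forall>q::real. 2 \<le> q \<longrightarrow>
        Lq_norm (lebesgue_prod m d) q (counting_function \<G>)
          \<le> ennreal ((48 + 48 * A * real p ^ p) * inverse \<eta> * q ^ (m - 1))
            * ennreal_powr (emeasure (lebesgue_prod m d) (shadow \<G>)) (1 / q)) \<and>
      (\<integral>\<^sup>+x\<in>shadow \<G>.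
          (ennreal_exp (ennreal (A powr (- 1 / real p))
             * ennreal_powr (ennreal \<eta> * counting_function \<G> x) (1 / real (m - 1))) - 1)
          \<partial>lebesgue_prod m d)
        \<le> ennreal (48 + 48 * A * real p ^ p) * emeasure (lebesgue_prod m d) (shadow \<G>)"
    if grid: "\<forall>i<m. dyadic_grid (d i) (\<D> i)" and \<eta>: "0 < \<eta>"
      and \<G>: "\<G> \<subseteq> dyadic_rectangles m \<D>" "incomparable \<G>" "sparse_family (lebesgue_prod m d) \<eta> \<G>"
      and fin: "emeasure (lebesgue_prod m d) (shadow \<G>) < \<infinity>"
    for d \<D> \<eta> \<G>
  proof -
    define M where "M = lebesgue_prod m d"
    have grid': "dyadic_grid (d i) (\<D> i)" if "i < m" for i using grid that by simp
    have "countable \<G>" by (rule countable_subset[OF \<G>(1) countable_dyadic_rectangles[OF grid']])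
    moreover have "\<G> \<subseteq> sets M"
      unfolding M_def using \<G>(1) by (auto intro: sets_dyadic_rectangle[where \<D> = \<D>, OF grid'])
    ultimately have S: "shadow \<G> \<in> sets M" unfolding shadow_def by (intro sets.countable_Union)
    have "\<exists>B. B \<in> sets M \<and> emeasure M B \<le> ennreal ((1 / 4) ^ K) * emeasure M (shadow \<G>) \<and>
        (\<forall>x\<in>space M. ennreal (A / \<eta> * real (Suc K) ^ p) < counting_function \<G> x \<longrightarrow> x \<in> B)" for K
    proof -
      obtain B where "B \<in> sets M" "emeasure M B \<le> ennreal ((1 / 4) ^ K) * emeasure M (shadow \<G>)"
        "\<And>x. x \<in> space M \<Longrightarrow>
          ennreal (A / \<eta> * real (K + 1) ^ p) < counting_function \<G> x \<Longrightarrow> x \<in> B"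
        using level_set_bound_countable[OF m \<eta> grid' \<G>, of K] unfolding M_def A_def p_def by blast
      then show ?thesis unfolding Suc_eq_plus1 by blast
    qed
    then obtain B where B: "\<And>K. B K \<in> sets M"
      "\<And>K. emeasure M (B K) \<le> ennreal ((1 / 4) ^ K) * emeasure M (shadow \<G>)"
      "\<And>K x. x \<in> space M \<Longrightarrow> ennreal (A / \<eta> * real (Suc K) ^ p) < counting_function \<G> x \<Longrightarrow> x \<in> B K"
      by metis
    have hB: "x \<in> B K" if "x \<in> shadow \<G>" "ennreal (A / \<eta> * real (Suc K) ^ p) < counting_function \<G> x" for K x
      using B(3) that sets.sets_into_space[OF S] by blast
    note bounds = exp_integral_and_Lq_norm_le[OF p A \<eta> S fin[folded M_def] counting_function_eq_0 B(1,2) hB]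
    have Lq: "Lq_norm M q (counting_function \<G>)
        \<le> ennreal ((48 + 48 * A * real p ^ p) * inverse \<eta> * q ^ p) * ennreal_powr (emeasure M (shadow \<G>)) (1 / q)"
      if "2 \<le> q" for q
    proof -
      have "Lq_norm M q (counting_function \<G>)
        \<le> ennreal (48 * A * real p ^ p * inverse \<eta> * q ^ p) * ennreal_powr (emeasure M (shadow \<G>)) (1 / q)"
        by (rule bounds(2)) (use that in auto)
      also have "\<dots> \<le> ennreal ((48 + 48 * A * real p ^ p) * inverse \<eta> * q ^ p) * ennreal_powr (emeasure M (shadow \<G>)) (1 / q)"
        using \<eta> that by (intro mult_right_mono ennreal_leI) auto
      finally show ?thesis .
    qed
    have "(\<integral>\<^sup>+x\<in>shadow \<G>. (ennreal_exp (ennreal (A powr (- 1 / real p))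
             * ennreal_powr (ennreal \<eta> * counting_function \<G> x) (1 / real p)) - 1) \<partial>M)
        \<le> ennreal 48 * emeasure M (shadow \<G>)"
      by (rule bounds(1))
    also have "\<dots> \<le> ennreal (48 + 48 * A * real p ^ p) * emeasure M (shadow \<G>)"
      using A by (intro mult_right_mono ennreal_leI) auto
    finally show ?thesis using Lq unfolding M_def p_def by blast
  qed
  have pos: "0 < A powr (- 1 / real p)" "0 < 48 + 48 * A * real p ^ p"
    using A by (auto intro: add_pos_nonneg)
  show ?thesis
  proof (rule exI[of _ "A powr (- 1 / real p)"], rule exI[of _ "48 + 48 * A * real p ^ p"],
      rule conjI[OF pos(1)], rule conjI[OF pos(2)], intro allI impI, goal_cases)
    case (1 d \<D> \<eta> \<G>)
    show ?case by (rule main[OF 1(3,4,6-9)])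
  qed
qed

end
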